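(* Let $\sigma>0$ and $K(t)=\exp\!\big(-\|t\|^2/(2\sigma^2)\big)$ on $\mathbb{R}^2$. Let $\mu=\sum_{j=1}^N a_j\delta_{t_j}$ with $a_j\in\mathbb{R}$ and distinct points $T=\{t_1,\dots,t_N\}\subset\mathbb{R}^2$, and let the samples be $y_i=(K*\mu)(s_i)=\sum_j a_jK(s_i-t_j)$ for all points $s_i$ of a uniform square grid $\{s_1+\zeta(p,q): p=0,\dots,S_1-1,\ q=0,\dots,S_2-1\}$ with grid spacing $\zeta>0$. Assume $T$ lies within the perimeter of the grid, i.e. in the closed rectangle whose corners are the corner points of the grid. Assume the pair $(\Delta(T),\zeta)$ satisfies condition (R). Then $\mu$ is the unique solution of $$\min_{\tilde\mu}\ \|\tilde\mu\|_{TV}\quad\text{subject to}\quad (K*\tilde\mu)(s_i)=y_i\ \text{ for all grid points } s_i,$$ where the minimum is over finite signed Borel measures $\tilde\mu$ on $\mathbb{R}^2$.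
   Context: The minimum separation of $T$ is $\Delta(T)=\min_{i\neq i'}\|t_i-t_{i'}\|$. The total variation norm is $\|\nu\|_{TV}=\sup\{\int f\,d\nu: f \text{ continuous}, |f|\le 1\}$; for an atomic measure $\sum a_j\delta_{t_j}$ it equals $\sum|a_j|$. Condition (R): $\zeta/\sigma$ lies in one of the following intervals and $\Delta(T)/\sigma$ is at least the corresponding value: $[0.10,0.45]\mapsto 4.10$; $[0.45,0.55]\mapsto 4.15$; $[0.55,0.60]\mapsto 4.20$; $[0.60,0.65]\mapsto 4.25$; $[0.65,0.70]\mapsto 4.30$; $[0.70,0.75]\mapsto 4.35$; $[0.75,0.80]\mapsto 4.40$; $[0.80,0.85]\mapsto 4.50$; $[0.85,0.89]\mapsto 4.55$. *)

theory Defs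
  imports "HOL-Analysis.Analysis"
begin

text \<open>A finite signed Borel measure on the plane is represented by a pair (M1, M2)
  of finite (positive) Borel measures, standing for M1 - M2.\<close>
type_synonym smeasure = "(real \<times> real) measure \<times> (real \<times> real) measure"

definition fin_signed :: "smeasure \<Rightarrow> bool" where
  "fin_signed \<nu> \<longleftrightarrow>
     sets (fst \<nu>) = sets (borel :: (real \<times> real) measure) \<and> finite_measure (fst \<nu>) \<and>
     sets (snd \<nu>) = sets (borel :: (real \<times> real) measure) \<and> finite_measure (snd \<nu>)"

definition sint :: "smeasure \<Rightarrow> (real \<times> real \<Rightarrow> real) \<Rightarrow> real" where
  "sint \<nu> f = (\<integral>x. f x \<partial>(fst \<nu>)) - (\<integral>x. f x \<partial>(snd \<nu>))"

definition same_smeasure :: "smeasure \<Rightarrow> smeasure \<Rightarrow> bool" where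
  "same_smeasure \<nu> \<mu> \<longleftrightarrow>
     (\<forall>A \<in> sets (borel :: (real \<times> real) measure).
        measure (fst \<nu>) A - measure (snd \<nu>) A = measure (fst \<mu>) A - measure (snd \<mu>) A)"

definition TV :: "smeasure \<Rightarrow> real" where
  "TV \<nu> = Sup {sint \<nu> f | f. continuous_on UNIV f \<and> (\<forall>x. \<bar>f x\<bar> \<le> 1)}"

definition gauss :: "real \<Rightarrow> real \<times> real \<Rightarrow> real" where
  "gauss \<sigma> t = exp (- (norm t * norm t) / (2 * (\<sigma> * \<sigma>)))"

definition conv :: "real \<Rightarrow> smeasure \<Rightarrow> real \<times> real \<Rightarrow> real" where
  "conv \<sigma> \<nu> s = sint \<nu> (\<lambda>t. gauss \<sigma> (s - t))"

definition atomic :: "nat \<Rightarrow> (nat \<Rightarrow> real \<times> real) \<Rightarrow> (nat \<Rightarrow> real) \<Rightarrow> (real \<times> real) measure" where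
  "atomic N t w = measure_of UNIV (sets borel)
      (\<lambda>A. \<Sum>j\<in>{j. j < N \<and> t j \<in> A}. ennreal (w j))"

definition spikes :: "nat \<Rightarrow> (nat \<Rightarrow> real \<times> real) \<Rightarrow> (nat \<Rightarrow> real) \<Rightarrow> smeasure" where
  "spikes N t a = (atomic N t (\<lambda>j. max (a j) 0), atomic N t (\<lambda>j. max (- a j) 0))"

text \<open>Minimum separation; equals \<infinity> when T has fewer than two points.\<close>
definition min_sep :: "(real \<times> real) set \<Rightarrow> ereal" where
  "min_sep T = Inf {ereal (dist x y) | x y. x \<in> T \<and> y \<in> T \<and> x \<noteq> y}"

text \<open>Condition (R), in terms of r = \<zeta>/\<sigma> and d = \<Delta>(T)/\<sigma>.\<close>
definition cond_R :: "real \<Rightarrow> ereal \<Rightarrow> bool" where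
  "cond_R r d \<longleftrightarrow>
     (0.10 \<le> r \<and> r \<le> 0.45 \<and> d \<ge> 4.10) \<or>
     (0.45 \<le> r \<and> r \<le> 0.55 \<and> d \<ge> 4.15) \<or>
     (0.55 \<le> r \<and> r \<le> 0.60 \<and> d \<ge> 4.20) \<or>
     (0.60 \<le> r \<and> r \<le> 0.65 \<and> d \<ge> 4.25) \<or>
     (0.65 \<le> r \<and> r \<le> 0.70 \<and> d \<ge> 4.30) \<or>
     (0.70 \<le> r \<and> r \<le> 0.75 \<and> d \<ge> 4.35) \<or>
     (0.75 \<le> r \<and> r \<le> 0.80 \<and> d \<ge> 4.40) \<or>
     (0.80 \<le> r \<and> r \<le> 0.85 \<and> d \<ge> 4.50) \<or>
     (0.85 \<le> r \<and> r \<le> 0.89 \<and> d \<ge> 4.55)"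

definition grid :: "real \<times> real \<Rightarrow> real \<Rightarrow> nat \<Rightarrow> nat \<Rightarrow> (real \<times> real) set" where
  "grid s1 \<zeta> S1 S2 = {(fst s1 + \<zeta> * real p, snd s1 + \<zeta> * real q) | p q. p < S1 \<and> q < S2}"

end

theory Submission
  imports Defs "HOL-Probability.Hoeffding"
begin

text \<open>
  The proof constructs, for every sign pattern, a dual certificate: a combination q of the sampled kernels
  with q = 1 or -1 at the spikes as prescribed and |q| < 1 elsewhere. After rescaling to \<open>\<sigma> = 1\<close>, let r
  be the grid spacing. In one coordinate a spike lies in a grid cell at distances A and B from the two
  end points, A + B = r. The two kernels centred there span a bump (value 1, slope 0 at the spike) and a wave
  (value 0, slope 1). By Hoeffding's lemma the bump is at most \<open>exp (-\<kappa> h\<^sup>2 / 2)\<close> with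
  \<open>\<kappa> = 1 - r\<^sup>2 / 4\<close>, and the wave is at most 2.12 |h| times this Gaussian. All nine cases of condition (R)
  give \<open>\<kappa> \<Delta>\<^sup>2 \<ge> 15.9\<close>, so in the metric scaled by the square root of \<open>\<kappa>\<close> the spikes
  are more than 3.987 apart, and nothing else about (R) is needed.

  Near each spike q is a product bump plus small multiples of the two waves; the coefficients solve a
  linear system that is a small perturbation of the identity, and therefore differ from the prescribed signs by
  at most 0.006 and from 0 by at most 0.025. Far contributions are summed by cutting the plane into squares of diameter
  \<open>\<Delta>\<close>, each of which contains at most one spike. Within scaled distance 0.4 of a spike, |q| < 1
  follows from a second order Taylor expansion, further out from the sizes of the terms.

  If \<open>\<nu>\<close> is feasible and its total variation does not exceed that of the spikes, it maximizes
  the integral of q, so \<open>\<nu>\<close> annihilates all continuous g with |g| \<open>\<le>\<close> 1 - |q| and lives on the spikes;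
  a second certificate, for the signs of the difference of the weights, identifies the weights.
\<close>

subsection \<open>Elementary inequalities\<close>

text \<open>The kernels at hand are centred at grid points, not at spikes, so one kernel cannot
  prescribe value and slope of q at a spike; two per coordinate can. Relative to the spike, the
  kernel at offset \<open>a\<close> is a constant times
  \<open>exp (- h\<^sup>2 / 2) * exp (a * h)\<close>. Hence the bump is this Gaussian times the
  moment generating function of the centred two-point variable with values -A and B, and Hoeffding's
  bound \<open>exp (r\<^sup>2 * h\<^sup>2 / 8)\<close> does not depend on where in its cell the
  spike lies. The wave is a divided difference whose denominator r cancels in the estimates, so
  nothing degenerates for small r. Waves are there because |q| <= 1 with equality at the spikes
  forces a critical point at each spike. What decides the proof is the curvature budget near a
  spike, in multiples of the squared unscaled distance: the own bump contributes at least 0.994 *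
  0.48 * 0.801 > 0.382, while the own waves and the far atoms take away at most 0.05 + 0.315. The
  constant 3.987 is the three-digit number just below the square root of 15.9.\<close>

lemma exp_ge_taylor_pow16:
  fixes x :: real
  assumes "0 \<le> x"
  shows "(1 + x/16 + (x/16)\<^sup>2/2 + (x/16)^3/6 + (x/16)^4/24) ^ 16 \<le> exp x"
proof -
  have "(\<Sum>n<5. (x/16) ^ n /\<^sub>R fact n) \<le> (\<Sum>n. (x/16) ^ n /\<^sub>R fact n)"
  proof (rule sum_le_suminf)
    show "summable (\<lambda>n. (x/16) ^ n /\<^sub>R fact n)"
      by (rule summable_exp_generic)
  qed (use assms in auto)
  then have "(\<Sum>n<5. (x/16) ^ n /\<^sub>R fact n) \<le> exp (x/16)"
    unfolding exp_def .
  moreover have "(\<Sum>n<5. (x/16) ^ n /\<^sub>R fact n) = 1 + x/16 + (x/16)\<^sup>2/2 + (x/16)^3/6 + (x/16)^4/24"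
    by (simp add: lessThan_nat_numeral fact_numeral)
  ultimately have "1 + x/16 + (x/16)\<^sup>2/2 + (x/16)^3/6 + (x/16)^4/24 \<le> exp (x/16)"
    by simp
  then have "(1 + x/16 + (x/16)\<^sup>2/2 + (x/16)^3/6 + (x/16)^4/24) ^ 16 \<le> exp (x/16) ^ 16"
    using assms by (intro power_mono) auto
  also have "\<dots> = exp x"
    by (simp flip: exp_of_nat_mult)
  finally show ?thesis .
qed

text \<open>Serves for the decimal tables below: \<open>u\<close> is \<open>- x / 16\<close> rounded
  down and \<open>p\<close> the Taylor polynomial at \<open>u\<close> rounded down, so that the last
  premise compares short rational numbers. Dividing by 16 keeps \<open>u\<close> below 1 there,
  where degree 4 is accurate enough.\<close>

lemma exp_le_pow16:
  fixes x u p c :: real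
  assumes "16 * u \<le> - x" "0 \<le> u" "p \<le> 1 + u + u\<^sup>2/2 + u^3/6 + u^4/24" "0 \<le> p" "0 < c" "1 \<le> c * p ^ 16"
  shows "exp x \<le> c"
proof -
  have "p ^ 16 \<le> (1 + u + u\<^sup>2/2 + u^3/6 + u^4/24) ^ 16"
    using assms by (intro power_mono)
  also have "\<dots> \<le> exp (16 * u)"
    using exp_ge_taylor_pow16[of "16 * u"] assms by simp
  also have "\<dots> \<le> exp (- x)" using assms by simp
  finally have "1 \<le> c * exp (- x)"
    using assms(5,6) mult_left_mono[of "p ^ 16" "exp (- x)" c] by linarith
  then show ?thesis
    by (simp add: exp_minus field_simps)
qed

text \<open>Termwise comparison of the two odd power series: (2n+1)! >= 6^n n!, because (2n+3)(2n+2)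
  >= 6(n+1).\<close>

lemma sinh_le_exp_square:
  fixes y :: real
  assumes "0 \<le> y"
  shows "sinh y \<le> y * exp (y\<^sup>2 / 6)"
proof -
  have fact_ge: "6 ^ n * fact n \<le> (fact (2 * n + 1) :: real)" for n
  proof (induction n)
    case (Suc n)
    have "6 ^ Suc n * fact (Suc n) = (6 * (real n + 1)) * (6 ^ n * fact n :: real)"
      by (simp add: algebra_simps)
    also have "\<dots> \<le> (2 * real n + 3) * (2 * real n + 2) * fact (2 * n + 1)"
    proof (rule mult_mono)
      show "6 * (real n + 1) \<le> (2 * real n + 3) * (2 * real n + 2)"
        by (simp add: algebra_simps)
    qed (use Suc in auto)
    also have "\<dots> = fact (2 * Suc n + 1)"
      by (simp add: algebra_simps)
    finally show ?case .
  qed simp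
  have "(\<lambda>n. (\<lambda>n. if even n then 0 else y ^ n /\<^sub>R fact n) (2 * n + 1)) sums sinh y"
    using sinh_converges[of y] by (subst sums_mono_reindex) (auto simp: strict_mono_def elim!: oddE)
  then have s1: "(\<lambda>n. y ^ (2 * n + 1) /\<^sub>R fact (2 * n + 1)) sums sinh y"
    by simp
  have s2: "(\<lambda>n. y * ((y\<^sup>2 / 6) ^ n /\<^sub>R fact n)) sums (y * exp (y\<^sup>2 / 6))"
    by (intro sums_mult exp_converges)
  show ?thesis
  proof (rule sums_le[OF _ s1 s2])
    fix n
    have "y ^ (2 * n + 1) /\<^sub>R fact (2 * n + 1) = y ^ (2 * n + 1) / fact (2 * n + 1)"
      by (rule scaleR_conv_of_real[THEN trans]) (simp add: field_simps)
    also have "\<dots> \<le> y ^ (2 * n + 1) / (6 ^ n * fact n)"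
      using assms fact_ge by (intro divide_left_mono) auto
    also have "\<dots> = y * (y\<^sup>2) ^ n / (6 ^ n * fact n)"
      by (simp add: power_mult)
    also have "\<dots> = y * ((y\<^sup>2 / 6) ^ n /\<^sub>R fact n)"
      by (simp add: power_divide field_simps)
    finally show "y ^ (2 * n + 1) /\<^sub>R fact (2 * n + 1) \<le> y * ((y\<^sup>2 / 6) ^ n /\<^sub>R fact n)" .
  qed
qed

lemma exp_three_quarters_le: "exp (3/4 :: real) \<le> 2.12"
proof -
  have "exp (3/4 :: real) ^ 4 = exp 1 ^ 3"
    by (simp flip: exp_of_nat_mult)
  also have "\<dots> \<le> 2.72 ^ 3"
    using e_less_272 by (intro power_mono) auto
  also have "\<dots> \<le> 2.12 ^ 4"
    by (simp add: power_divide)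
  finally show ?thesis
    by (subst (asm) power_mono_iff) auto
qed

lemma exp_two_le: "exp (2::real) \<le> 7.4"
proof -
  have "exp (2::real) = exp 1 ^ 2"
    by (simp flip: exp_of_nat_mult)
  also have "\<dots> \<le> 2.72 ^ 2"
    using e_less_272 by (intro power_mono) auto
  finally show ?thesis
    by (simp add: power_divide)
qed

text \<open>With exp x - 1 = 2 exp(x/2) sinh(x/2), the sinh bound leaves x exp(x/2 + x^2/24), and (x
  - 3)^2 >= 0 moves the linear term into x^2/8 at the price of exp(3/4) <= 2.12. The exponent x^2/8
  is that of Hoeffding's lemma, so waves and bumps share an envelope.\<close>

lemma exp_minus_one_le_gauss:
  fixes x :: real
  assumes "0 \<le> x"
  shows "exp x - 1 \<le> 2.12 * x * exp (x\<^sup>2 / 8)"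
proof -
  have "exp x - 1 = 2 * exp (x/2) * sinh (x/2)"
    by (simp add: sinh_def algebra_simps flip: exp_add)
  also have "\<dots> \<le> 2 * exp (x/2) * (x/2 * exp ((x/2)\<^sup>2 / 6))"
    using assms by (intro mult_left_mono sinh_le_exp_square) auto
  also have "\<dots> = x * exp (x/2 + x\<^sup>2/24)"
    by (simp add: exp_add power2_eq_square)
  also have "\<dots> \<le> x * exp (3/4 + x\<^sup>2/8)"
  proof -
    have "0 \<le> (x - 3)\<^sup>2" by simp
    then show ?thesis
      using assms by (intro mult_left_mono) (auto simp: power2_eq_square algebra_simps)
  qed
  also have "\<dots> = x * exp (x\<^sup>2/8) * exp (3/4)"
    by (simp add: exp_add)
  also have "\<dots> \<le> x * exp (x\<^sup>2/8) * 2.12"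
    using assms exp_three_quarters_le by (intro mult_left_mono) auto
  finally show ?thesis by (simp add: algebra_simps)
qed

text \<open>From x <= 2 + x^2/8, which is (x - 4)^2 >= 0; 7.4 bounds exp 2.\<close>

lemma exp_le_gauss:
  fixes x :: real
  shows "exp x \<le> 7.4 * exp (x\<^sup>2 / 8)"
proof -
  have "0 \<le> (x - 4)\<^sup>2" by simp
  then have "exp x \<le> exp (2 + x\<^sup>2 / 8)"
    by (auto simp: power2_eq_square algebra_simps)
  also have "\<dots> \<le> 7.4 * exp (x\<^sup>2 / 8)"
    using exp_two_le by (simp add: exp_add)
  finally show ?thesis .
qed

text \<open>Divided by A + B, the left side is the moment generating function of the centred
  variable taking -A with probability B/(A+B) and B with probability A/(A+B), so this is Hoeffding's
  lemma for an interval of length A + B. Negative h is reduced to positive h by exchanging A and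
  B.\<close>

lemma two_point_mgf_le:
  fixes A B h :: real
  assumes "0 \<le> A" "0 \<le> B" "0 < A + B"
  shows "B * exp (- A * h) + A * exp (B * h) \<le> (A + B) * exp ((A + B)\<^sup>2 * h\<^sup>2 / 8)"
proof -
  have *: "B * exp (- A * h) + A * exp (B * h) \<le> (A + B) * exp ((A + B)\<^sup>2 * h\<^sup>2 / 8)"
    if "0 \<le> A" "0 \<le> B" "0 < A + B" "0 \<le> h" for A B h :: real
  proof -
    define p where "p = A / (A + B)"
    define H where "H = (A + B) * h"
    have H: "0 \<le> H" "0 \<le> p" using that by (auto simp: H_def p_def)
    have "- H * p + ln (1 + p * (exp H - 1)) \<le> H\<^sup>2 / 8"
      using Hoeffdings_lemma_aux[OF H] .
    moreover have pos: "0 < 1 + p * (exp H - 1)"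
      using H by (intro add_pos_nonneg mult_nonneg_nonneg) auto
    ultimately have "1 + p * (exp H - 1) \<le> exp (H\<^sup>2 / 8 + H * p)"
      by (subst ln_le_cancel_iff[symmetric]) auto
    then have "(1 + p * (exp H - 1)) * exp (- (H * p)) \<le> exp (H\<^sup>2 / 8 + H * p) * exp (- (H * p))"
      by (intro mult_right_mono) auto
    also have "\<dots> = exp (H\<^sup>2 / 8)" by (simp flip: exp_add)
    finally have "(1 + p * (exp H - 1)) * exp (- (H * p)) \<le> exp (H\<^sup>2 / 8)" .
    then have "(A + B) * ((1 + p * (exp H - 1)) * exp (- (H * p))) \<le> (A + B) * exp (H\<^sup>2 / 8)"
      using that by (intro mult_left_mono) auto
    moreover have "H * p = A * h" using that by (simp add: H_def p_def)
    moreover have "exp H * exp (- (A * h)) = exp (B * h)"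
      by (simp add: H_def algebra_simps flip: exp_add)
    moreover have "(A + B) * ((1 + p * (exp H - 1)) * e) = B * e + A * (exp H * e)" for e
      using that by (simp add: p_def field_simps)
    ultimately have "B * exp (- (A * h)) + A * exp (B * h) \<le> (A + B) * exp (H\<^sup>2 / 8)"
      by simp
    then show ?thesis
      by (simp add: H_def power_mult_distrib)
  qed
  show ?thesis
  proof (cases "0 \<le> h")
    case True
    with assms show ?thesis by (intro *)
  next
    case False
    then have "A * exp (- B * - h) + B * exp (A * - h) \<le> (B + A) * exp ((B + A)\<^sup>2 * (- h)\<^sup>2 / 8)"
      using assms by (intro *) auto
    then show ?thesis by (simp add: ac_simps)
  qed
qed

subsection \<open>One-dimensional bumps and waves\<close>

text \<open>Here h is the offset from the spike, whose neighbouring grid points lie at -A and B. Up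
  to constants, \<open>exp (- A * h)\<close> and \<open>exp (B * h)\<close> are the kernels centred
  there with the factor \<open>exp (- h\<^sup>2 / 2)\<close> removed. This combination has value 1
  and slope 0 at h = 0, and \<open>wave_factor\<close> has value 0 and slope 1.\<close>

definition bump_factor :: "real \<Rightarrow> real \<Rightarrow> real \<Rightarrow> real" where
  "bump_factor A B h = (B * exp (- A * h) + A * exp (B * h)) / (A + B)"

definition wave_factor :: "real \<Rightarrow> real \<Rightarrow> real \<Rightarrow> real" where
  "wave_factor A B h = (exp (B * h) - exp (- A * h)) / (A + B)"

definition wave_factor' :: "real \<Rightarrow> real \<Rightarrow> real \<Rightarrow> real" where
  "wave_factor' A B h = (B * exp (B * h) + A * exp (- A * h)) / (A + B)"

definition bump :: "real \<Rightarrow> real \<Rightarrow> real \<Rightarrow> real" where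
  "bump A B h = exp (- h\<^sup>2 / 2) * bump_factor A B h"

text \<open>Closed forms for the derivatives exist because \<open>exp (- A * h)\<close> and
  \<open>exp (B * h)\<close> solve y'' = (B - A) y' + A B y, and the derivative of
  \<open>bump_factor\<close> is A B times \<open>wave_factor\<close>.\<close>

definition bump' :: "real \<Rightarrow> real \<Rightarrow> real \<Rightarrow> real" where
  "bump' A B h = exp (- h\<^sup>2 / 2) * (A * B * wave_factor A B h - h * bump_factor A B h)"

definition bump'' :: "real \<Rightarrow> real \<Rightarrow> real \<Rightarrow> real" where
  "bump'' A B h = exp (- h\<^sup>2 / 2) *
     (A * B * wave_factor' A B h - 2 * h * (A * B * wave_factor A B h) + (h\<^sup>2 - 1) * bump_factor A B h)"

definition wave :: "real \<Rightarrow> real \<Rightarrow> real \<Rightarrow> real" where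
  "wave A B h = exp (- h\<^sup>2 / 2) * wave_factor A B h"

definition wave' :: "real \<Rightarrow> real \<Rightarrow> real \<Rightarrow> real" where
  "wave' A B h = exp (- h\<^sup>2 / 2) * (wave_factor' A B h - h * wave_factor A B h)"

definition wave'' :: "real \<Rightarrow> real \<Rightarrow> real \<Rightarrow> real" where
  "wave'' A B h = exp (- h\<^sup>2 / 2) *
     ((B - A - 2 * h) * wave_factor' A B h + (h\<^sup>2 - 1 + A * B) * wave_factor A B h)"

definition env :: "real \<Rightarrow> real \<Rightarrow> real" where
  "env r h = exp (- (1 - r\<^sup>2 / 4) * h\<^sup>2 / 2)"

lemma exp_second_order_le:
  fixes x :: real
  assumes "\<bar>x\<bar> \<le> 1"
  shows "\<bar>exp x - 1 - x\<bar> \<le> x\<^sup>2"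
proof -
  have "exp x \<le> 1 + x + x\<^sup>2"
  proof (cases "0 \<le> x")
    case True
    then show ?thesis using exp_bound[of x] assms by simp
  next
    case False
    have "exp x * (1 - x) \<le> exp x * exp (- x)"
      using exp_ge_add_one_self[of "- x"] by (intro mult_left_mono) auto
    also have "\<dots> = 1" by (simp flip: exp_add)
    \<comment> \<open>The product equals 1 - x^3, which is at least 1 for negative x.\<close>
    also have "\<dots> \<le> (1 + x + x\<^sup>2) * (1 - x)"
      using False by (simp add: algebra_simps power2_eq_square mult_nonpos_nonneg zero_le_mult_iff)
    finally show ?thesis
      using False by (simp add: mult_le_cancel_right)
  qed
  then show ?thesis using exp_ge_add_one_self[of x] by linarith
qed

locale cell =
  fixes A B r :: real
  assumes A_nonneg: "0 \<le> A" and B_nonneg: "0 \<le> B" and r_eq: "A + B = r"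
    and r_pos: "0 < r" and r_le: "r \<le> 0.89"
begin

lemma env_eq: "env r h = exp (- h\<^sup>2 / 2) * exp (r\<^sup>2 * h\<^sup>2 / 8)"
  unfolding env_def by (simp add: field_simps flip: exp_add)

lemma A_le: "A \<le> r" and B_le: "B \<le> r"
  using A_nonneg B_nonneg r_eq by auto

lemma bump_factor_le: "bump_factor A B h \<le> exp (r\<^sup>2 * h\<^sup>2 / 8)"
  using two_point_mgf_le[of A B h] A_nonneg B_nonneg r_eq r_pos
  by (simp add: bump_factor_def pos_divide_le_eq mult.commute)

lemma bump_factor_ge: "1 \<le> bump_factor A B h"
proof -
  have "1 + (- A * h) \<le> exp (- A * h)" "1 + B * h \<le> exp (B * h)"
    by (rule exp_ge_add_one_self)+
  then have "B * (1 + (- A * h)) + A * (1 + B * h) \<le> B * exp (- A * h) + A * exp (B * h)"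
    using A_nonneg B_nonneg by (intro add_mono mult_left_mono)
  moreover have "B * (1 + (- A * h)) + A * (1 + B * h) = r"
    using r_eq by (simp add: algebra_simps)
  ultimately have "r \<le> B * exp (- A * h) + A * exp (B * h)"
    by simp
  then show ?thesis
    using r_pos unfolding bump_factor_def r_eq by simp
qed

lemma wave_factor_sgn: "0 \<le> h * wave_factor A B h"
proof (cases "0 \<le> h")
  case True
  then have "- A * h \<le> 0" "0 \<le> B * h" using A_nonneg B_nonneg by auto
  then have "exp (- A * h) \<le> exp (B * h)" by (meson exp_le_cancel_iff order_trans)
  with True show ?thesis using r_pos r_eq by (simp add: wave_factor_def)
next
  case False
  then have "0 \<le> - A * h" "B * h \<le> 0" using A_nonneg B_nonneg by (auto simp: mult_le_0_iff)
  then have "exp (B * h) \<le> exp (- A * h)" by (meson exp_le_cancel_iff order_trans)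
  with False show ?thesis using r_pos r_eq by (simp add: wave_factor_def zero_le_mult_iff divide_le_0_iff)
qed

text \<open>Pulling out the smaller exponential, which is at most 1, leaves exp(r|h|) - 1. The
  factor r of its linear bound cancels the division by A + B = r.\<close>

lemma wave_factor_le: "\<bar>wave_factor A B h\<bar> \<le> 2.12 * \<bar>h\<bar> * exp (r\<^sup>2 * h\<^sup>2 / 8)"
proof -
  have "\<bar>exp (B * h) - exp (- A * h)\<bar> \<le> exp (r * \<bar>h\<bar>) - 1"
  proof (cases "0 \<le> h")
    case True
    then have "exp (- A * h) \<le> 1" using A_nonneg by simp
    have "1 \<le> exp (B * h)" using True B_nonneg by simp
    have "exp (B * h) - exp (- A * h) = exp (- A * h) * (exp (r * h) - 1)"
      by (simp add: r_eq[symmetric] algebra_simps flip: exp_add)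
    also have "\<dots> \<le> 1 * (exp (r * h) - 1)"
      using \<open>exp (- A * h) \<le> 1\<close> True r_pos by (intro mult_right_mono) auto
    finally show ?thesis
      using True \<open>exp (- A * h) \<le> 1\<close> \<open>1 \<le> exp (B * h)\<close> by simp
  next
    case False
    then have "exp (B * h) \<le> 1" using B_nonneg by (simp add: mult_le_0_iff)
    have "1 \<le> exp (- A * h)" using False A_nonneg by (simp add: mult_le_0_iff)
    have "exp (- A * h) - exp (B * h) = exp (B * h) * (exp (r * - h) - 1)"
      by (simp add: r_eq[symmetric] algebra_simps flip: exp_add)
    also have "\<dots> \<le> 1 * (exp (r * - h) - 1)"
      using \<open>exp (B * h) \<le> 1\<close> False r_pos by (intro mult_right_mono) (auto simp: mult_le_0_iff)
    finally show ?thesis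
      using False \<open>exp (B * h) \<le> 1\<close> \<open>1 \<le> exp (- A * h)\<close> by simp
  qed
  also have "\<dots> \<le> 2.12 * (r * \<bar>h\<bar>) * exp ((r * \<bar>h\<bar>)\<^sup>2 / 8)"
    using r_pos by (intro exp_minus_one_le_gauss) simp
  finally have "\<bar>exp (B * h) - exp (- A * h)\<bar> / r \<le> 2.12 * (r * \<bar>h\<bar>) * exp ((r * \<bar>h\<bar>)\<^sup>2 / 8) / r"
    using r_pos by (intro divide_right_mono) auto
  then show ?thesis
    using r_pos r_eq by (simp add: wave_factor_def power_mult_distrib)
qed

lemma wave_factor'_le: "\<bar>wave_factor' A B h\<bar> \<le> exp (r * \<bar>h\<bar>)"
  and wave_factor'_nonneg: "0 \<le> wave_factor' A B h"
proof -
  have "B * h \<le> r * \<bar>h\<bar>" "- A * h \<le> r * \<bar>h\<bar>"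
    using A_nonneg B_nonneg A_le B_le
    by (smt (verit) abs_ge_self abs_ge_minus_self mult_left_mono mult_right_mono abs_ge_zero mult_minus_left mult_minus_right)+
  then have "B * exp (B * h) + A * exp (- A * h) \<le> B * exp (r * \<bar>h\<bar>) + A * exp (r * \<bar>h\<bar>)"
    using A_nonneg B_nonneg by (intro add_mono mult_left_mono) auto
  also have "\<dots> = r * exp (r * \<bar>h\<bar>)" by (simp add: r_eq[symmetric] algebra_simps)
  finally show "\<bar>wave_factor' A B h\<bar> \<le> exp (r * \<bar>h\<bar>)"
    using A_nonneg B_nonneg r_pos r_eq by (simp add: wave_factor'_def pos_divide_le_eq mult.commute)
  show "0 \<le> wave_factor' A B h"
    using A_nonneg B_nonneg by (simp add: wave_factor'_def)
qed

lemma wave_factor'_le_gauss: "\<bar>wave_factor' A B h\<bar> \<le> 7.4 * exp (r\<^sup>2 * h\<^sup>2 / 8)"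
  using wave_factor'_le[of h] exp_le_gauss[of "r * \<bar>h\<bar>"] by (simp add: power_mult_distrib)

(* The left-hand side is the derivative of the bump factor, so the bump decreases away from its centre. *)
lemma slope_le:
  "\<bar>A * B * wave_factor A B h\<bar> \<le> \<bar>h\<bar> * bump_factor A B h"
proof (cases "0 \<le> h")
  case True
  have "exp (B * h) - exp (- A * h) = exp (B * h) * (1 - exp (- (r * h)))"
    by (simp add: r_eq[symmetric] algebra_simps flip: exp_add)
  also have "\<dots> \<le> exp (B * h) * (r * h)"
    using exp_ge_add_one_self[of "- (r * h)"] by (intro mult_left_mono) auto
  finally have "A * B * (exp (B * h) - exp (- A * h)) \<le> A * B * (exp (B * h) * (r * h))"
    using A_nonneg B_nonneg by (intro mult_left_mono) auto
  also have "\<dots> = (B * r) * (h * (A * exp (B * h)))" by simp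
  also have "\<dots> \<le> 1 * (h * (A * exp (B * h)))"
    using True A_nonneg mult_mono[of B 1 r 1] B_le r_le B_nonneg r_pos by (intro mult_right_mono) auto
  also have "\<dots> \<le> h * (B * exp (- A * h) + A * exp (B * h))"
    using True B_nonneg by (simp add: algebra_simps)
  finally have "A * B * wave_factor A B h \<le> h * bump_factor A B h"
    using r_pos r_eq by (simp add: wave_factor_def bump_factor_def divide_right_mono)
  moreover have "0 \<le> A * B * wave_factor A B h"
    using wave_factor_sgn[of h] True A_nonneg B_nonneg
    by (cases "h = 0") (simp add: wave_factor_def, simp add: zero_le_mult_iff)
  ultimately show ?thesis using True by simp
next
  case False
  have "exp (- A * h) - exp (B * h) = exp (- A * h) * (1 - exp (- (r * - h)))"
    by (simp add: r_eq[symmetric] algebra_simps flip: exp_add)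
  moreover have "1 - exp (- (r * - h)) \<le> r * - h"
    using exp_ge_add_one_self[of "- (r * - h)"] by linarith
  then have "exp (- A * h) * (1 - exp (- (r * - h))) \<le> exp (- A * h) * (r * - h)"
    by (intro mult_left_mono) auto
  ultimately have "exp (- A * h) - exp (B * h) \<le> exp (- A * h) * (r * - h)"
    by simp
  then have "A * B * (exp (- A * h) - exp (B * h)) \<le> A * B * (exp (- A * h) * (r * - h))"
    using A_nonneg B_nonneg by (intro mult_left_mono) auto
  also have "\<dots> = (A * r) * (- h * (B * exp (- A * h)))" by simp
  also have "\<dots> \<le> 1 * (- h * (B * exp (- A * h)))"
    using False B_nonneg mult_mono[of A 1 r 1] A_le r_le A_nonneg r_pos
    by (intro mult_right_mono) (auto simp: mult_le_0_iff)
  also have "\<dots> \<le> - h * (B * exp (- A * h) + A * exp (B * h))"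
    using False A_nonneg by (simp add: algebra_simps mult_le_0_iff)
  finally have "A * B * (exp (- A * h) - exp (B * h)) / r \<le> - h * (B * exp (- A * h) + A * exp (B * h)) / r"
    using r_pos by (intro divide_right_mono) auto
  then have "- (A * B * wave_factor A B h) \<le> - h * bump_factor A B h"
    unfolding wave_factor_def bump_factor_def r_eq by (simp add: algebra_simps diff_divide_distrib add_divide_distrib)
  moreover have "A * B * wave_factor A B h \<le> 0"
    using wave_factor_sgn[of h] False A_nonneg B_nonneg by (auto simp: zero_le_mult_iff mult_le_0_iff)
  ultimately show ?thesis using False by simp
qed

lemma abs_exp_times_le:
  assumes "\<bar>X\<bar> \<le> c * exp (r\<^sup>2 * h\<^sup>2 / 8)"
  shows "\<bar>exp (- h\<^sup>2 / 2) * X\<bar> \<le> c * env r h"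
  using mult_left_mono[OF assms, of "exp (- h\<^sup>2 / 2)"] by (simp add: env_eq abs_mult mult_ac)

lemma bump_le: "\<bar>bump A B h\<bar> \<le> env r h"
  using abs_exp_times_le[of "bump_factor A B h" 1 h] bump_factor_le[of h] bump_factor_ge[of h]
  by (simp add: bump_def)

lemma bump_ge: "exp (- h\<^sup>2 / 2) \<le> bump A B h"
  using mult_left_mono[OF bump_factor_ge[of h], of "exp (- h\<^sup>2 / 2)"] by (simp add: bump_def)

text \<open>The two terms have the same sign and, by \<open>slope_le\<close>, the first is the
  smaller in modulus, so their difference is bounded by the second alone.\<close>

lemma bump'_le: "\<bar>bump' A B h\<bar> \<le> \<bar>h\<bar> * env r h"
proof -
  have "\<bar>A * B * wave_factor A B h - h * bump_factor A B h\<bar> \<le> \<bar>h\<bar> * bump_factor A B h"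
  proof (cases "0 \<le> h")
    case True
    moreover have "0 \<le> A * B * wave_factor A B h"
      using wave_factor_sgn[of h] True A_nonneg B_nonneg
      by (cases "h = 0") (simp add: wave_factor_def, simp add: zero_le_mult_iff)
    ultimately show ?thesis using slope_le[of h] by simp
  next
    case False
    moreover have "A * B * wave_factor A B h \<le> 0"
      using wave_factor_sgn[of h] False A_nonneg B_nonneg by (auto simp: zero_le_mult_iff mult_le_0_iff)
    ultimately show ?thesis using slope_le[of h] by simp
  qed
  also have "\<dots> \<le> \<bar>h\<bar> * exp (r\<^sup>2 * h\<^sup>2 / 8)"
    by (intro mult_left_mono bump_factor_le) auto
  finally show ?thesis
    unfolding bump'_def by (rule abs_exp_times_le)
qed

text \<open>Again signs matter: with p the bump factor, the first term lies in [0, p], and h times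
  the slope lies in [0, h^2 p]. The triangle inequality alone would give 2 + 3h^2 in place of 1 +
  h^2.\<close>

lemma bump''_le: "\<bar>bump'' A B h\<bar> \<le> (1 + h\<^sup>2) * env r h"
proof -
  let ?p = "bump_factor A B h" and ?s = "A * B * wave_factor A B h" and ?t = "A * B * wave_factor' A B h"
  have "0 \<le> ?t" using A_nonneg B_nonneg wave_factor'_nonneg[of h] by simp
  have "?t \<le> ?p"
  proof -
    have "A\<^sup>2 \<le> 1" "B\<^sup>2 \<le> 1"
      using A_nonneg A_le B_nonneg B_le r_le by (auto intro!: power_le_one)
    then have "(B * exp (- A * h)) * A\<^sup>2 + (A * exp (B * h)) * B\<^sup>2
        \<le> (B * exp (- A * h)) * 1 + (A * exp (B * h)) * 1"
      using A_nonneg B_nonneg by (intro add_mono mult_left_mono) auto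
    then have "((B * exp (- A * h)) * A\<^sup>2 + (A * exp (B * h)) * B\<^sup>2) / r \<le> (B * exp (- A * h) + A * exp (B * h)) / r"
      using r_pos by (intro divide_right_mono) auto
    then show ?thesis
      unfolding wave_factor'_def bump_factor_def r_eq
      by (simp add: power2_eq_square algebra_simps)
  qed
  have hs: "0 \<le> h * ?s" "h * ?s \<le> h\<^sup>2 * ?p"
  proof -
    have "0 \<le> A * B * (h * wave_factor A B h)" using wave_factor_sgn[of h] A_nonneg B_nonneg by simp
    then show "0 \<le> h * ?s" by (simp add: mult_ac)
    have "h * ?s \<le> \<bar>h\<bar> * \<bar>?s\<bar>" by (metis abs_ge_self abs_mult)
    also have "\<dots> \<le> \<bar>h\<bar> * (\<bar>h\<bar> * ?p)" by (intro mult_left_mono slope_le) auto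
    finally show "h * ?s \<le> h\<^sup>2 * ?p" by (simp add: power2_eq_square algebra_simps)
  qed
  have "0 \<le> ?p" "0 \<le> h\<^sup>2 * ?p" using bump_factor_ge[of h] by auto
  have "\<bar>?t - 2 * (h * ?s) + (h\<^sup>2 - 1) * ?p\<bar> \<le> (1 + h\<^sup>2) * ?p"
  proof -
    have "(h\<^sup>2 - 1) * ?p = h\<^sup>2 * ?p - ?p" "(1 + h\<^sup>2) * ?p = ?p + h\<^sup>2 * ?p" by (auto simp: algebra_simps)
    then show ?thesis
      using hs \<open>0 \<le> ?t\<close> \<open>?t \<le> ?p\<close> \<open>0 \<le> ?p\<close> \<open>0 \<le> h\<^sup>2 * ?p\<close> by linarith
  qed
  also have "\<dots> \<le> (1 + h\<^sup>2) * exp (r\<^sup>2 * h\<^sup>2 / 8)"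
    by (intro mult_left_mono bump_factor_le) auto
  finally have "\<bar>?t - 2 * h * ?s + (h\<^sup>2 - 1) * ?p\<bar> \<le> (1 + h\<^sup>2) * exp (r\<^sup>2 * h\<^sup>2 / 8)"
    by (simp only: mult.assoc)
  then show ?thesis
    unfolding bump''_def by (rule abs_exp_times_le)
qed

lemma wave_le: "\<bar>wave A B h\<bar> \<le> 2.12 * \<bar>h\<bar> * env r h"
  unfolding wave_def by (rule abs_exp_times_le[OF wave_factor_le])

lemma wave'_le: "\<bar>wave' A B h\<bar> \<le> (7.4 + 2.12 * h\<^sup>2) * env r h"
proof -
  have "\<bar>h * wave_factor A B h\<bar> \<le> \<bar>h\<bar> * (2.12 * \<bar>h\<bar> * exp (r\<^sup>2 * h\<^sup>2 / 8))"
    unfolding abs_mult by (intro mult_left_mono wave_factor_le) auto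
  also have "\<dots> = 2.12 * h\<^sup>2 * exp (r\<^sup>2 * h\<^sup>2 / 8)"
    by (simp add: power2_eq_square algebra_simps)
  finally have "\<bar>wave_factor' A B h - h * wave_factor A B h\<bar> \<le>
      7.4 * exp (r\<^sup>2 * h\<^sup>2 / 8) + 2.12 * h\<^sup>2 * exp (r\<^sup>2 * h\<^sup>2 / 8)"
    using wave_factor'_le_gauss[of h] by linarith
  then show ?thesis
    unfolding wave'_def by (intro abs_exp_times_le) (simp add: algebra_simps)
qed

lemma wave''_le: "\<bar>wave'' A B h\<bar> \<le> (7.4 * (0.89 + 2 * \<bar>h\<bar>) + 2.12 * \<bar>h\<bar> * (1 + h\<^sup>2)) * env r h"
proof -
  have "\<bar>B - A - 2 * h\<bar> \<le> 0.89 + 2 * \<bar>h\<bar>"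
    using A_nonneg B_nonneg A_le B_le r_le by linarith
  then have 1: "\<bar>(B - A - 2 * h) * wave_factor' A B h\<bar> \<le> (0.89 + 2 * \<bar>h\<bar>) * (7.4 * exp (r\<^sup>2 * h\<^sup>2 / 8))"
    unfolding abs_mult by (intro mult_mono wave_factor'_le_gauss) auto
  have "A * B \<le> 1"
    using mult_mono[of A 1 B 1] A_le B_le r_le A_nonneg B_nonneg by simp
  moreover have "0 \<le> A * B" using A_nonneg B_nonneg by simp
  ultimately have "\<bar>h\<^sup>2 - 1 + A * B\<bar> \<le> 1 + h\<^sup>2"
    using zero_le_power2[of h] by linarith
  then have 2: "\<bar>(h\<^sup>2 - 1 + A * B) * wave_factor A B h\<bar> \<le> (1 + h\<^sup>2) * (2.12 * \<bar>h\<bar> * exp (r\<^sup>2 * h\<^sup>2 / 8))"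
    unfolding abs_mult by (intro mult_mono wave_factor_le) auto
  show ?thesis
    unfolding wave''_def
    by (rule abs_exp_times_le, rule order_trans[OF abs_triangle_ineq], rule order_trans[OF add_mono[OF 1 2]])
       (simp add: algebra_simps)
qed

lemma bump_near: "\<bar>bump A B h\<bar> \<le> 1" "1 - bump A B h \<le> h\<^sup>2 / 2"
proof -
  have "r\<^sup>2 \<le> 1" using r_pos r_le by (auto intro!: power_le_one)
  then have "env r h \<le> 1" by (simp add: env_def mult_nonpos_nonneg)
  then show "\<bar>bump A B h\<bar> \<le> 1" using bump_le[of h] by linarith
  show "1 - bump A B h \<le> h\<^sup>2 / 2"
    using bump_ge[of h] exp_ge_add_one_self[of "- h\<^sup>2 / 2"] by simp
qed

text \<open>0.45 exceeds 0.4 * 1.118, the unscaled radius of the region treated by Taylor expansion.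
  The factor contributes A^2 + B^2 <= r^2 <= 0.89 r before division by r, the Gaussian contributes
  0.64 h^2 / 2, and 0.89 + 0.32 = 1.21.\<close>

lemma wave_near:
  assumes "\<bar>h\<bar> \<le> 0.45"
  shows "\<bar>wave A B h - h\<bar> \<le> 1.21 * h\<^sup>2"
proof -
  have le: "\<bar>a * h\<bar> \<le> 1" if "0 \<le> a" "a \<le> r" for a
  proof -
    have "\<bar>a\<bar> * \<bar>h\<bar> \<le> 0.89 * 0.45" using that r_le assms by (intro mult_mono) auto
    then show ?thesis by (simp add: abs_mult)
  qed
  have "\<bar>exp (B * h) - 1 - B * h\<bar> \<le> (B * h)\<^sup>2"
    by (intro exp_second_order_le le B_nonneg B_le)
  moreover have "\<bar>exp (- A * h) - 1 - (- A * h)\<bar> \<le> (- A * h)\<^sup>2"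
    using le[of A] A_nonneg A_le by (intro exp_second_order_le) auto
  ultimately have "\<bar>(exp (B * h) - exp (- A * h)) - r * h\<bar> \<le> (B * h)\<^sup>2 + (- A * h)\<^sup>2"
    unfolding r_eq[symmetric] distrib_right by linarith
  also have "\<dots> = (B\<^sup>2 + A\<^sup>2) * h\<^sup>2"
    by (simp add: power_mult_distrib algebra_simps)
  also have "\<dots> \<le>(r * r) * h\<^sup>2"
    unfolding r_eq[symmetric] using A_nonneg B_nonneg
    by (intro mult_right_mono) (auto simp: algebra_simps power2_eq_square)
  also have "\<dots> \<le>(r * 0.89) * h\<^sup>2"
    using r_le r_pos by (intro mult_right_mono mult_left_mono) auto
  also have "\<dots> = r * (0.89 * h\<^sup>2)" by simp
  also have "(exp (B * h) - exp (- A * h)) - r * h = r * (wave_factor A B h - h)"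
    unfolding wave_factor_def r_eq using r_pos by (simp add: field_simps)
  finally have wf: "\<bar>wave_factor A B h - h\<bar> \<le> 0.89 * h\<^sup>2"
    unfolding abs_mult using r_pos by simp
  have "h\<^sup>2 \<le> 81 / 400"
    unfolding power2_eq_square using mult_mono[OF assms assms] by (simp add: abs_mult[symmetric])
  then have "\<bar>wave_factor A B h - h\<bar> \<le> 19 / 100" using wf by simp
  moreover have "\<bar>h\<bar> \<le> 45 / 100" using assms by simp
  ultimately have "\<bar>wave_factor A B h\<bar> \<le> 64 / 100" by linarith
  then have "\<bar>wave_factor A B h\<bar> \<le> 0.64" by simp
  moreover
  have "\<bar>exp (- h\<^sup>2 / 2) - 1\<bar> \<le> h\<^sup>2 / 2"
    using exp_ge_add_one_self[of "- h\<^sup>2 / 2"] by simp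
  ultimately have "\<bar>exp (- h\<^sup>2 / 2) - 1\<bar> * \<bar>wave_factor A B h\<bar> \<le> h\<^sup>2 / 2 * 0.64"
    by (intro mult_mono) auto
  then have "\<bar>(exp (- h\<^sup>2 / 2) - 1) * wave_factor A B h\<bar> \<le> 0.32 * h\<^sup>2"
    by (simp add: abs_mult)
  moreover have "wave A B h - h = (wave_factor A B h - h) + (exp (- h\<^sup>2 / 2) - 1) * wave_factor A B h"
    by (simp add: wave_def algebra_simps)
  ultimately have "\<bar>wave A B h - h\<bar> \<le> 0.89 * h\<^sup>2 + 0.32 * h\<^sup>2"
    using wf by linarith
  then show ?thesis by (rule order_trans) simp
qed

end

section \<open>Derivatives of factors, bumps and waves\<close>

lemma bump_factor_has_derivative [derivative_intros]:
  "(f has_real_derivative f') (at x within S) \<Longrightarrow> 0 < A + B \<Longrightarrow>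
   ((\<lambda>x. bump_factor A B (f x)) has_real_derivative A * B * wave_factor A B (f x) * f') (at x within S)"
  unfolding bump_factor_def wave_factor_def
  by (rule derivative_eq_intros refl | assumption | simp)+ (simp add: field_simps)

lemma wave_factor_has_derivative [derivative_intros]:
  "(f has_real_derivative f') (at x within S) \<Longrightarrow> 0 < A + B \<Longrightarrow>
   ((\<lambda>x. wave_factor A B (f x)) has_real_derivative wave_factor' A B (f x) * f') (at x within S)"
  unfolding wave_factor'_def wave_factor_def
  by (rule derivative_eq_intros refl | assumption | simp)+ (simp add: field_simps)

lemma wave_factor'_has_derivative [derivative_intros]:
  "(f has_real_derivative f') (at x within S) \<Longrightarrow> 0 < A + B \<Longrightarrow>
   ((\<lambda>x. wave_factor' A B (f x)) has_real_derivative
     ((B - A) * wave_factor' A B (f x) + A * B * wave_factor A B (f x)) * f') (at x within S)"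
  unfolding wave_factor'_def wave_factor_def
  by (rule derivative_eq_intros refl | assumption | simp)+ (simp add: divide_inverse algebra_simps)

lemma bump_has_derivative [derivative_intros]:
  "(f has_real_derivative f') (at x within S) \<Longrightarrow> 0 < A + B \<Longrightarrow>
   ((\<lambda>x. bump A B (f x)) has_real_derivative bump' A B (f x) * f') (at x within S)"
  unfolding bump_def bump'_def
  by (rule derivative_eq_intros refl | assumption | simp)+ (simp add: algebra_simps)

lemma bump'_has_derivative [derivative_intros]:
  "(f has_real_derivative f') (at x within S) \<Longrightarrow> 0 < A + B \<Longrightarrow>
   ((\<lambda>x. bump' A B (f x)) has_real_derivative bump'' A B (f x) * f') (at x within S)"
  unfolding bump''_def bump'_def
  by (rule derivative_eq_intros refl | assumption | simp)+ (simp add: algebra_simps power2_eq_square)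

lemma wave_has_derivative [derivative_intros]:
  "(f has_real_derivative f') (at x within S) \<Longrightarrow> 0 < A + B \<Longrightarrow>
   ((\<lambda>x. wave A B (f x)) has_real_derivative wave' A B (f x) * f') (at x within S)"
  unfolding wave_def wave'_def
  by (rule derivative_eq_intros refl | assumption | simp)+ (simp add: algebra_simps)

lemma wave'_has_derivative [derivative_intros]:
  "(f has_real_derivative f') (at x within S) \<Longrightarrow> 0 < A + B \<Longrightarrow>
   ((\<lambda>x. wave' A B (f x)) has_real_derivative wave'' A B (f x) * f') (at x within S)"
  unfolding wave''_def wave'_def
  by (rule derivative_eq_intros refl | assumption | simp)+ (simp add: algebra_simps power2_eq_square)

subsection \<open>Linear systems and sums over separated points\<close>

text \<open>The iterates \<open>y n\<close> of the block operator applied to b decay like \<theta>^n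
  in the largest block norm, and their sum solves the system. Blocks are kept abstract because each
  spike carries a triple of unknowns, a value and a gradient, estimated through one joint
  norm.\<close>

lemma neumann_series_solution:
  fixes L :: "nat \<Rightarrow> nat \<Rightarrow> 'a::banach \<Rightarrow> 'a" and b :: "nat \<Rightarrow> 'a"
  assumes fin: "finite I"
    and lin: "\<And>j k. j \<in> I \<Longrightarrow> k \<in> I \<Longrightarrow> bounded_linear (L j k)"
    and bnd: "\<And>j k x. j \<in> I \<Longrightarrow> k \<in> I \<Longrightarrow> norm (L j k x) \<le> c j k * norm x"
    and nonneg: "\<And>j k. 0 \<le> c j k"
    and row: "\<And>j. j \<in> I \<Longrightarrow> (\<Sum>k\<in>I. c j k) \<le> \<theta>"
    and \<theta>: "0 \<le> \<theta>" "\<theta> < 1"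
  shows "\<exists>x. \<forall>j\<in>I. x j = b j + (\<Sum>k\<in>I. L j k (x k))"
proof -
  define y where "y = rec_nat b (\<lambda>n z j. \<Sum>k\<in>I. L j k (z k))"
  have y0: "y 0 = b" and yS: "y (Suc n) j = (\<Sum>k\<in>I. L j k (y n k))" for n j
    by (auto simp: y_def)
  define C where "C = (\<Sum>k\<in>I. norm (b k))"
  have C: "norm (b j) \<le> C" if "j \<in> I" for j
    unfolding C_def using fin that by (intro member_le_sum) auto
  have "0 \<le> C" by (simp add: C_def sum_nonneg)
  have y_le: "norm (y n j) \<le> C * \<theta> ^ n" if "j \<in> I" for n j
    using that
  proof (induction n arbitrary: j)
    case 0
    then show ?case using C by (simp add: y0)
  next
    case (Suc n)
    have "norm (y (Suc n) j) \<le> (\<Sum>k\<in>I. norm (L j k (y n k)))"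
      unfolding yS by (rule norm_sum)
    also have "\<dots> \<le> (\<Sum>k\<in>I. c j k * (C * \<theta> ^ n))"
      using Suc nonneg by (intro sum_mono order_trans[OF bnd] mult_left_mono) auto
    also have "\<dots> = (\<Sum>k\<in>I. c j k) * (C * \<theta> ^ n)"
      by (simp add: sum_distrib_right)
    also have "\<dots> \<le> \<theta> * (C * \<theta> ^ n)"
      using row[OF Suc.prems] \<open>0 \<le> C\<close> \<theta> by (intro mult_right_mono) auto
    finally show ?case by (simp add: mult_ac)
  qed
  have sm: "summable (\<lambda>n. y n j)" if "j \<in> I" for j
  proof (rule summable_comparison_test')
    show "summable (\<lambda>n. C * \<theta> ^ n)"
      using \<theta> by (intro summable_mult summable_geometric) auto
  qed (rule y_le[OF that])
  define x where "x j = (\<Sum>n. y n j)" for j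
  have "x j = b j + (\<Sum>k\<in>I. L j k (x k))" if "j \<in> I" for j
  proof -
    have "(\<lambda>n. L j k (y n k)) sums L j k (x k)" if "k \<in> I" for k
      unfolding x_def using bounded_linear.sums[OF lin[OF \<open>j \<in> I\<close> that]] sm[OF that]
      by (simp add: summable_sums)
    then have "(\<lambda>n. \<Sum>k\<in>I. L j k (y n k)) sums (\<Sum>k\<in>I. L j k (x k))"
      by (rule sums_sum)
    then have "(\<lambda>n. y (Suc n) j) sums (\<Sum>k\<in>I. L j k (x k))"
      by (simp add: yS)
    moreover have "(\<lambda>n. y (Suc n) j) sums (x j - b j)"
      using sm[OF that] by (subst sums_Suc_iff) (simp add: x_def y0 summable_sums)
    ultimately show ?thesis
      by (metis sums_unique2 add.commute diff_add_cancel)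
  qed
  then show ?thesis by blast
qed

(* Maps both [i, i + 1) and [- i - 1, - i), given by their floors, to i. *)
definition cell_index :: "int \<Rightarrow> nat" where
  "cell_index i = (if 0 \<le> i then nat i else nat (- i - 1))"

lemma cell_index_le:
  fixes u :: real and i :: int
  assumes "of_int i \<le> u" "u < of_int i + 1"
  shows "real (cell_index i) \<le> \<bar>u\<bar>"
  using assms by (auto simp: cell_index_def split: if_splits)

text \<open>For a >= 2 one has a^2 >= 4 + (a - 2), which reduces the sum to a geometric series of
  ratio at most 1/2.\<close>

lemma sum_powr_squares_le:
  fixes q :: real
  assumes "0 \<le> q" "q \<le> 1/2"
  shows "(\<Sum>a\<in>{2..n}. q ^ (a\<^sup>2)) \<le> 2 * q ^ 4"
proof -
  have "(\<Sum>a\<in>{2..n}. q ^ (a\<^sup>2)) \<le> (\<Sum>a\<in>{2..n}. q ^ 4 * q ^ (a - 2))"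
  proof (rule sum_mono)
    fix a assume a: "a \<in> {2..n}"
    then obtain m where m: "a = m + 2" by (metis add.commute atLeastAtMost_iff le_Suc_ex)
    have "4 + (a - 2) \<le> a\<^sup>2" by (simp add: m power2_eq_square)
    then show "q ^ (a\<^sup>2) \<le> q ^ 4 * q ^ (a - 2)"
      using assms by (subst power_add[symmetric]) (intro power_decreasing; simp)
  qed
  also have "\<dots> = q ^ 4 * (\<Sum>a\<in>{2..n}. q ^ (a - 2))"
    by (simp add: sum_distrib_left)
  also have "(\<Sum>a\<in>{2..n}. q ^ (a - 2)) \<le> 2"
  proof -
    have "(\<Sum>a\<in>{2..n}. q ^ (a - 2)) = (\<Sum>a<n - 1. q ^ a)"
      by (rule sum.reindex_bij_witness[of _ "\<lambda>a. a + 2" "\<lambda>a. a - 2"]) auto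
    also have "\<dots> \<le> (\<Sum>a<n - 1. (1/2) ^ a)"
      using assms by (intro sum_mono power_mono) auto
    also have "\<dots> \<le> 2"
      using geometric_sum[of "1/2 :: real" "n - 1"] by simp
    finally show ?thesis .
  qed
  then have "q ^ 4 * (\<Sum>a\<in>{2..n}. q ^ (a - 2)) \<le> q ^ 4 * 2"
    using assms by (intro mult_left_mono) auto
  finally show ?thesis by simp
qed

(* The plane is cut into squares of side d/sqrt 2 with t as a common corner, so that every square
   contains at most one of the points. *)

lemma separated_gauss_sum_le:
  fixes T :: "'i set" and p :: "'i \<Rightarrow> real \<times> real" and t :: "real \<times> real"
  assumes fin: "finite T" and "0 < d" "0 < c"
    and sep: "\<And>x y. x \<in> T \<Longrightarrow> y \<in> T \<Longrightarrow> x \<noteq> y \<Longrightarrow> d < dist (p x) (p y)"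
    and q: "q = exp (- c * d\<^sup>2 / 2)" "q \<le> 1/2"
    and G: "0 \<le> G0" "0 \<le> G1" "0 \<le> G2"
    and G0: "\<And>x. x \<in> T \<Longrightarrow> dist t (p x) \<le> d \<Longrightarrow> exp (- c * (dist t (p x))\<^sup>2) \<le> G0"
    and G1: "\<And>x. x \<in> T \<Longrightarrow> d\<^sup>2 / 2 \<le> (dist t (p x))\<^sup>2 \<Longrightarrow> exp (- c * (dist t (p x))\<^sup>2) \<le> G1"
    and G2: "\<And>x. x \<in> T \<Longrightarrow> d \<le> dist t (p x) \<Longrightarrow> exp (- c * (dist t (p x))\<^sup>2) \<le> G2"
  shows "(\<Sum>x\<in>T. exp (- c * (dist t (p x))\<^sup>2)) \<le> 4 * G0 + 8 * G1 + 4 * G2 + 32 * q ^ 4"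
proof -
  define s where "s = d / sqrt 2"
  have s: "0 < s" "s\<^sup>2 = d\<^sup>2 / 2" using \<open>0 < d\<close> by (auto simp: s_def power_divide)
  define X where "X x = (fst (p x) - fst t) / s" for x
  define Y where "Y x = (snd (p x) - snd t) / s" for x
  have dist_eq: "(dist t (p x))\<^sup>2 = s\<^sup>2 * ((X x)\<^sup>2 + (Y x)\<^sup>2)" for x
    using s(1) by (simp add: dist_prod_def dist_real_def X_def Y_def power_divide power2_commute field_simps)
  have dist_eq2: "(dist (p x) (p y))\<^sup>2 = s\<^sup>2 * ((X x - X y)\<^sup>2 + (Y x - Y y)\<^sup>2)" for x y
  proof -
    have "X x - X y = (fst (p x) - fst (p y)) / s" "Y x - Y y = (snd (p x) - snd (p y)) / s"
      by (auto simp: X_def Y_def diff_divide_distrib)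
    then show ?thesis
      using s(1) by (simp only:) (simp add: dist_prod_def dist_real_def power_divide distrib_left)
  qed
  define cl where "cl x = (\<lfloor>X x\<rfloor>, \<lfloor>Y x\<rfloor>)" for x
  \<comment> \<open>Points in one half-open unit square differ by less than 1 in both scaled
    coordinates, hence by less than s * sqrt 2 = d.\<close>
  have inj: "inj_on cl T"
  proof (rule inj_onI, rule ccontr)
    fix x y assume xy: "x \<in> T" "y \<in> T" "cl x = cl y" "x \<noteq> y"
    have "\<lfloor>X x\<rfloor> = \<lfloor>X y\<rfloor>" "\<lfloor>Y x\<rfloor> = \<lfloor>Y y\<rfloor>" using xy(3) by (auto simp: cl_def)
    then have "\<bar>X x - X y\<bar> < 1" "\<bar>Y x - Y y\<bar> < 1"
      by linarith+
    then have "(X x - X y)\<^sup>2 < 1" "(Y x - Y y)\<^sup>2 < 1"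
      by (simp_all add: abs_square_less_1)
    then have "(dist (p x) (p y))\<^sup>2 < s\<^sup>2 * 2"
      unfolding dist_eq2 using s(1) by (intro mult_strict_left_mono) auto
    also have "\<dots> = d\<^sup>2" by (simp add: s)
    finally have "dist (p x) (p y) < d"
      using \<open>0 < d\<close> by (simp add: power2_less_imp_less)
    with sep[OF xy(1,2,4)] show False by simp
  qed
  \<comment> \<open>Majorant by layers: of the sixteen squares with both indices at most 1, the four
    touching t get \<open>G0\<close>, the four diagonal ones, at distance at least d, get
    \<open>G2\<close>, and the other eight, at distance at least d / sqrt 2, get
    \<open>G1\<close>.\<close>
  define F where "F a b = (if a \<le> 1 \<and> b \<le> 1 then (if a = 0 \<and> b = 0 then G0 else if a = 1 \<and> b = 1 then G2 else G1)
      else q ^ (a\<^sup>2) * q ^ (b\<^sup>2))" for a b :: nat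
  have "0 \<le> q" using q by simp
  have F_nonneg: "0 \<le> F a b" for a b
    using G \<open>0 \<le> q\<close> by (auto simp: F_def)
  have F_le: "exp (- c * (dist t (p x))\<^sup>2) \<le> F (cell_index \<lfloor>X x\<rfloor>) (cell_index \<lfloor>Y x\<rfloor>)" if "x \<in> T" for x
  proof -
    define a b where "a = cell_index \<lfloor>X x\<rfloor>" and "b = cell_index \<lfloor>Y x\<rfloor>"
    have "real a \<le> \<bar>X x\<bar>" "real b \<le> \<bar>Y x\<bar>"
      unfolding a_def b_def by (rule cell_index_le; linarith)+
    then have ab: "(real a)\<^sup>2 \<le> (X x)\<^sup>2" "(real b)\<^sup>2 \<le> (Y x)\<^sup>2"
      using abs_le_square_iff by fastforce+
    have ge: "s\<^sup>2 * ((real a)\<^sup>2 + (real b)\<^sup>2) \<le> (dist t (p x))\<^sup>2"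
      unfolding dist_eq using ab by (intro mult_left_mono add_mono) auto
    consider "a = 0 \<and> b = 0" | "a = 1 \<and> b = 1" | "a \<le> 1 \<and> b \<le> 1 \<and> a + b = 1" | "\<not> (a \<le> 1 \<and> b \<le> 1)"
      by linarith
    then have "exp (- c * (dist t (p x))\<^sup>2) \<le> F a b"
    proof cases
      case 1
      have "\<bar>X x\<bar> \<le> 1" "\<bar>Y x\<bar> \<le> 1"
        using 1 unfolding a_def b_def cell_index_def by (auto split: if_splits simp: abs_le_iff; linarith)+
      then have "(X x)\<^sup>2 \<le> 1" "(Y x)\<^sup>2 \<le> 1"
        by (simp_all add: abs_square_le_1)
      then have "(dist t (p x))\<^sup>2 \<le> s\<^sup>2 * 2"
        unfolding dist_eq by (intro mult_left_mono) auto
      then have "dist t (p x) \<le> d"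
        using s \<open>0 < d\<close> power2_le_imp_le by fastforce
      then show ?thesis using G0[OF that] 1 by (simp add: F_def)
    next
      case 2
      have "d\<^sup>2 \<le> (dist t (p x))\<^sup>2" using ge 2 s by simp
      then have "d \<le> dist t (p x)" using power2_le_imp_le by fastforce
      then show ?thesis using G2[OF that] 2 by (simp add: F_def)
    next
      case 3
      then have "a = 0 \<and> b = 1 \<or> a = 1 \<and> b = 0" by arith
      then have "(real a)\<^sup>2 + (real b)\<^sup>2 = 1" by auto
      then have "d\<^sup>2 / 2 \<le> (dist t (p x))\<^sup>2" using ge s by simp
      then show ?thesis using G1[OF that] 3 by (auto simp: F_def)
    next
      case 4
      have "exp (- c * (dist t (p x))\<^sup>2) \<le> exp (- c * (s\<^sup>2 * ((real a)\<^sup>2 + (real b)\<^sup>2)))"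
        using ge \<open>0 < c\<close> by simp
      also have "\<dots> = exp (real (a\<^sup>2) * (- c * d\<^sup>2 / 2)) * exp (real (b\<^sup>2) * (- c * d\<^sup>2 / 2))"
        by (simp add: s algebra_simps flip: exp_add)
      also have "\<dots> = F a b"
        using 4 unfolding exp_of_nat_mult by (auto simp: F_def q)
      finally show ?thesis .
    qed
    then show ?thesis by (simp add: a_def b_def)
  qed
  obtain n where n: "cell_index \<lfloor>X x\<rfloor> \<le> n" "cell_index \<lfloor>Y x\<rfloor> \<le> n" if "x \<in> T" for x
  proof -
    define n where "n = Max (insert 0 ((\<lambda>x. cell_index \<lfloor>X x\<rfloor>) ` T \<union> (\<lambda>x. cell_index \<lfloor>Y x\<rfloor>) ` T))"
    show ?thesis
      by (rule that[of n]) (use fin in \<open>auto simp: n_def intro!: Max_ge\<close>)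
  qed
  define m where "m = n + 1"
  have "1 \<le> m" by (simp add: m_def)
  let ?J = "{- int n - 1..int n}"
  \<comment> \<open>Each layer index belongs to exactly two cells of an axis, which yields the
    factor 4 in the plane.\<close>
  have split: "(\<Sum>i\<in>?J. f (cell_index i)) = 2 * (\<Sum>a\<le>n. f a)" for f :: "nat \<Rightarrow> real"
  proof -
    have "(\<Sum>i\<in>?J. f (cell_index i)) = (\<Sum>i\<in>{0..int n}. f (cell_index i)) + (\<Sum>i\<in>{- int n - 1..-1}. f (cell_index i))"
      by (subst sum.union_disjoint[symmetric]) (auto intro!: arg_cong2[where f = sum])
    also have "(\<Sum>i\<in>{0..int n}. f (cell_index i)) = (\<Sum>a\<le>n. f a)"
      by (rule sum.reindex_bij_witness[of _ int nat]) (auto simp: cell_index_def)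
    also have "(\<Sum>i\<in>{- int n - 1..-1}. f (cell_index i)) = (\<Sum>a\<le>n. f a)"
      by (rule sum.reindex_bij_witness[of _ "\<lambda>a. - int a - 1" cell_index]) (auto simp: cell_index_def)
    finally show ?thesis by simp
  qed
  have "(\<Sum>x\<in>T. exp (- c * (dist t (p x))\<^sup>2)) \<le> (\<Sum>x\<in>T. F (cell_index (fst (cl x))) (cell_index (snd (cl x))))"
    by (intro sum_mono) (use F_le in \<open>simp add: cl_def\<close>)
  also have "\<dots> = (\<Sum>z\<in>cl ` T. F (cell_index (fst z)) (cell_index (snd z)))"
    by (simp add: sum.reindex[OF inj])
  also have "\<dots> \<le> (\<Sum>z\<in>?J \<times> ?J. F (cell_index (fst z)) (cell_index (snd z)))"
  proof (rule sum_mono2)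
    show "cl ` T \<subseteq> ?J \<times> ?J"
    proof
      fix z assume "z \<in> cl ` T"
      then obtain x where x: "x \<in> T" "z = cl x" by blast
      have "i \<in> ?J" if "cell_index i \<le> n" for i
        using that by (auto simp: cell_index_def split: if_splits)
      then show "z \<in> ?J \<times> ?J"
        using n[OF x(1)] by (auto simp: x(2) cl_def)
    qed
  qed (auto simp: F_nonneg)
  also have "\<dots> = (\<Sum>i\<in>?J. \<Sum>j\<in>?J. F (cell_index i) (cell_index j))"
    by (simp add: sum.cartesian_product case_prod_beta)
  also have "\<dots> = 4 * (\<Sum>a\<le>n. \<Sum>b\<le>n. F a b)"
    by (simp add: split sum_distrib_left[symmetric] split[of "\<lambda>a. \<Sum>b\<le>n. F a b"])
  also have "(\<Sum>a\<le>n. \<Sum>b\<le>n. F a b) \<le> (\<Sum>a\<le>m. \<Sum>b\<le>m. F a b)"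
    by (intro order_trans[OF sum_mono[OF sum_mono2] sum_mono2]) (auto simp: m_def F_nonneg sum_nonneg)
  also have "\<dots> \<le> G0 + 2 * G1 + G2 + 8 * q ^ 4"
  proof -
    have dec: "(\<Sum>a\<le>m. f a) = f 0 + f 1 + (\<Sum>a\<in>{2..m}. f a)" for f :: "nat \<Rightarrow> real"
    proof -
      have "{..m} = {0,1} \<union> {2..m}" using \<open>1 \<le> m\<close> by auto
      then show ?thesis by (subst \<open>{..m} = _\<close>, subst sum.union_disjoint) auto
    qed
    define \<tau> where "\<tau> = (\<Sum>a\<in>{2..m}. q ^ (a\<^sup>2))"
    have \<tau>: "0 \<le> \<tau>" "\<tau> \<le> 2 * q ^ 4"
      using sum_powr_squares_le[OF \<open>0 \<le> q\<close> q(2)] \<open>0 \<le> q\<close> by (simp_all add: \<tau>_def sum_nonneg)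
    have "(\<Sum>b\<le>m. F 0 b) = G0 + G1 + \<tau>" "(\<Sum>b\<le>m. F 1 b) = G1 + G2 + q * \<tau>"
      unfolding dec by (auto simp: F_def \<tau>_def sum_distrib_left)
    moreover have "(\<Sum>b\<le>m. F a b) = q ^ (a\<^sup>2) * (1 + q + \<tau>)" if "a \<in> {2..m}" for a
      unfolding dec using that by (auto simp: F_def \<tau>_def sum_distrib_left algebra_simps)
    then have "(\<Sum>a\<in>{2..m}. \<Sum>b\<le>m. F a b) = \<tau> * (1 + q + \<tau>)"
      by (simp add: \<tau>_def sum_distrib_right)
    \<comment> \<open>The terms outside the two by two block sum to (1 + q + \<tau>)^2 - (1 + q)^2 =
      \<tau> (2 + 2q + \<tau>).\<close>
    ultimately have "(\<Sum>a\<le>m. \<Sum>b\<le>m. F a b) = G0 + 2 * G1 + G2 + \<tau> * (2 + 2 * q + \<tau>)"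
      by (subst dec[of "\<lambda>a. \<Sum>b\<le>m. F a b"]) (simp add: algebra_simps)
    also have "\<tau> * (2 + 2 * q + \<tau>) \<le> 2 * q ^ 4 * 4"
    proof (rule mult_mono)
      have "q ^ 4 \<le> (1/2) ^ 4" using q \<open>0 \<le> q\<close> by (intro power_mono) auto
      then show "2 + 2 * q + \<tau> \<le> 4" using \<tau> q(2) by (simp add: power_divide)
    qed (use \<tau> \<open>0 \<le> q\<close> in auto)
    finally show ?thesis by simp
  qed
  finally show ?thesis by simp
qed

subsection \<open>Two-dimensional atoms\<close>

lemma cauchy_schwarz_2:
  fixes a b c d :: real
  shows "\<bar>a\<bar> * \<bar>c\<bar> + \<bar>b\<bar> * \<bar>d\<bar> \<le> norm (a, b) * norm (c, d)"
  using Cauchy_Schwarz_ineq2[of "(\<bar>a\<bar>, \<bar>b\<bar>)" "(\<bar>c\<bar>, \<bar>d\<bar>)"] by (simp add: norm_Pair)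

lemma norm_Pair_mono:
  fixes a b c d :: real
  assumes "\<bar>a\<bar> \<le> c" "\<bar>b\<bar> \<le> d"
  shows "norm (a, b) \<le> norm (c, d)"
  unfolding norm_Pair using assms by (intro real_sqrt_le_mono add_mono power_mono) auto

lemma abs_sum3_le:
  fixes x y z :: real
  assumes "\<bar>x\<bar> \<le> a" "\<bar>y\<bar> \<le> b" "\<bar>z\<bar> \<le> c"
  shows "\<bar>x + y + z\<bar> \<le> a + b + c"
  using assms by linarith

context
  fixes A B C D :: real
begin

text \<open>For positive A + B and C + D the value at 0 is \<alpha> and the gradient at 0 is
  \<beta>, so the unknowns of the interpolation problem are the value and the slope that an atom has
  at its own spike.\<close>

definition atom :: "real \<Rightarrow> real \<times> real \<Rightarrow> real \<times> real \<Rightarrow> real" where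
  "atom \<alpha> \<beta> v = \<alpha> * (bump A B (fst v) * bump C D (snd v))
     + fst \<beta> * (wave A B (fst v) * bump C D (snd v)) + snd \<beta> * (bump A B (fst v) * wave C D (snd v))"

definition atom_x :: "real \<Rightarrow> real \<times> real \<Rightarrow> real \<times> real \<Rightarrow> real" where
  "atom_x \<alpha> \<beta> v = \<alpha> * (bump' A B (fst v) * bump C D (snd v))
     + fst \<beta> * (wave' A B (fst v) * bump C D (snd v)) + snd \<beta> * (bump' A B (fst v) * wave C D (snd v))"

definition atom_y :: "real \<Rightarrow> real \<times> real \<Rightarrow> real \<times> real \<Rightarrow> real" where
  "atom_y \<alpha> \<beta> v = \<alpha> * (bump A B (fst v) * bump' C D (snd v))
     + fst \<beta> * (wave A B (fst v) * bump' C D (snd v)) + snd \<beta> * (bump A B (fst v) * wave' C D (snd v))"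

text \<open>The Hessian at v as a quadratic form in u; Taylor's formula is applied along segments,
  so only this form is required.\<close>

definition atom_uu :: "real \<Rightarrow> real \<times> real \<Rightarrow> real \<times> real \<Rightarrow> real \<times> real \<Rightarrow> real" where
  "atom_uu \<alpha> \<beta> u v =
     \<alpha> * (bump'' A B (fst v) * bump C D (snd v) * (fst u)\<^sup>2 + 2 * (bump' A B (fst v) * bump' C D (snd v)) * (fst u * snd u)
        + bump A B (fst v) * bump'' C D (snd v) * (snd u)\<^sup>2)
     + fst \<beta> * (wave'' A B (fst v) * bump C D (snd v) * (fst u)\<^sup>2 + 2 * (wave' A B (fst v) * bump' C D (snd v)) * (fst u * snd u)
        + wave A B (fst v) * bump'' C D (snd v) * (snd u)\<^sup>2)
     + snd \<beta> * (bump'' A B (fst v) * wave C D (snd v) * (fst u)\<^sup>2 + 2 * (bump' A B (fst v) * wave' C D (snd v)) * (fst u * snd u)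
        + bump A B (fst v) * wave'' C D (snd v) * (snd u)\<^sup>2)"

lemma atom_line_derivative:
  assumes "0 < A + B" "0 < C + D"
  shows "((\<lambda>s. atom \<alpha> \<beta> (v + s *\<^sub>R u)) has_real_derivative
     (atom_x \<alpha> \<beta> (v + s *\<^sub>R u) * fst u + atom_y \<alpha> \<beta> (v + s *\<^sub>R u) * snd u)) (at s within S)"
  unfolding atom_def atom_x_def atom_y_def
  by (rule derivative_eq_intros refl assms | simp)+ (simp add: algebra_simps)

lemma atom_line_derivative2:
  assumes "0 < A + B" "0 < C + D"
  shows "((\<lambda>s. atom_x \<alpha> \<beta> (v + s *\<^sub>R u) * fst u + atom_y \<alpha> \<beta> (v + s *\<^sub>R u) * snd u) has_real_derivative
     atom_uu \<alpha> \<beta> u (v + s *\<^sub>R u)) (at s within S)"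
  unfolding atom_uu_def atom_x_def atom_y_def
  by (rule derivative_eq_intros refl assms | simp)+ (simp add: algebra_simps power2_eq_square)

end

locale cell2 = X: cell A B r + Y: cell C D r for A B C D r
begin

text \<open>The product of the Gaussian envelopes is radial, which allows the bounds on atoms to
  depend on \<open>norm v\<close> alone.\<close>

lemma env_mult: "env r h * env r k = exp (- (1 - r\<^sup>2 / 4) / 2 * (norm (h, k))\<^sup>2)"
proof -
  have "(norm (h, k))\<^sup>2 = h\<^sup>2 + k\<^sup>2" by (simp add: norm_Pair)
  moreover have "- (1 - r\<^sup>2 / 4) * h\<^sup>2 / 2 + - (1 - r\<^sup>2 / 4) * k\<^sup>2 / 2 = - (1 - r\<^sup>2 / 4) / 2 * (h\<^sup>2 + k\<^sup>2)"
    by (simp add: field_simps)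
  ultimately show ?thesis
    by (simp only: env_def exp_add[symmetric])
qed

lemma env_nonneg: "0 \<le> env r h"
  by (simp add: env_def)

lemma prod_le:
  assumes "\<bar>x\<bar> \<le> a * env r h" "\<bar>y\<bar> \<le> b * env r k"
  shows "\<bar>x * y\<bar> \<le> a * b * (env r h * env r k)"
  using mult_mono[OF assms] assms by (simp add: abs_mult mult_ac)

lemma atom_le:
  "\<bar>atom A B C D \<alpha> \<beta> v\<bar> \<le> (\<bar>\<alpha>\<bar> + 2.12 * norm v * norm \<beta>) * exp (- (1 - r\<^sup>2 / 4) / 2 * (norm v)\<^sup>2)"
proof -
  obtain h k where v: "v = (h, k)" by fastforce
  obtain b c where \<beta>: "\<beta> = (b, c)" by fastforce
  let ?E = "env r h * env r k"
  have E: "0 \<le> ?E" using env_nonneg by simp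
  have bump1: "\<bar>bump A B h\<bar> \<le> 1 * env r h" "\<bar>bump C D k\<bar> \<le> 1 * env r k"
    using X.bump_le Y.bump_le by auto
  have "\<bar>\<alpha> * (bump A B h * bump C D k)\<bar> \<le> \<bar>\<alpha>\<bar> * (1 * 1 * ?E)"
    unfolding abs_mult[of \<alpha>] by (intro mult_left_mono prod_le bump1) auto
  moreover have "\<bar>b * (wave A B h * bump C D k)\<bar> \<le> \<bar>b\<bar> * (2.12 * \<bar>h\<bar> * 1 * ?E)"
    unfolding abs_mult[of b] by (intro mult_left_mono prod_le bump1 X.wave_le) auto
  moreover have "\<bar>c * (bump A B h * wave C D k)\<bar> \<le> \<bar>c\<bar> * (1 * (2.12 * \<bar>k\<bar>) * ?E)"
    unfolding abs_mult[of c] by (intro mult_left_mono prod_le bump1 Y.wave_le) auto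
  ultimately have "\<bar>atom A B C D \<alpha> \<beta> v\<bar> \<le> \<bar>\<alpha>\<bar> * (1 * 1 * ?E) + \<bar>b\<bar> * (2.12 * \<bar>h\<bar> * 1 * ?E) + \<bar>c\<bar> * (1 * (2.12 * \<bar>k\<bar>) * ?E)"
    unfolding atom_def v \<beta> fst_conv snd_conv by (rule abs_sum3_le)
  also have "\<dots> = (\<bar>\<alpha>\<bar> + 2.12 * (\<bar>h\<bar> * \<bar>b\<bar> + \<bar>k\<bar> * \<bar>c\<bar>)) * ?E"
  proof -
    have "a * (1 * 1 * E) + b * (M * h * 1 * E) + c * (1 * (M * k) * E) = (a + M * (h * b + k * c)) * E"
      for a b c h k M E :: real by (simp add: algebra_simps)
    then show ?thesis .
  qed
  also have "\<dots> \<le> (\<bar>\<alpha>\<bar> + 2.12 * (norm v * norm \<beta>)) * ?E"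
    unfolding v \<beta> by (intro mult_right_mono add_left_mono mult_left_mono cauchy_schwarz_2 E) auto
  finally show ?thesis by (simp only: env_mult v mult.assoc)
qed

text \<open>Both components are arranged as a common multiple of |h| or |k| plus a common multiple
  of |b| or |c|. The majorant is thus a sum of two vectors parallel to (|h|, |k|) and (|b|, |c|),
  whose Euclidean norms enter without a loss of sqrt 2.\<close>

lemma atom_grad_le:
  "norm (atom_x A B C D \<alpha> \<beta> v, atom_y A B C D \<alpha> \<beta> v)
    \<le> (\<bar>\<alpha>\<bar> * norm v + norm \<beta> * (7.4 + 2.12 * (norm v)\<^sup>2)) * exp (- (1 - r\<^sup>2 / 4) / 2 * (norm v)\<^sup>2)"
proof -
  obtain h k where v: "v = (h, k)" by fastforce
  obtain b c where \<beta>: "\<beta> = (b, c)" by fastforce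
  let ?E = "env r h * env r k"
  have E: "0 \<le> ?E" using env_nonneg by simp
  have bump1: "\<bar>bump A B h\<bar> \<le> 1 * env r h" "\<bar>bump C D k\<bar> \<le> 1 * env r k"
    using X.bump_le Y.bump_le by auto
  define S where "S = \<bar>b\<bar> * \<bar>h\<bar> + \<bar>c\<bar> * \<bar>k\<bar>"
  have "\<bar>\<alpha> * (bump' A B h * bump C D k)\<bar> \<le> \<bar>\<alpha>\<bar> * (\<bar>h\<bar> * 1 * ?E)"
    unfolding abs_mult[of \<alpha>] by (intro mult_left_mono prod_le bump1 X.bump'_le) auto
  moreover have "\<bar>b * (wave' A B h * bump C D k)\<bar> \<le> \<bar>b\<bar> * ((7.4 + 2.12 * h\<^sup>2) * 1 * ?E)"
    unfolding abs_mult[of b] by (intro mult_left_mono prod_le bump1 X.wave'_le) auto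
  moreover have "\<bar>c * (bump' A B h * wave C D k)\<bar> \<le> \<bar>c\<bar> * (\<bar>h\<bar> * (2.12 * \<bar>k\<bar>) * ?E)"
    unfolding abs_mult[of c] by (intro mult_left_mono prod_le X.bump'_le Y.wave_le) auto
  ultimately have "\<bar>atom_x A B C D \<alpha> \<beta> v\<bar> \<le> \<bar>\<alpha>\<bar> * (\<bar>h\<bar> * 1 * ?E) + \<bar>b\<bar> * ((7.4 + 2.12 * h\<^sup>2) * 1 * ?E) + \<bar>c\<bar> * (\<bar>h\<bar> * (2.12 * \<bar>k\<bar>) * ?E)"
    unfolding atom_x_def v \<beta> fst_conv snd_conv by (rule abs_sum3_le)
  also have "\<dots> = ?E * (\<bar>\<alpha>\<bar> + 2.12 * S) * \<bar>h\<bar> + ?E * 7.4 * \<bar>b\<bar>"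
  proof -
    have "a * (h * 1 * E) + b * ((X + M * h\<^sup>2) * 1 * E) + c * (h * (M * k) * E)
        = E * (a + M * (b * h + c * k)) * h + E * X * b"
      for a b c h k M X E :: real by (simp add: algebra_simps power2_eq_square)
    from this[of "\<bar>\<alpha>\<bar>" "\<bar>h\<bar>" _ "\<bar>b\<bar>"] show ?thesis unfolding S_def power2_abs .
  qed
  finally have x: "\<bar>atom_x A B C D \<alpha> \<beta> v\<bar> \<le> ?E * (\<bar>\<alpha>\<bar> + 2.12 * S) * \<bar>h\<bar> + ?E * 7.4 * \<bar>b\<bar>" .
  have "\<bar>\<alpha> * (bump A B h * bump' C D k)\<bar> \<le> \<bar>\<alpha>\<bar> * (1 * \<bar>k\<bar> * ?E)"
    unfolding abs_mult[of \<alpha>] by (intro mult_left_mono prod_le bump1 Y.bump'_le) auto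
  moreover have "\<bar>b * (wave A B h * bump' C D k)\<bar> \<le> \<bar>b\<bar> * (2.12 * \<bar>h\<bar> * \<bar>k\<bar> * ?E)"
    unfolding abs_mult[of b] by (intro mult_left_mono prod_le Y.bump'_le X.wave_le) auto
  moreover have "\<bar>c * (bump A B h * wave' C D k)\<bar> \<le> \<bar>c\<bar> * (1 * (7.4 + 2.12 * k\<^sup>2) * ?E)"
    unfolding abs_mult[of c] by (intro mult_left_mono prod_le bump1 Y.wave'_le) auto
  ultimately have "\<bar>atom_y A B C D \<alpha> \<beta> v\<bar> \<le> \<bar>\<alpha>\<bar> * (1 * \<bar>k\<bar> * ?E) + \<bar>b\<bar> * (2.12 * \<bar>h\<bar> * \<bar>k\<bar> * ?E) + \<bar>c\<bar> * (1 * (7.4 + 2.12 * k\<^sup>2) * ?E)"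
    unfolding atom_y_def v \<beta> fst_conv snd_conv by (rule abs_sum3_le)
  also have "\<dots> = ?E * (\<bar>\<alpha>\<bar> + 2.12 * S) * \<bar>k\<bar> + ?E * 7.4 * \<bar>c\<bar>"
  proof -
    have "a * (1 * k * E) + b * (M * h * k * E) + c * (1 * (X + M * k\<^sup>2) * E)
        = E * (a + M * (b * h + c * k)) * k + E * X * c"
      for a b c h k M X E :: real by (simp add: algebra_simps power2_eq_square)
    from this[of "\<bar>\<alpha>\<bar>" "\<bar>k\<bar>" _ "\<bar>b\<bar>" _ "\<bar>h\<bar>" "\<bar>c\<bar>"] show ?thesis unfolding S_def power2_abs .
  qed
  finally have y: "\<bar>atom_y A B C D \<alpha> \<beta> v\<bar> \<le> ?E * (\<bar>\<alpha>\<bar> + 2.12 * S) * \<bar>k\<bar> + ?E * 7.4 * \<bar>c\<bar>" .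
  have "0 \<le> S" by (simp add: S_def)
  have "norm (atom_x A B C D \<alpha> \<beta> v, atom_y A B C D \<alpha> \<beta> v)
      \<le> norm ((?E * (\<bar>\<alpha>\<bar> + 2.12 * S)) *\<^sub>R (\<bar>h\<bar>, \<bar>k\<bar>) + (?E * 7.4) *\<^sub>R (\<bar>b\<bar>, \<bar>c\<bar>))"
    using norm_Pair_mono[OF x y] by simp
  also have "\<dots> \<le> norm ((?E * (\<bar>\<alpha>\<bar> + 2.12 * S)) *\<^sub>R (\<bar>h\<bar>, \<bar>k\<bar>)) + norm ((?E * 7.4) *\<^sub>R (\<bar>b\<bar>, \<bar>c\<bar>))"
    by (rule norm_triangle_ineq)
  also have "\<dots> = ?E * (\<bar>\<alpha>\<bar> + 2.12 * S) * norm v + ?E * 7.4 * norm \<beta>"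
    using E \<open>0 \<le> S\<close> unfolding norm_scaleR v \<beta> by (simp add: norm_Pair)
  also have "\<dots> \<le> ?E * (\<bar>\<alpha>\<bar> + 2.12 * (norm \<beta> * norm v)) * norm v + ?E * 7.4 * norm \<beta>"
    using E cauchy_schwarz_2[of b h c k] unfolding v \<beta> S_def
    by (intro add_right_mono mult_right_mono mult_left_mono add_left_mono) auto
  also have "\<dots> = (\<bar>\<alpha>\<bar> * norm v + norm \<beta> * (7.4 + 2.12 * (norm v)\<^sup>2)) * ?E"
  proof -
    have "E * (a + M * (n * \<rho>)) * \<rho> + E * X * n = (a * \<rho> + n * (X + M * \<rho>\<^sup>2)) * E"
      for a n \<rho> M X E :: real by (simp add: algebra_simps power2_eq_square)
    then show ?thesis .
  qed
  finally show ?thesis by (simp only: env_mult v)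
qed

text \<open>Collecting terms produces the square W of a scalar product and the mixed sums S and T,
  all estimated by Cauchy-Schwarz. The constants come from 24.5 >= 2.12 + 3 * 7.4 and 6.7 >= 7.4 *
  0.89.\<close>

lemma atom_hess_le:
  "\<bar>atom_uu A B C D \<alpha> \<beta> u v\<bar>
    \<le> (\<bar>\<alpha>\<bar> * (1 + (norm v)\<^sup>2) + norm \<beta> * (2.12 * norm v ^ 3 + 24.5 * norm v + 6.7))
        * exp (- (1 - r\<^sup>2 / 4) / 2 * (norm v)\<^sup>2) * (norm u)\<^sup>2"
proof -
  obtain h k where v: "v = (h, k)" by fastforce
  obtain b c where \<beta>: "\<beta> = (b, c)" by fastforce
  obtain p s where u: "u = (p, s)" by fastforce
  let ?E = "env r h * env r k"
  let ?n = "norm \<beta>" and ?\<rho> = "norm v" and ?U = "(norm u)\<^sup>2"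
  have E: "0 \<le> ?E" using env_nonneg by simp
  have bump1: "\<bar>bump A B h\<bar> \<le> 1 * env r h" "\<bar>bump C D k\<bar> \<le> 1 * env r k"
    using X.bump_le Y.bump_le by auto
  have comb: "\<bar>\<gamma> * (P * p\<^sup>2 + 2 * Q * (p * s) + R * s\<^sup>2)\<bar> \<le> \<bar>\<gamma>\<bar> * (P' * ?E * p\<^sup>2 + 2 * (Q' * ?E) * (\<bar>p\<bar> * \<bar>s\<bar>) + R' * ?E * s\<^sup>2)"
    if "\<bar>P\<bar> \<le> P' * ?E" "\<bar>Q\<bar> \<le> Q' * ?E" "\<bar>R\<bar> \<le> R' * ?E" for P P' Q Q' R R' \<gamma>
  proof -
    have "\<bar>P * p\<^sup>2\<bar> \<le> P' * ?E * p\<^sup>2" "\<bar>R * s\<^sup>2\<bar> \<le> R' * ?E * s\<^sup>2"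
      using that by (simp_all add: abs_mult mult_right_mono)
    moreover have "\<bar>Q * (p * s)\<bar> \<le> (Q' * ?E) * (\<bar>p\<bar> * \<bar>s\<bar>)"
      unfolding abs_mult using that by (intro mult_right_mono) auto
    ultimately show ?thesis
      unfolding abs_mult[of \<gamma>] by (intro mult_left_mono) (auto simp: mult.assoc)
  qed
  define S where "S = \<bar>b\<bar> * \<bar>h\<bar> + \<bar>c\<bar> * \<bar>k\<bar>"
  define T where "T = \<bar>b\<bar> * \<bar>k\<bar> + \<bar>c\<bar> * \<bar>h\<bar>"
  define W where "W = (\<bar>h\<bar> * \<bar>p\<bar> + \<bar>k\<bar> * \<bar>s\<bar>)\<^sup>2"
  have S: "S \<le> ?n * ?\<rho>" unfolding S_def \<beta> v by (rule cauchy_schwarz_2)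
  have T: "T \<le> ?n * ?\<rho>" using cauchy_schwarz_2[of b k c h] unfolding T_def \<beta> v by (simp add: norm_Pair add.commute)
  have ST: "0 \<le> S" "0 \<le> T" by (auto simp: S_def T_def)
  have bc: "\<bar>b\<bar> \<le> ?n" "\<bar>c\<bar> \<le> ?n" using norm_fst_le[of b c] norm_snd_le[of c b] by (auto simp: \<beta>)
  have U: "?U = p\<^sup>2 + s\<^sup>2" and \<rho>: "?\<rho>\<^sup>2 = h\<^sup>2 + k\<^sup>2" by (auto simp: u v norm_Pair)
  have W: "W \<le> ?\<rho>\<^sup>2 * ?U"
    unfolding W_def v u power_mult_distrib[symmetric] using cauchy_schwarz_2 by (intro power_mono) auto
  have ps: "2 * (\<bar>p\<bar> * \<bar>s\<bar>) \<le> ?U"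
    using zero_le_power2[of "\<bar>p\<bar> - \<bar>s\<bar>"] by (simp add: U power2_diff)
  have "\<bar>\<alpha> * (bump'' A B h * bump C D k * p\<^sup>2 + 2 * (bump' A B h * bump' C D k) * (p * s) + bump A B h * bump'' C D k * s\<^sup>2)\<bar>
      \<le> \<bar>\<alpha>\<bar> * ((1 + h\<^sup>2) * 1 * ?E * p\<^sup>2 + 2 * (\<bar>h\<bar> * \<bar>k\<bar> * ?E) * (\<bar>p\<bar> * \<bar>s\<bar>) + 1 * (1 + k\<^sup>2) * ?E * s\<^sup>2)"
    by (intro comb prod_le bump1 X.bump''_le Y.bump''_le X.bump'_le Y.bump'_le)
  moreover have "\<bar>b * (wave'' A B h * bump C D k * p\<^sup>2 + 2 * (wave' A B h * bump' C D k) * (p * s) + wave A B h * bump'' C D k * s\<^sup>2)\<bar>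
      \<le> \<bar>b\<bar> * ((7.4 * (0.89 + 2 * \<bar>h\<bar>) + 2.12 * \<bar>h\<bar> * (1 + h\<^sup>2)) * 1 * ?E * p\<^sup>2 + 2 * ((7.4 + 2.12 * h\<^sup>2) * \<bar>k\<bar> * ?E) * (\<bar>p\<bar> * \<bar>s\<bar>)
          + 2.12 * \<bar>h\<bar> * (1 + k\<^sup>2) * ?E * s\<^sup>2)"
    by (intro comb prod_le bump1 X.wave''_le Y.bump''_le X.wave'_le Y.bump'_le X.wave_le)
  moreover have "\<bar>c * (bump'' A B h * wave C D k * p\<^sup>2 + 2 * (bump' A B h * wave' C D k) * (p * s) + bump A B h * wave'' C D k * s\<^sup>2)\<bar>
      \<le> \<bar>c\<bar> * ((1 + h\<^sup>2) * (2.12 * \<bar>k\<bar>) * ?E * p\<^sup>2 + 2 * (\<bar>h\<bar> * (7.4 + 2.12 * k\<^sup>2) * ?E) * (\<bar>p\<bar> * \<bar>s\<bar>)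
          + 1 * (7.4 * (0.89 + 2 * \<bar>k\<bar>) + 2.12 * \<bar>k\<bar> * (1 + k\<^sup>2)) * ?E * s\<^sup>2)"
    by (intro comb prod_le bump1 Y.wave''_le X.bump''_le Y.wave'_le X.bump'_le Y.wave_le)
  ultimately have "\<bar>atom_uu A B C D \<alpha> \<beta> u v\<bar> \<le>
      \<bar>\<alpha>\<bar> * ((1 + h\<^sup>2) * 1 * ?E * p\<^sup>2 + 2 * (\<bar>h\<bar> * \<bar>k\<bar> * ?E) * (\<bar>p\<bar> * \<bar>s\<bar>) + 1 * (1 + k\<^sup>2) * ?E * s\<^sup>2)
      + \<bar>b\<bar> * ((7.4 * (0.89 + 2 * \<bar>h\<bar>) + 2.12 * \<bar>h\<bar> * (1 + h\<^sup>2)) * 1 * ?E * p\<^sup>2 + 2 * ((7.4 + 2.12 * h\<^sup>2) * \<bar>k\<bar> * ?E) * (\<bar>p\<bar> * \<bar>s\<bar>)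
          + 2.12 * \<bar>h\<bar> * (1 + k\<^sup>2) * ?E * s\<^sup>2)
      + \<bar>c\<bar> * ((1 + h\<^sup>2) * (2.12 * \<bar>k\<bar>) * ?E * p\<^sup>2 + 2 * (\<bar>h\<bar> * (7.4 + 2.12 * k\<^sup>2) * ?E) * (\<bar>p\<bar> * \<bar>s\<bar>)
          + 1 * (7.4 * (0.89 + 2 * \<bar>k\<bar>) + 2.12 * \<bar>k\<bar> * (1 + k\<^sup>2)) * ?E * s\<^sup>2)"
    unfolding atom_uu_def v \<beta> u fst_conv snd_conv by (rule abs_sum3_le)
  also have "\<dots> = (\<bar>\<alpha>\<bar> * (?U + W) + 2.12 * (S * (?U + W))
      + 7.4 * (0.89 * (\<bar>b\<bar> * p\<^sup>2 + \<bar>c\<bar> * s\<^sup>2) + 2 * (\<bar>b\<bar> * \<bar>h\<bar> * p\<^sup>2 + \<bar>c\<bar> * \<bar>k\<bar> * s\<^sup>2) + T * (2 * (\<bar>p\<bar> * \<bar>s\<bar>)))) * ?E"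
  proof -
    \<comment> \<open>Stated for free variables, so that absolute values and decimals do not disturb
      the ring normalization.\<close>
    have "a * ((1 + h\<^sup>2) * 1 * E * p\<^sup>2 + 2 * (h * k * E) * (p * s) + 1 * (1 + k\<^sup>2) * E * s\<^sup>2)
      + b * ((X * (Y + 2 * h) + M * h * (1 + h\<^sup>2)) * 1 * E * p\<^sup>2 + 2 * ((X + M * h\<^sup>2) * k * E) * (p * s)
          + M * h * (1 + k\<^sup>2) * E * s\<^sup>2)
      + c * ((1 + h\<^sup>2) * (M * k) * E * p\<^sup>2 + 2 * (h * (X + M * k\<^sup>2) * E) * (p * s)
          + 1 * (X * (Y + 2 * k) + M * k * (1 + k\<^sup>2)) * E * s\<^sup>2)
      = (a * ((p\<^sup>2 + s\<^sup>2) + (h * p + k * s)\<^sup>2) + M * ((b * h + c * k) * ((p\<^sup>2 + s\<^sup>2) + (h * p + k * s)\<^sup>2))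
      + X * (Y * (b * p\<^sup>2 + c * s\<^sup>2) + 2 * (b * h * p\<^sup>2 + c * k * s\<^sup>2) + (b * k + c * h) * (2 * (p * s)))) * E"
      for a b c h k p s M X Y E :: real by (simp add: algebra_simps power2_eq_square)
    from this[of "\<bar>\<alpha>\<bar>" "\<bar>h\<bar>" _ "\<bar>p\<bar>" "\<bar>k\<bar>" "\<bar>s\<bar>" "\<bar>b\<bar>" _ _ _ "\<bar>c\<bar>"]
    show ?thesis unfolding U W_def S_def T_def power2_abs .
  qed
  also have "\<dots> \<le> (\<bar>\<alpha>\<bar> * (?U + ?\<rho>\<^sup>2 * ?U) + 2.12 * ((?n * ?\<rho>) * (?U + ?\<rho>\<^sup>2 * ?U))
      + 7.4 * (0.89 * (?n * ?U) + 2 * ((?n * ?\<rho>) * ?U) + (?n * ?\<rho>) * ?U)) * ?E"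
  proof (intro mult_right_mono E add_mono mult_left_mono)
    show "S * (?U + W) \<le> (?n * ?\<rho>) * (?U + ?\<rho>\<^sup>2 * ?U)"
      using S W ST by (intro mult_mono) (auto simp: W_def)
    show "\<bar>b\<bar> * p\<^sup>2 + \<bar>c\<bar> * s\<^sup>2 \<le> ?n * ?U"
      unfolding U using mult_right_mono[OF bc(1), of "p\<^sup>2"] mult_right_mono[OF bc(2), of "s\<^sup>2"] by (simp add: algebra_simps)
    have "\<bar>b\<bar> * \<bar>h\<bar> * p\<^sup>2 + \<bar>c\<bar> * \<bar>k\<bar> * s\<^sup>2 \<le> S * ?U"
      unfolding U S_def by (simp add: algebra_simps)
    also have "\<dots> \<le> (?n * ?\<rho>) * ?U" using S by (intro mult_right_mono) auto
    finally show "\<bar>b\<bar> * \<bar>h\<bar> * p\<^sup>2 + \<bar>c\<bar> * \<bar>k\<bar> * s\<^sup>2 \<le> (?n * ?\<rho>) * ?U" .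
    show "T * (2 * (\<bar>p\<bar> * \<bar>s\<bar>)) \<le> (?n * ?\<rho>) * ?U"
      using T ST ps by (intro mult_mono) auto
  qed (use W in auto)
  also have "\<dots> = (\<bar>\<alpha>\<bar> * (1 + ?\<rho>\<^sup>2) + ?n * (2.12 * ?\<rho> ^ 3 + 24.32 * ?\<rho> + 6.586)) * ?E * ?U"
  proof -
    have "(a * (U + \<rho>\<^sup>2 * U) + M * ((n * \<rho>) * (U + \<rho>\<^sup>2 * U)) + X * (Y * (n * U) + 2 * ((n * \<rho>) * U) + (n * \<rho>) * U)) * E
      = (a * (1 + \<rho>\<^sup>2) + n * (M * \<rho> ^ 3 + (M + 3 * X) * \<rho> + X * Y)) * E * U"
      for a U \<rho> M n X Y E :: real by (simp add: algebra_simps power2_eq_square power3_eq_cube)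
    then have "(\<bar>\<alpha>\<bar> * (?U + ?\<rho>\<^sup>2 * ?U) + 2.12 * ((?n * ?\<rho>) * (?U + ?\<rho>\<^sup>2 * ?U))
      + 7.4 * (0.89 * (?n * ?U) + 2 * ((?n * ?\<rho>) * ?U) + (?n * ?\<rho>) * ?U)) * ?E
      = (\<bar>\<alpha>\<bar> * (1 + ?\<rho>\<^sup>2) + ?n * (2.12 * ?\<rho> ^ 3 + (2.12 + 3 * 7.4) * ?\<rho> + 7.4 * 0.89)) * ?E * ?U" .
    then show ?thesis by simp
  qed
  also have "\<dots> \<le> (\<bar>\<alpha>\<bar> * (1 + ?\<rho>\<^sup>2) + ?n * (2.12 * ?\<rho> ^ 3 + 24.5 * ?\<rho> + 6.7)) * ?E * ?U"
    using E by (intro mult_right_mono add_left_mono mult_left_mono add_mono) auto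
  finally show ?thesis by (simp only: env_mult v)
qed

text \<open>The linear part of the waves is subtracted because it will cancel against the gradient
  of the other atoms. Each component costs 1.4 times the squared norm, and |b| + |c| <= sqrt 2 *
  norm \<beta> with 1.4 * sqrt 2 <= 2.\<close>

lemma own_wave_le:
  assumes "norm v \<le> 0.45"
  shows "\<bar>fst \<beta> * (wave A B (fst v) * bump C D (snd v) - fst v) + snd \<beta> * (bump A B (fst v) * wave C D (snd v) - snd v)\<bar>
    \<le> 2 * norm \<beta> * (norm v)\<^sup>2"
proof -
  obtain h k where v: "v = (h, k)" by fastforce
  obtain b c where \<beta>: "\<beta> = (b, c)" by fastforce
  have n: "(norm v)\<^sup>2 = h\<^sup>2 + k\<^sup>2" by (simp add: v norm_Pair)
  have hk: "\<bar>h\<bar> \<le> 0.45" "\<bar>k\<bar> \<le> 0.45"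
    using assms norm_fst_le[of h k] norm_snd_le[of k h] by (auto simp: v)
  have *: "\<bar>w * b - h\<bar> \<le> 1.4 * (h\<^sup>2 + k\<^sup>2)"
    if "\<bar>w - h\<bar> \<le> 1.21 * h\<^sup>2" "\<bar>b\<bar> \<le> 1" "1 - b \<le> k\<^sup>2 / 2" "\<bar>h\<bar> \<le> 0.45" for w b h k :: real
  proof -
    have "\<bar>w * b - h\<bar> \<le> \<bar>w - h\<bar> * \<bar>b\<bar> + \<bar>h\<bar> * \<bar>1 - b\<bar>"
      unfolding abs_mult[symmetric] by (simp add: algebra_simps abs_if)
    also have "\<dots> \<le> 1.21 * h\<^sup>2 * 1 + 0.45 * (k\<^sup>2 / 2)"
      using that by (intro add_mono mult_mono) auto
    also have "\<dots> \<le> 1.4 * (h\<^sup>2 + k\<^sup>2)"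
      by (simp add: algebra_simps) (use zero_le_power2[of h] zero_le_power2[of k] in linarith)
    finally show ?thesis .
  qed
  have "\<bar>wave A B h * bump C D k - h\<bar> \<le> 1.4 * (h\<^sup>2 + k\<^sup>2)"
    using hk by (intro * X.wave_near Y.bump_near) auto
  moreover have "\<bar>wave C D k * bump A B h - k\<bar> \<le> 1.4 * (k\<^sup>2 + h\<^sup>2)"
    using hk by (intro * Y.wave_near X.bump_near) auto
  ultimately have x: "\<bar>wave A B h * bump C D k - h\<bar> \<le> 1.4 * (norm v)\<^sup>2" "\<bar>bump A B h * wave C D k - k\<bar> \<le> 1.4 * (norm v)\<^sup>2"
    unfolding n by (simp_all add: mult.commute add.commute)
  have "\<bar>b * (wave A B h * bump C D k - h) + c * (bump A B h * wave C D k - k)\<bar>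
      \<le> \<bar>b\<bar> * (1.4 * (norm v)\<^sup>2) + \<bar>c\<bar> * (1.4 * (norm v)\<^sup>2)"
    using mult_left_mono[OF x(1), of "\<bar>b\<bar>"] mult_left_mono[OF x(2), of "\<bar>c\<bar>"]
    by (intro order_trans[OF abs_triangle_ineq add_mono]) (simp_all add: abs_mult)
  also have "\<dots> = (\<bar>b\<bar> * 1 + \<bar>c\<bar> * 1) * (1.4 * (norm v)\<^sup>2)"
    by (simp add: algebra_simps)
  also have "\<dots> \<le> (norm \<beta> * sqrt 2) * (1.4 * (norm v)\<^sup>2)"
    using cauchy_schwarz_2[of b 1 c 1] by (intro mult_right_mono) (auto simp: \<beta> norm_Pair)
  also have "\<dots> \<le> (norm \<beta> * (2 / 1.4)) * (1.4 * (norm v)\<^sup>2)"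
    by (intro mult_right_mono mult_left_mono real_le_lsqrt) (auto simp: power_divide)
  finally show ?thesis by (simp add: v \<beta>)
qed

end

subsection \<open>Moments of separated point sets\<close>

(* The polynomial factor is traded for a part of the exponent; the loss is smallest at z = 4, which is about
   the distance of the nearest neighbours. *)
lemma power_exp_le:
  fixes z :: real
  assumes "0 \<le> z"
  shows "z ^ m * exp (- z\<^sup>2 / 2) \<le> 4 ^ m * exp (- real m / 2) * exp (- (1/2 - real m / 32) * z\<^sup>2)"
proof -
  have "z\<^sup>2 / 16 \<le> exp (z\<^sup>2 / 16 - 1)"
    using exp_ge_add_one_self[of "z\<^sup>2 / 16 - 1"] by simp
  moreover have "(exp ((z\<^sup>2 / 16 - 1) / 2))\<^sup>2 = exp (z\<^sup>2 / 16 - 1)"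
    by (subst exp_of_nat_mult[symmetric]) simp
  ultimately have "z\<^sup>2 \<le> (4 * exp ((z\<^sup>2 / 16 - 1) / 2))\<^sup>2"
    by (simp add: power_mult_distrib)
  then have "z \<le> 4 * exp ((z\<^sup>2 / 16 - 1) / 2)"
    by (rule power2_le_imp_le) simp
  then have "z ^ m \<le> (4 * exp ((z\<^sup>2 / 16 - 1) / 2)) ^ m"
    using assms by (intro power_mono)
  also have "\<dots> = 4 ^ m * exp (real m * ((z\<^sup>2 / 16 - 1) / 2))"
    by (simp only: power_mult_distrib exp_of_nat_mult)
  finally have "z ^ m * exp (- z\<^sup>2 / 2) \<le> 4 ^ m * exp (real m * ((z\<^sup>2 / 16 - 1) / 2)) * exp (- z\<^sup>2 / 2)"
    by (intro mult_right_mono) auto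
  also have "\<dots> = 4 ^ m * exp (- real m / 2) * exp (- (1/2 - real m / 32) * z\<^sup>2)"
    unfolding mult.assoc exp_add[symmetric] by (simp add: field_simps)
  finally show ?thesis .
qed

text \<open>For r <= 0.89 the factor 1 - r^2/4 is at least 0.801. The constant 1.118 used in this
  locale lies just above 1 / sqrt 0.801 and converts scaled into unscaled distances.\<close>

locale separated =
  fixes T :: "'i set" and p :: "'i \<Rightarrow> real \<times> real" and \<kappa> :: real
  assumes fin: "finite T" and \<kappa>: "0.801 \<le> \<kappa>"
    and sep: "\<And>x y. x \<in> T \<Longrightarrow> y \<in> T \<Longrightarrow> x \<noteq> y \<Longrightarrow> 3.987 < sqrt \<kappa> * dist (p x) (p y)"
begin

lemma \<kappa>_pos: "0 < \<kappa>" using \<kappa> by simp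

lemma inverse_sqrt_le: "1 \<le> 1.118 * sqrt \<kappa>"
proof -
  have "(1 / 1.118)\<^sup>2 \<le> \<kappa>" using \<kappa> by (simp add: power_divide)
  then have "1 / 1.118 \<le> sqrt \<kappa>" by (rule real_le_rsqrt)
  then show ?thesis by simp
qed

lemma dist_le_scaled: "dist x y \<le> 1.118 * (sqrt \<kappa> * dist x y)"
  using mult_right_mono[OF inverse_sqrt_le, of "dist x y"] by simp

lemma scaled_square: "(sqrt \<kappa> * d)\<^sup>2 = \<kappa> * d\<^sup>2"
  using \<kappa>_pos by (simp add: power_mult_distrib)

text \<open>Each power of the unscaled distance costs a factor 1.118, hence 4.472 = 4 *
  1.118.\<close>

lemma moment_le:
  "dist x y ^ m * exp (- \<kappa> / 2 * (dist x y)\<^sup>2) \<le> 4.472 ^ m * exp (- real m / 2) * exp (- (1/2 - real m / 32) * \<kappa> * (dist x y)\<^sup>2)"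
proof -
  define z where "z = sqrt \<kappa> * dist x y"
  have z: "0 \<le> z" "z\<^sup>2 = \<kappa> * (dist x y)\<^sup>2" using \<kappa>_pos by (auto simp: z_def scaled_square)
  have "dist x y ^ m \<le> (1.118 * z) ^ m"
    unfolding z_def using dist_le_scaled by (intro power_mono) auto
  then have "dist x y ^ m * exp (- z\<^sup>2 / 2) \<le> (1.118 * z) ^ m * exp (- z\<^sup>2 / 2)"
    by (intro mult_right_mono) auto
  also have "\<dots> = 1.118 ^ m * (z ^ m * exp (- z\<^sup>2 / 2))"
    by (simp only: power_mult_distrib mult.assoc)
  also have "\<dots> \<le> 1.118 ^ m * (4 ^ m * exp (- real m / 2) * exp (- (1/2 - real m / 32) * z\<^sup>2))"
    using z by (intro mult_left_mono power_exp_le) auto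
  also have "\<dots> = (1.118 * 4) ^ m * exp (- real m / 2) * exp (- (1/2 - real m / 32) * z\<^sup>2)"
    by (simp only: power_mult_distrib mult.assoc)
  finally show ?thesis by (simp add: z mult.assoc)
qed

text \<open>The bound 0.4 admits the exponents 1/2 - m/32 with m <= 3 as well as 0.49, and it makes
  q at most exp(-1) <= 1/2.\<close>

lemma gauss_sum_le:
  assumes S: "S \<subseteq> T" and c: "0.4 \<le> c" and G: "0 \<le> G0" "0 \<le> G1" "0 \<le> G2"
    and G0: "\<And>x. x \<in> S \<Longrightarrow> sqrt \<kappa> * dist t (p x) \<le> 3.987 \<Longrightarrow> exp (- c * \<kappa> * (dist t (p x))\<^sup>2) \<le> G0"
    and G1: "\<And>x. x \<in> S \<Longrightarrow> 3.987\<^sup>2 / 2 \<le> \<kappa> * (dist t (p x))\<^sup>2 \<Longrightarrow> exp (- c * \<kappa> * (dist t (p x))\<^sup>2) \<le> G1"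
    and G2: "\<And>x. x \<in> S \<Longrightarrow> 3.987 \<le> sqrt \<kappa> * dist t (p x) \<Longrightarrow> exp (- c * \<kappa> * (dist t (p x))\<^sup>2) \<le> G2"
  shows "(\<Sum>x\<in>S. exp (- c * \<kappa> * (dist t (p x))\<^sup>2)) \<le> 4 * G0 + 8 * G1 + 4 * G2 + 32 * exp (- 2 * c * 3.987\<^sup>2)"
proof -
  define d where "d = 3.987 / sqrt \<kappa>"
  have sk: "0 < sqrt \<kappa>" using \<kappa>_pos by simp
  have d2: "\<kappa> * d\<^sup>2 = 3.987\<^sup>2" using \<kappa>_pos by (simp add: d_def power_divide)
  have d_le: "d \<le> u \<longleftrightarrow> 3.987 \<le> sqrt \<kappa> * u" "u \<le> d \<longleftrightarrow> sqrt \<kappa> * u \<le> 3.987" "d < u \<longleftrightarrow> 3.987 < sqrt \<kappa> * u" for u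
    using sk by (simp_all add: d_def field_simps)
  define q where "q = exp (- (c * \<kappa>) * d\<^sup>2 / 2)"
  have q: "q = exp (- c * 3.987\<^sup>2 / 2)" unfolding q_def d2[symmetric] by (simp add: mult.assoc)
  have "1 \<le> c * 3.987\<^sup>2 / 2" using mult_right_mono[OF c, of "3.987\<^sup>2 / 2"] by (simp add: power_divide)
  then have "exp (- (c * 3.987\<^sup>2 / 2)) \<le> exp (- 1)" by (subst exp_le_cancel_iff) linarith
  also have "\<dots> \<le> 1/2" using exp_ge_add_one_self[of 1] by (simp add: exp_minus field_simps)
  finally have "q \<le> 1/2" by (simp add: q)
  have q4: "q ^ 4 = exp (- 2 * c * 3.987\<^sup>2)" unfolding q by (simp flip: exp_of_nat_mult)
  have "(\<Sum>x\<in>S. exp (- (c * \<kappa>) * (dist t (p x))\<^sup>2)) \<le> 4 * G0 + 8 * G1 + 4 * G2 + 32 * q ^ 4"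
  proof (rule separated_gauss_sum_le[where d = d])
    show "0 < d" "0 < c * \<kappa>" using sk \<kappa>_pos c by (auto simp: d_def)
    show "d < dist (p x) (p y)" if "x \<in> S" "y \<in> S" "x \<noteq> y" for x y
      using sep[of x y] that S by (auto simp: d_le)
    show "exp (- (c * \<kappa>) * (dist t (p x))\<^sup>2) \<le> G1" if "x \<in> S" "d\<^sup>2 / 2 \<le> (dist t (p x))\<^sup>2" for x
      using G1[OF that(1)] mult_left_mono[OF that(2), of \<kappa>] \<kappa>_pos by (simp add: d2)
    show "exp (- (c * \<kappa>) * (dist t (p x))\<^sup>2) \<le> G0" if "x \<in> S" "dist t (p x) \<le> d" for x
      using G0[OF that(1)] that(2) by (simp add: d_le)
    show "exp (- (c * \<kappa>) * (dist t (p x))\<^sup>2) \<le> G2" if "x \<in> S" "d \<le> dist t (p x)" for x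
      using G2[OF that(1)] that(2) by (simp add: d_le)
  qed (use S fin finite_subset q_def \<open>q \<le> 1/2\<close> G in auto)
  then show ?thesis by (simp add: q4)
qed

lemma exp_scaled_le:
  assumes "0 \<le> R" "R \<le> sqrt \<kappa> * d" "0 \<le> c"
  shows "exp (- c * \<kappa> * d\<^sup>2) \<le> exp (- c * R\<^sup>2)"
proof -
  have "R\<^sup>2 \<le> \<kappa> * d\<^sup>2" using power_mono[OF assms(2,1), of 2] by (simp add: scaled_square)
  from mult_left_mono[OF this assms(3)] show ?thesis by (simp add: mult.assoc)
qed

text \<open>16 = 4 + 8 + 4: all squares of the first two layers get the same bound.\<close>

lemma gauss_sum_le16:
  assumes "S \<subseteq> T" "0.4 \<le> c" "0 \<le> R" "\<And>x. x \<in> S \<Longrightarrow> R \<le> sqrt \<kappa> * dist t (p x)"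
  shows "(\<Sum>x\<in>S. exp (- c * \<kappa> * (dist t (p x))\<^sup>2)) \<le> 16 * exp (- c * R\<^sup>2) + 32 * exp (- 2 * c * 3.987\<^sup>2)"
proof -
  have "exp (- c * \<kappa> * (dist t (p x))\<^sup>2) \<le> exp (- c * R\<^sup>2)" if "x \<in> S" for x
    using assms that by (intro exp_scaled_le) auto
  then show ?thesis
    using gauss_sum_le[of S c "exp (- c * R\<^sup>2)" "exp (- c * R\<^sup>2)" "exp (- c * R\<^sup>2)" t] assms by simp
qed

(* The four squares touching t have diameter 3.987 and hence contain no further point, which leaves twelve
   squares in the first two layers. *)
lemma gauss_sum_le12:
  assumes "S \<subseteq> T" "0.4 \<le> c" "\<And>x. x \<in> S \<Longrightarrow> 3.987 < sqrt \<kappa> * dist t (p x)"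
  shows "(\<Sum>x\<in>S. exp (- c * \<kappa> * (dist t (p x))\<^sup>2)) \<le> 12 * exp (- c * 3.987\<^sup>2) + 32 * exp (- 2 * c * 3.987\<^sup>2)"
proof -
  have "exp (- c * \<kappa> * (dist t (p x))\<^sup>2) \<le> exp (- c * 3.987\<^sup>2)" if "x \<in> S" for x
    using assms(2) assms(3)[OF that] that by (intro exp_scaled_le) auto
  then show ?thesis
    using gauss_sum_le[of S c 0 "exp (- c * 3.987\<^sup>2)" "exp (- c * 3.987\<^sup>2)" t] assms
    by (simp add: linorder_not_le[symmetric]) 
qed

text \<open>Only the four squares touching t use R, the next twelve use their own distances. This is
  the better bound when R is clearly smaller than 3.987 / sqrt 2.\<close>

lemma gauss_sum_le4:
  assumes "S \<subseteq> T" "0.4 \<le> c" "0 \<le> R" "\<And>x. x \<in> S \<Longrightarrow> R \<le> sqrt \<kappa> * dist t (p x)"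
  shows "(\<Sum>x\<in>S. exp (- c * \<kappa> * (dist t (p x))\<^sup>2)) \<le>
    4 * exp (- c * R\<^sup>2) + 8 * exp (- c * (3.987\<^sup>2 / 2)) + 4 * exp (- c * 3.987\<^sup>2) + 32 * exp (- 2 * c * 3.987\<^sup>2)"
proof (rule gauss_sum_le)
  fix x assume x: "x \<in> S"
  show "exp (- c * \<kappa> * (dist t (p x))\<^sup>2) \<le> exp (- c * R\<^sup>2)"
    using assms x by (intro exp_scaled_le) auto
  show "exp (- c * \<kappa> * (dist t (p x))\<^sup>2) \<le> exp (- c * (3.987\<^sup>2 / 2))" if "3.987\<^sup>2 / 2 \<le> \<kappa> * (dist t (p x))\<^sup>2"
    using mult_left_mono[OF that, of c] assms(2) by (simp add: mult.assoc)
  show "exp (- c * \<kappa> * (dist t (p x))\<^sup>2) \<le> exp (- c * 3.987\<^sup>2)" if "3.987 \<le> sqrt \<kappa> * dist t (p x)"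
    using assms(2) that by (intro exp_scaled_le) auto
qed (use assms in auto)

lemma moment_sum_le:
  assumes "(\<Sum>x\<in>S. exp (- (1/2 - real m / 32) * \<kappa> * (dist t (p x))\<^sup>2)) \<le> B"
  shows "(\<Sum>x\<in>S. dist t (p x) ^ m * exp (- \<kappa> / 2 * (dist t (p x))\<^sup>2)) \<le> 4.472 ^ m * (exp (- real m / 2) * B)"
proof -
  have "(\<Sum>x\<in>S. dist t (p x) ^ m * exp (- \<kappa> / 2 * (dist t (p x))\<^sup>2))
      \<le> (\<Sum>x\<in>S. 4.472 ^ m * exp (- real m / 2) * exp (- (1/2 - real m / 32) * \<kappa> * (dist t (p x))\<^sup>2))"
    by (intro sum_mono moment_le)
  also have "\<dots> = 4.472 ^ m * (exp (- real m / 2) * (\<Sum>x\<in>S. exp (- (1/2 - real m / 32) * \<kappa> * (dist t (p x))\<^sup>2)))"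
    by (simp only: sum_distrib_left mult.assoc)
  also have "\<dots> \<le> 4.472 ^ m * (exp (- real m / 2) * B)"
    using assms by (intro mult_left_mono) auto
  finally show ?thesis .
qed

text \<open>Applied with t a spike and S the other spikes; these numbers control the off-diagonal
  part of the interpolation system.\<close>

lemma moment_sums_far:
  assumes "S \<subseteq> T" "\<And>x. x \<in> S \<Longrightarrow> 3.987 < sqrt \<kappa> * dist t (p x)"
  shows "(\<Sum>x\<in>S. exp (- \<kappa> / 2 * (dist t (p x))\<^sup>2)) \<le> 0.0043"
    and "(\<Sum>x\<in>S. dist t (p x) * exp (- \<kappa> / 2 * (dist t (p x))\<^sup>2)) \<le> 0.0191"
    and "(\<Sum>x\<in>S. (dist t (p x))\<^sup>2 * exp (- \<kappa> / 2 * (dist t (p x))\<^sup>2)) \<le> 0.085"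
proof -
  have *: "(\<Sum>x\<in>S. dist t (p x) ^ m * exp (- \<kappa> / 2 * (dist t (p x))\<^sup>2)) \<le> 4.472 ^ m * (12 * u + 32 * v)"
    if "0.4 \<le> 1/2 - real m / 32"
      "exp (- (real m / 2 + (1/2 - real m / 32) * 3.987\<^sup>2)) \<le> u"
      "exp (- (real m / 2 + 2 * (1/2 - real m / 32) * 3.987\<^sup>2)) \<le> v" for m u v
  proof -
    let ?c = "1/2 - real m / 32"
    have "(\<Sum>x\<in>S. dist t (p x) ^ m * exp (- \<kappa> / 2 * (dist t (p x))\<^sup>2))
        \<le> 4.472 ^ m * (exp (- real m / 2) * (12 * exp (- ?c * 3.987\<^sup>2) + 32 * exp (- 2 * ?c * 3.987\<^sup>2)))"
      by (intro moment_sum_le gauss_sum_le12 assms that)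
    also have "\<dots> = 4.472 ^ m * (12 * exp (- (real m / 2 + ?c * 3.987\<^sup>2)) + 32 * exp (- (real m / 2 + 2 * ?c * 3.987\<^sup>2)))"
      by (simp add: algebra_simps flip: exp_add)
    also have "\<dots> \<le> 4.472 ^ m * (12 * u + 32 * v)"
      using that(2,3) by (intro mult_left_mono add_mono) auto
    finally show ?thesis .
  qed
  have "exp (- (real 0 / 2 + (1/2 - real 0 / 32) * 3.987\<^sup>2)) \<le> (0.000355 :: real)"
    by (rule exp_le_pow16[where u = "0.49675" and p = "1.64309"]) (simp_all add: power_divide)
  moreover have "exp (- (real 0 / 2 + 2 * (1/2 - real 0 / 32) * 3.987\<^sup>2)) \<le> (0.0000002 :: real)"
    by (rule exp_le_pow16[where u = "0.99351" and p = "2.69107"]) (simp_all add: power_divide)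
  ultimately show "(\<Sum>x\<in>S. exp (- \<kappa> / 2 * (dist t (p x))\<^sup>2)) \<le> 0.0043"
    using *[of 0 "0.000355" "0.0000002"] by simp
  have "exp (- (real 1 / 2 + (1/2 - real 1 / 32) * 3.987\<^sup>2)) \<le> (0.000354 :: real)"
    by (rule exp_le_pow16[where u = "0.49695" and p = "1.64342"]) (simp_all add: power_divide)
  moreover have "exp (- (real 1 / 2 + 2 * (1/2 - real 1 / 32) * 3.987\<^sup>2)) \<le> (0.0000003 :: real)"
    by (rule exp_le_pow16[where u = "0.96266" and p = "2.61048"]) (simp_all add: power_divide)
  ultimately show "(\<Sum>x\<in>S. dist t (p x) * exp (- \<kappa> / 2 * (dist t (p x))\<^sup>2)) \<le> 0.0191"
    using *[of 1 "0.000354" "0.0000003"] by simp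
  have "exp (- (real 2 / 2 + (1/2 - real 2 / 32) * 3.987\<^sup>2)) \<le> (0.000353 :: real)"
    by (rule exp_le_pow16[where u = "0.49716" and p = "1.64376"]) (simp_all add: power_divide)
  moreover have "exp (- (real 2 / 2 + 2 * (1/2 - real 2 / 32) * 3.987\<^sup>2)) \<le> (0.00000036 :: real)"
    by (rule exp_le_pow16[where u = "0.93182" and p = "2.53222"]) (simp_all add: power_divide)
  ultimately show "(\<Sum>x\<in>S. (dist t (p x))\<^sup>2 * exp (- \<kappa> / 2 * (dist t (p x))\<^sup>2)) \<le> 0.085"
    using *[of 2 "0.000353" "0.00000036"] by (simp add: power_divide)
qed

text \<open>3.587 = 3.987 - 0.4: applied with t within scaled distance 0.4 of a spike, as an
  intermediate point of Taylor's formula. The third moment enters through the Hessian bound.\<close>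

lemma moment_sums_near:
  assumes "S \<subseteq> T" "\<And>x. x \<in> S \<Longrightarrow> 3.587 \<le> sqrt \<kappa> * dist t (p x)"
  shows "(\<Sum>x\<in>S. exp (- \<kappa> / 2 * (dist t (p x))\<^sup>2)) \<le> 0.0262"
    and "(\<Sum>x\<in>S. dist t (p x) * exp (- \<kappa> / 2 * (dist t (p x))\<^sup>2)) \<le> 0.106"
    and "(\<Sum>x\<in>S. (dist t (p x))\<^sup>2 * exp (- \<kappa> / 2 * (dist t (p x))\<^sup>2)) \<le> 0.43"
    and "(\<Sum>x\<in>S. dist t (p x) ^ 3 * exp (- \<kappa> / 2 * (dist t (p x))\<^sup>2)) \<le> 1.75"
proof -
  have *: "(\<Sum>x\<in>S. dist t (p x) ^ m * exp (- \<kappa> / 2 * (dist t (p x))\<^sup>2)) \<le> 4.472 ^ m * (16 * u + 32 * v)"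
    if "0.4 \<le> 1/2 - real m / 32"
      "exp (- (real m / 2 + (1/2 - real m / 32) * 3.587\<^sup>2)) \<le> u"
      "exp (- (real m / 2 + 2 * (1/2 - real m / 32) * 3.987\<^sup>2)) \<le> v" for m u v
  proof -
    let ?c = "1/2 - real m / 32"
    have "(\<Sum>x\<in>S. dist t (p x) ^ m * exp (- \<kappa> / 2 * (dist t (p x))\<^sup>2))
        \<le> 4.472 ^ m * (exp (- real m / 2) * (16 * exp (- ?c * 3.587\<^sup>2) + 32 * exp (- 2 * ?c * 3.987\<^sup>2)))"
      by (intro moment_sum_le gauss_sum_le16 assms that) auto
    also have "\<dots> = 4.472 ^ m * (16 * exp (- (real m / 2 + ?c * 3.587\<^sup>2)) + 32 * exp (- (real m / 2 + 2 * ?c * 3.987\<^sup>2)))"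
      by (simp add: algebra_simps flip: exp_add)
    also have "\<dots> \<le> 4.472 ^ m * (16 * u + 32 * v)"
      using that(2,3) by (intro mult_left_mono add_mono) auto
    finally show ?thesis .
  qed
  have "exp (- (real 0 / 2 + (1/2 - real 0 / 32) * 3.587\<^sup>2)) \<le> (0.00162 :: real)"
    by (rule exp_le_pow16[where u = "0.40208" and p = "1.49483"]) (simp_all add: power_divide)
  moreover have "exp (- (real 0 / 2 + 2 * (1/2 - real 0 / 32) * 3.987\<^sup>2)) \<le> (0.0000007 :: real)"
    by (rule exp_le_pow16[where u = "0.99351" and p = "2.69107"]) (simp_all add: power_divide)
  ultimately show "(\<Sum>x\<in>S. exp (- \<kappa> / 2 * (dist t (p x))\<^sup>2)) \<le> 0.0262"
    using *[of 0 "0.00162" "0.0000007"] by simp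
  have "exp (- (real 1 / 2 + (1/2 - real 1 / 32) * 3.587\<^sup>2)) \<le> (0.00147 :: real)"
    by (rule exp_le_pow16[where u = "0.4082" and p = "1.504"]) (simp_all add: power_divide)
  moreover have "exp (- (real 1 / 2 + 2 * (1/2 - real 1 / 32) * 3.987\<^sup>2)) \<le> (0.0000007 :: real)"
    by (rule exp_le_pow16[where u = "0.96266" and p = "2.61048"]) (simp_all add: power_divide)
  ultimately show "(\<Sum>x\<in>S. dist t (p x) * exp (- \<kappa> / 2 * (dist t (p x))\<^sup>2)) \<le> 0.106"
    using *[of 1 "0.00147" "0.0000007"] by simp
  have "exp (- (real 2 / 2 + (1/2 - real 2 / 32) * 3.587\<^sup>2)) \<le> (0.001335 :: real)"
    by (rule exp_le_pow16[where u = "0.41432" and p = "1.51323"]) (simp_all add: power_divide)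
  moreover have "exp (- (real 2 / 2 + 2 * (1/2 - real 2 / 32) * 3.987\<^sup>2)) \<le> (0.0000007 :: real)"
    by (rule exp_le_pow16[where u = "0.93182" and p = "2.53222"]) (simp_all add: power_divide)
  ultimately show "(\<Sum>x\<in>S. (dist t (p x))\<^sup>2 * exp (- \<kappa> / 2 * (dist t (p x))\<^sup>2)) \<le> 0.43"
    using *[of 2 "0.001335" "0.0000007"] by (simp add: power_divide)
  have "exp (- (real 3 / 2 + (1/2 - real 3 / 32) * 3.587\<^sup>2)) \<le> (0.00122 :: real)"
    by (rule exp_le_pow16[where u = "0.42044" and p = "1.52251"]) (simp_all add: power_divide)
  moreover have "exp (- (real 3 / 2 + 2 * (1/2 - real 3 / 32) * 3.987\<^sup>2)) \<le> (0.0000007 :: real)"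
    by (rule exp_le_pow16[where u = "0.90097" and p = "2.45619"]) (simp_all add: power_divide)
  ultimately show "(\<Sum>x\<in>S. dist t (p x) ^ 3 * exp (- \<kappa> / 2 * (dist t (p x))\<^sup>2)) \<le> 1.75"
    using *[of 3 "0.00122" "0.0000007"] by (simp add: power_divide)
qed

end

subsection \<open>The interpolation problem\<close>

(* A component of \<omega> is 0 if the grid has a single line in that direction: then no wave is available there,
   but all spikes share that coordinate and the slope condition holds automatically. *)
locale spike_config =
  fixes N :: nat and t :: "nat \<Rightarrow> real \<times> real" and A C :: "nat \<Rightarrow> real" and r :: real
    and \<omega> :: "real \<times> real" and \<epsilon> :: "nat \<Rightarrow> real" and \<kappa> :: real
  defines "\<kappa> \<equiv> 1 - r\<^sup>2 / 4"
  assumes r: "0 < r" "r \<le> 0.89"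
    and A: "\<And>j. j < N \<Longrightarrow> 0 \<le> A j \<and> A j \<le> r" and C: "\<And>j. j < N \<Longrightarrow> 0 \<le> C j \<and> C j \<le> r"
    and sep: "\<And>j k. j < N \<Longrightarrow> k < N \<Longrightarrow> j \<noteq> k \<Longrightarrow> 3.987 < sqrt \<kappa> * dist (t j) (t k)"
    and \<omega>_fst: "fst \<omega> = 1 \<or> fst \<omega> = 0 \<and> (\<forall>j<N. \<forall>k<N. fst (t j) = fst (t k))"
    and \<omega>_snd: "snd \<omega> = 1 \<or> snd \<omega> = 0 \<and> (\<forall>j<N. \<forall>k<N. snd (t j) = snd (t k))"
    and \<epsilon>: "\<And>j. \<bar>\<epsilon> j\<bar> = 1"
begin

lemma cell2: "j < N \<Longrightarrow> cell2 (A j) (r - A j) (C j) (r - C j) r"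
  using r A[of j] C[of j] by unfold_locales auto

lemma \<kappa>_ge: "0.801 \<le> \<kappa>"
proof -
  have "r\<^sup>2 \<le> 0.89\<^sup>2" using r by (intro power_mono) auto
  then show ?thesis by (simp add: \<kappa>_def power_divide)
qed

sublocale separated "{..<N}" t \<kappa>
  using sep \<kappa>_ge by unfold_locales auto

definition wt :: "real \<times> real \<Rightarrow> real \<times> real" where
  "wt \<beta> = (fst \<omega> * fst \<beta>, snd \<omega> * snd \<beta>)"

lemma norm_wt_le: "norm (wt \<beta>) \<le> norm \<beta>"
proof -
  have "\<bar>fst \<omega>\<bar> \<le> 1" "\<bar>snd \<omega>\<bar> \<le> 1" using \<omega>_fst \<omega>_snd by auto
  then have "\<bar>fst \<omega> * fst \<beta>\<bar> \<le> \<bar>fst \<beta>\<bar>" "\<bar>snd \<omega> * snd \<beta>\<bar> \<le> \<bar>snd \<beta>\<bar>"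
    unfolding abs_mult by (auto intro: mult_left_le_one_le)
  then have "norm (wt \<beta>) \<le> norm (\<bar>fst \<beta>\<bar>, \<bar>snd \<beta>\<bar>)"
    unfolding wt_def by (rule norm_Pair_mono)
  then show ?thesis by (cases \<beta>) (simp add: norm_Pair)
qed

definition g :: "nat \<Rightarrow> real \<Rightarrow> real \<times> real \<Rightarrow> real \<times> real \<Rightarrow> real" where
  "g k \<alpha> \<beta> v = atom (A k) (r - A k) (C k) (r - C k) \<alpha> (wt \<beta>) v"

definition gx :: "nat \<Rightarrow> real \<Rightarrow> real \<times> real \<Rightarrow> real \<times> real \<Rightarrow> real" where
  "gx k \<alpha> \<beta> v = atom_x (A k) (r - A k) (C k) (r - C k) \<alpha> (wt \<beta>) v"

definition gy :: "nat \<Rightarrow> real \<Rightarrow> real \<times> real \<Rightarrow> real \<times> real \<Rightarrow> real" where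
  "gy k \<alpha> \<beta> v = atom_y (A k) (r - A k) (C k) (r - C k) \<alpha> (wt \<beta>) v"

definition guu :: "nat \<Rightarrow> real \<Rightarrow> real \<times> real \<Rightarrow> real \<times> real \<Rightarrow> real \<times> real \<Rightarrow> real" where
  "guu k \<alpha> \<beta> u v = atom_uu (A k) (r - A k) (C k) (r - C k) \<alpha> (wt \<beta>) u v"

abbreviation E :: "real \<times> real \<Rightarrow> real \<times> real \<Rightarrow> real" where
  "E x y \<equiv> exp (- \<kappa> / 2 * (dist x y)\<^sup>2)"

lemma g_le:
  assumes "k < N"
  shows "\<bar>g k \<alpha> \<beta> (x - t k)\<bar> \<le> (\<bar>\<alpha>\<bar> + 2.12 * norm \<beta> * dist x (t k)) * E x (t k)"
proof -
  have "\<bar>g k \<alpha> \<beta> (x - t k)\<bar> \<le> (\<bar>\<alpha>\<bar> + 2.12 * norm (x - t k) * norm (wt \<beta>)) * E x (t k)"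
    using cell2.atom_le[OF cell2[OF assms]] by (simp add: g_def \<kappa>_def dist_norm)
  also have "\<dots> \<le> (\<bar>\<alpha>\<bar> + 2.12 * norm (x - t k) * norm \<beta>) * E x (t k)"
    by (intro mult_right_mono add_left_mono mult_left_mono norm_wt_le) auto
  finally show ?thesis by (simp add: dist_norm mult_ac)
qed

lemma grad_le:
  assumes "k < N"
  shows "norm (gx k \<alpha> \<beta> (x - t k), gy k \<alpha> \<beta> (x - t k))
    \<le> (\<bar>\<alpha>\<bar> * dist x (t k) + norm \<beta> * (7.4 + 2.12 * (dist x (t k))\<^sup>2)) * E x (t k)"
proof -
  have "norm (gx k \<alpha> \<beta> (x - t k), gy k \<alpha> \<beta> (x - t k))
    \<le> (\<bar>\<alpha>\<bar> * norm (x - t k) + norm (wt \<beta>) * (7.4 + 2.12 * (norm (x - t k))\<^sup>2)) * E x (t k)"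
    using cell2.atom_grad_le[OF cell2[OF assms]] by (simp add: gx_def gy_def \<kappa>_def dist_norm)
  also have "\<dots> \<le> (\<bar>\<alpha>\<bar> * norm (x - t k) + norm \<beta> * (7.4 + 2.12 * (norm (x - t k))\<^sup>2)) * E x (t k)"
    by (intro mult_right_mono add_left_mono norm_wt_le) auto
  finally show ?thesis by (simp add: dist_norm)
qed

lemma guu_le:
  assumes "k < N"
  shows "\<bar>guu k \<alpha> \<beta> u (x - t k)\<bar>
    \<le> (\<bar>\<alpha>\<bar> * (1 + (dist x (t k))\<^sup>2) + norm \<beta> * (2.12 * dist x (t k) ^ 3 + 24.5 * dist x (t k) + 6.7)) * E x (t k) * (norm u)\<^sup>2"
proof -
  let ?\<rho> = "norm (x - t k)"
  have "\<bar>guu k \<alpha> \<beta> u (x - t k)\<bar>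
    \<le> (\<bar>\<alpha>\<bar> * (1 + ?\<rho>\<^sup>2) + norm (wt \<beta>) * (2.12 * ?\<rho> ^ 3 + 24.5 * ?\<rho> + 6.7)) * E x (t k) * (norm u)\<^sup>2"
    using cell2.atom_hess_le[OF cell2[OF assms]] by (simp add: guu_def \<kappa>_def dist_norm)
  also have "\<dots> \<le> (\<bar>\<alpha>\<bar> * (1 + ?\<rho>\<^sup>2) + norm \<beta> * (2.12 * ?\<rho> ^ 3 + 24.5 * ?\<rho> + 6.7)) * E x (t k) * (norm u)\<^sup>2"
    by (intro mult_right_mono add_left_mono norm_wt_le) auto
  finally show ?thesis by (simp add: dist_norm)
qed

lemma bump_0: "0 < a + b \<Longrightarrow> bump a b 0 = 1" "bump' a b 0 = 0" "wave a b 0 = 0" "0 < a + b \<Longrightarrow> wave' a b 0 = 1"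
  by (auto simp: bump_def bump'_def wave_def wave'_def bump_factor_def wave_factor_def wave_factor'_def add.commute)

lemma g_0: "g k \<alpha> \<beta> 0 = \<alpha>" "gx k \<alpha> \<beta> 0 = fst (wt \<beta>)" "gy k \<alpha> \<beta> 0 = snd (wt \<beta>)"
  using r by (auto simp: g_def gx_def gy_def atom_def atom_x_def atom_y_def bump_0)

text \<open>The equations ask the sum of all atoms to have value \<epsilon> j and gradient zero at t
  j, with the own atom isolated on the left; masked directions are settled in
  \<open>gradient_eq\<close>. The other atoms form a contraction, so a Neumann series
  applies.\<close>

lemma linear_system_solvable:
  obtains \<alpha> \<beta> where
    "\<And>j. j < N \<Longrightarrow> \<alpha> j = \<epsilon> j - (\<Sum>k\<in>{..<N}-{j}. g k (\<alpha> k) (\<beta> k) (t j - t k))"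
    "\<And>j. j < N \<Longrightarrow> \<beta> j = - (\<Sum>k\<in>{..<N}-{j}. (gx k (\<alpha> k) (\<beta> k) (t j - t k), gy k (\<alpha> k) (\<beta> k) (t j - t k)))"
proof -
  define L where "L j k z = (if j = k then 0 else
      - (g k (fst z) (snd z) (t j - t k), (gx k (fst z) (snd z) (t j - t k), gy k (fst z) (snd z) (t j - t k))))"
    for j k and z :: "real \<times> (real \<times> real)"
  \<comment> \<open>Sum of the value bound and the gradient bound of an atom: 8.4 = 1 + 7.4 and 3.12
    = 2.12 + 1.\<close>
  define c where "c j k = (if j = k then 0 else
      (8.4 * E (t j) (t k) + 3.12 * (dist (t j) (t k) * E (t j) (t k)) + 2.12 * ((dist (t j) (t k))\<^sup>2 * E (t j) (t k))))" for j k
  have bnd: "norm (L j k z) \<le> c j k * norm z" if "k < N" for j k z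
  proof (cases "j = k")
    case False
    obtain a b where z: "z = (a, b)" by (meson surj_pair)
    have a: "\<bar>a\<bar> \<le> norm z" and b: "norm b \<le> norm z"
      using norm_fst_le[of a b] norm_snd_le[of b a] by (auto simp: z)
    have "norm (L j k z) \<le> \<bar>g k a b (t j - t k)\<bar> + norm (gx k a b (t j - t k), gy k a b (t j - t k))"
      using norm_Pair_le[of "g k a b (t j - t k)" "(gx k a b (t j - t k), gy k a b (t j - t k))"]
      by (simp only: L_def z False if_False fst_conv snd_conv norm_minus_cancel real_norm_def)
    also have "\<dots> \<le> (\<bar>a\<bar> + 2.12 * norm b * dist (t j) (t k)) * E (t j) (t k)
        + (\<bar>a\<bar> * dist (t j) (t k) + norm b * (7.4 + 2.12 * (dist (t j) (t k))\<^sup>2)) * E (t j) (t k)"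
      using that by (intro add_mono g_le grad_le)
    also have "\<dots> \<le> (norm z + 2.12 * norm z * dist (t j) (t k)) * E (t j) (t k)
        + (norm z * dist (t j) (t k) + norm z * (7.4 + 2.12 * (dist (t j) (t k))\<^sup>2)) * E (t j) (t k)"
      by (intro add_mono mult_right_mono mult_left_mono a b) auto
    also have "\<dots> = c j k * norm z"
      using False by (simp add: c_def algebra_simps)
    finally show ?thesis .
  qed (simp add: L_def c_def)
  have lin: "bounded_linear (L j k)" if "k < N" for j k
  proof (rule bounded_linear_intro)
    show "L j k (x + y) = L j k x + L j k y" for x y
      by (simp add: L_def g_def gx_def gy_def atom_def atom_x_def atom_y_def wt_def algebra_simps)
    show "L j k (s *\<^sub>R x) = s *\<^sub>R L j k x" for s x
      by (simp add: L_def g_def gx_def gy_def atom_def atom_x_def atom_y_def wt_def algebra_simps)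
    show "norm (L j k x) \<le> norm x * c j k" for x
      using bnd[OF that, of j x] by (simp add: mult.commute)
  qed
  have row: "(\<Sum>k<N. c j k) \<le> 0.3" if "j < N" for j
  proof -
    have far: "3.987 < sqrt \<kappa> * dist (t j) (t k)" if "k \<in> {..<N} - {j}" for k
      using that \<open>j < N\<close> sep[of j k] by auto
    have "(\<Sum>k<N. c j k) = (\<Sum>k\<in>{..<N}-{j}. c j k)"
      by (rule sum.mono_neutral_right) (auto simp: c_def)
    also have "\<dots> = 8.4 * (\<Sum>k\<in>{..<N}-{j}. E (t j) (t k)) + 3.12 * (\<Sum>k\<in>{..<N}-{j}. dist (t j) (t k) * E (t j) (t k))
        + 2.12 * (\<Sum>k\<in>{..<N}-{j}. (dist (t j) (t k))\<^sup>2 * E (t j) (t k))"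
      unfolding sum_distrib_left sum.distrib[symmetric] by (rule sum.cong) (auto simp: c_def)
    also have "\<dots> \<le> 8.4 * 0.0043 + 3.12 * 0.0191 + 2.12 * 0.085"
      using far by (intro add_mono mult_left_mono moment_sums_far) auto
    finally show ?thesis by simp
  qed
  have "\<exists>z. \<forall>j\<in>{..<N}. z j = (\<epsilon> j, 0, 0) + (\<Sum>k\<in>{..<N}. L j k (z k))"
    by (rule neumann_series_solution[where c = c and \<theta> = "0.3"]) (use lin bnd row in \<open>auto simp: c_def\<close>)
  then obtain z where z: "z j = (\<epsilon> j, 0, 0) + (\<Sum>k<N. L j k (z k))" if "j < N" for j
    by auto
  have z': "z j = (\<epsilon> j, 0, 0) - (\<Sum>k\<in>{..<N}-{j}. (g k (fst (z k)) (snd (z k)) (t j - t k),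
      (gx k (fst (z k)) (snd (z k)) (t j - t k), gy k (fst (z k)) (snd (z k)) (t j - t k))))" if "j < N" for j
  proof -
    have "(\<Sum>k<N. L j k (z k)) = (\<Sum>k\<in>{..<N}-{j}. L j k (z k))"
      by (rule sum.mono_neutral_right) (auto simp: L_def)
    also have "\<dots> = - (\<Sum>k\<in>{..<N}-{j}. (g k (fst (z k)) (snd (z k)) (t j - t k),
      (gx k (fst (z k)) (snd (z k)) (t j - t k), gy k (fst (z k)) (snd (z k)) (t j - t k))))"
      unfolding sum_negf[symmetric] by (rule sum.cong) (auto simp: L_def)
    finally show ?thesis using z[OF that] by simp
  qed
  show ?thesis
  proof (rule that[of "\<lambda>j. fst (z j)" "\<lambda>j. snd (z j)"])
    fix j assume "j < N"
    from z'[OF this] show "fst (z j) = \<epsilon> j - (\<Sum>k\<in>{..<N}-{j}. g k (fst (z k)) (snd (z k)) (t j - t k))"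
      by (simp add: prod_eq_iff fst_sum snd_sum)
    from z'[OF \<open>j < N\<close>] show "snd (z j) = - (\<Sum>k\<in>{..<N}-{j}. (gx k (fst (z k)) (snd (z k)) (t j - t k), gy k (fst (z k)) (snd (z k)) (t j - t k)))"
      by (simp add: prod_eq_iff fst_sum snd_sum)
  qed
qed

text \<open>A priori estimate: inserting the far moments, the maxima a of |\<alpha>| and n of the
  norms of \<beta> satisfy roughly a <= 1 + 0.0043 a + 0.041 n and n <= 0.0191 a + 0.212 n. Solving
  these two linear inequalities gives the bounds.\<close>

lemma coefficients_exist:
  obtains \<alpha> \<beta> where
    "\<And>j. j < N \<Longrightarrow> \<alpha> j = \<epsilon> j - (\<Sum>k\<in>{..<N}-{j}. g k (\<alpha> k) (\<beta> k) (t j - t k))"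
    "\<And>j. j < N \<Longrightarrow> \<beta> j = - (\<Sum>k\<in>{..<N}-{j}. (gx k (\<alpha> k) (\<beta> k) (t j - t k), gy k (\<alpha> k) (\<beta> k) (t j - t k)))"
    "\<And>j. j < N \<Longrightarrow> \<bar>\<alpha> j - \<epsilon> j\<bar> \<le> 0.006" "\<And>j. j < N \<Longrightarrow> norm (\<beta> j) \<le> 0.025"
proof -
  obtain \<alpha> \<beta> where
    eq: "\<And>j. j < N \<Longrightarrow> \<alpha> j = \<epsilon> j - (\<Sum>k\<in>{..<N}-{j}. g k (\<alpha> k) (\<beta> k) (t j - t k))"
    "\<And>j. j < N \<Longrightarrow> \<beta> j = - (\<Sum>k\<in>{..<N}-{j}. (gx k (\<alpha> k) (\<beta> k) (t j - t k), gy k (\<alpha> k) (\<beta> k) (t j - t k)))"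
    using linear_system_solvable by blast
  \<comment> \<open>Inserting 0 keeps the maximum defined and nonnegative, also for N = 0.\<close>
  define a where "a = Max (insert 0 ((\<lambda>j. \<bar>\<alpha> j\<bar>) ` {..<N}))"
  define n where "n = Max (insert 0 ((\<lambda>j. norm (\<beta> j)) ` {..<N}))"
  have a: "\<bar>\<alpha> j\<bar> \<le> a" "norm (\<beta> j) \<le> n" if "j < N" for j
    using that by (auto simp: a_def n_def intro!: Max_ge)
  have nn: "0 \<le> a" "0 \<le> n" by (auto simp: a_def n_def)
  have \<alpha>_le: "\<bar>\<alpha> j - \<epsilon> j\<bar> \<le> 0.0043 * a + 2.12 * 0.0191 * n"
    and \<beta>_le: "norm (\<beta> j) \<le> 0.0191 * a + (7.4 * 0.0043 + 2.12 * 0.085) * n" if j: "j < N" for j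
  proof -
    let ?K = "{..<N} - {j}"
    have far: "3.987 < sqrt \<kappa> * dist (t j) (t k)" if "k \<in> ?K" for k
      using that \<open>j < N\<close> sep[of j k] by auto
    have m: "(\<Sum>k\<in>?K. E (t j) (t k)) \<le> 0.0043" "(\<Sum>k\<in>?K. dist (t j) (t k) * E (t j) (t k)) \<le> 0.0191"
      "(\<Sum>k\<in>?K. (dist (t j) (t k))\<^sup>2 * E (t j) (t k)) \<le> 0.085"
      using far by (intro moment_sums_far; force)+
    have "\<bar>\<alpha> j - \<epsilon> j\<bar> = \<bar>\<Sum>k\<in>?K. g k (\<alpha> k) (\<beta> k) (t j - t k)\<bar>"
      by (subst eq(1)[OF j]) simp
    also have "\<dots> \<le> (\<Sum>k\<in>?K. \<bar>g k (\<alpha> k) (\<beta> k) (t j - t k)\<bar>)" by (rule sum_abs)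
    also have "\<dots> \<le> (\<Sum>k\<in>?K. (a + 2.12 * n * dist (t j) (t k)) * E (t j) (t k))"
      using a by (intro sum_mono order_trans[OF g_le] mult_right_mono add_mono mult_left_mono) auto
    also have "\<dots> = a * (\<Sum>k\<in>?K. E (t j) (t k)) + 2.12 * n * (\<Sum>k\<in>?K. dist (t j) (t k) * E (t j) (t k))"
      unfolding sum_distrib_left sum.distrib[symmetric] by (simp only: distrib_right mult.assoc)
    also have "\<dots> \<le> a * 0.0043 + 2.12 * n * 0.0191"
      using m nn by (intro add_mono mult_left_mono) auto
    finally show "\<bar>\<alpha> j - \<epsilon> j\<bar> \<le> 0.0043 * a + 2.12 * 0.0191 * n" by simp
    have "norm (\<beta> j) \<le> (\<Sum>k\<in>?K. norm (gx k (\<alpha> k) (\<beta> k) (t j - t k), gy k (\<alpha> k) (\<beta> k) (t j - t k)))"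
      by (subst eq(2)[OF j], subst norm_minus_cancel) (rule norm_sum)
    also have "\<dots> \<le> (\<Sum>k\<in>?K. (a * dist (t j) (t k) + n * (7.4 + 2.12 * (dist (t j) (t k))\<^sup>2)) * E (t j) (t k))"
      using a by (intro sum_mono order_trans[OF grad_le] mult_right_mono add_mono) auto
    also have "\<dots> = a * (\<Sum>k\<in>?K. dist (t j) (t k) * E (t j) (t k)) + n * (7.4 * (\<Sum>k\<in>?K. E (t j) (t k))
        + 2.12 * (\<Sum>k\<in>?K. (dist (t j) (t k))\<^sup>2 * E (t j) (t k)))"
      unfolding sum_distrib_left sum.distrib[symmetric] by (simp only: distrib_right distrib_left mult.assoc)
    also have "\<dots> \<le> a * 0.0191 + n * (7.4 * 0.0043 + 2.12 * 0.085)"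
      using m nn by (intro add_mono mult_left_mono) auto
    finally show "norm (\<beta> j) \<le> 0.0191 * a + (7.4 * 0.0043 + 2.12 * 0.085) * n" by simp
  qed
  have "a \<le> 1 + (0.0043 * a + 2.12 * 0.0191 * n)"
    unfolding a_def
  proof (subst Max_le_iff, simp, simp, fold a_def, intro ballI)
    fix u assume "u \<in> insert 0 ((\<lambda>j. \<bar>\<alpha> j\<bar>) ` {..<N})"
    then consider "u = 0" | j where "j < N" "u = \<bar>\<alpha> j\<bar>" by auto
    then show "u \<le> 1 + (0.0043 * a + 2.12 * 0.0191 * n)"
    proof cases
      case 2
      then show ?thesis using \<alpha>_le[of j] \<epsilon>[of j] by linarith
    qed (use nn in auto)
  qed
  moreover have "n \<le> 0.0191 * a + (7.4 * 0.0043 + 2.12 * 0.085) * n"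
    unfolding n_def
  proof (subst Max_le_iff, simp, simp, fold n_def, intro ballI)
    fix u assume "u \<in> insert 0 ((\<lambda>j. norm (\<beta> j)) ` {..<N})"
    then consider "u = 0" | j where "j < N" "u = norm (\<beta> j)" by auto
    then show "u \<le> 0.0191 * a + (7.4 * 0.0043 + 2.12 * 0.085) * n"
    proof cases
      case 2
      then show ?thesis using \<beta>_le[of j] by simp
    qed (use nn in auto)
  qed
  ultimately have an: "n \<le> 0.025" "0.0043 * a + 2.12 * 0.0191 * n \<le> 0.006"
    using nn by simp_all
  show ?thesis
  proof (rule that[OF eq])
    show "\<bar>\<alpha> j - \<epsilon> j\<bar> \<le> 0.006" if "j < N" for j using \<alpha>_le[OF that] an by linarith
    show "norm (\<beta> j) \<le> 0.025" if "j < N" for j using a(2)[OF that] an by linarith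
  qed
qed

end

subsection \<open>The interpolant is small off the spikes\<close>

text \<open>From (1 - u + u^2/2)(1 + u + u^2/2) = 1 + u^4/4 and the quadratic lower bound for exp
  u.\<close>

lemma exp_minus_le_quadratic:
  fixes u :: real
  assumes "0 \<le> u"
  shows "exp (- u) \<le> 1 - u + u\<^sup>2 / 2"
proof -
  have "1 \<le> 1 + u ^ 4 / 4" by simp
  also have "\<dots> = (1 - u + u\<^sup>2 / 2) * (1 + u + u\<^sup>2 / 2)"
    by (simp add: algebra_simps power2_eq_square power4_eq_xxxx)
  also have "\<dots> \<le> (1 - u + u\<^sup>2 / 2) * exp u"
  proof (rule mult_left_mono)
    show "1 + u + u\<^sup>2 / 2 \<le> exp u" using assms by (rule exp_lower_Taylor_quadratic)
    have "0 \<le> (1 - u)\<^sup>2" by simp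
    then show "0 \<le> 1 - u + u\<^sup>2 / 2" by (simp add: power2_eq_square algebra_simps)
  qed
  finally show ?thesis by (simp add: exp_minus field_simps)
qed

locale interpolant = spike_config +
  fixes \<alpha> :: "nat \<Rightarrow> real" and \<beta> :: "nat \<Rightarrow> real \<times> real"
  assumes \<alpha>_eq: "\<And>j. j < N \<Longrightarrow> \<alpha> j = \<epsilon> j - (\<Sum>k\<in>{..<N}-{j}. g k (\<alpha> k) (\<beta> k) (t j - t k))"
    and \<beta>_eq: "\<And>j. j < N \<Longrightarrow> \<beta> j = - (\<Sum>k\<in>{..<N}-{j}. (gx k (\<alpha> k) (\<beta> k) (t j - t k), gy k (\<alpha> k) (\<beta> k) (t j - t k)))"
    and \<alpha>_near: "\<And>j. j < N \<Longrightarrow> \<bar>\<alpha> j - \<epsilon> j\<bar> \<le> 0.006"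
    and \<beta>_small: "\<And>j. j < N \<Longrightarrow> norm (\<beta> j) \<le> 0.025"
begin

definition q :: "real \<times> real \<Rightarrow> real" where
  "q x = (\<Sum>k<N. g k (\<alpha> k) (\<beta> k) (x - t k))"

lemma \<alpha>_le: "j < N \<Longrightarrow> \<bar>\<alpha> j\<bar> \<le> 1.006"
  using \<alpha>_near[of j] \<epsilon>[of j] by (simp add: abs_if split: if_splits)

lemma q_split:
  assumes "j < N"
  shows "q x = g j (\<alpha> j) (\<beta> j) (x - t j) + (\<Sum>k\<in>{..<N}-{j}. g k (\<alpha> k) (\<beta> k) (x - t k))"
  unfolding q_def using assms by (subst sum.remove[of _ j]) auto

lemma q_spike:
  assumes "j < N"
  shows "q (t j) = \<epsilon> j"
  using \<alpha>_eq[OF assms] by (simp add: q_split[OF assms] g_0)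

text \<open>In a masked direction all spikes share the coordinate, bumps have slope 0 there and the
  wave has weight 0, so both sides vanish; otherwise this is the equation for \<beta>.\<close>

lemma gradient_eq:
  assumes j: "j < N"
  shows "(\<Sum>k\<in>{..<N}-{j}. gx k (\<alpha> k) (\<beta> k) (t j - t k)) = - fst (wt (\<beta> j))"
    and "(\<Sum>k\<in>{..<N}-{j}. gy k (\<alpha> k) (\<beta> k) (t j - t k)) = - snd (wt (\<beta> j))"
proof -
  have eq: "fst (\<beta> j) = - (\<Sum>k\<in>{..<N}-{j}. gx k (\<alpha> k) (\<beta> k) (t j - t k))"
    "snd (\<beta> j) = - (\<Sum>k\<in>{..<N}-{j}. gy k (\<alpha> k) (\<beta> k) (t j - t k))"
    using \<beta>_eq[OF j] by (auto simp: prod_eq_iff fst_sum snd_sum)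
  show "(\<Sum>k\<in>{..<N}-{j}. gx k (\<alpha> k) (\<beta> k) (t j - t k)) = - fst (wt (\<beta> j))"
  proof (cases "fst \<omega> = 1")
    case False
    then have \<omega>: "fst \<omega> = 0" and const: "\<forall>j<N. \<forall>k<N. fst (t j) = fst (t k)"
      using \<omega>_fst by blast+
    have "gx k (\<alpha> k) (\<beta> k) (t j - t k) = 0" if "k < N" for k
    proof -
      have "fst (t j) = fst (t k)" using const j that by blast
      then show ?thesis by (simp add: gx_def atom_x_def wt_def \<omega> bump_0)
    qed
    then have "(\<Sum>k\<in>{..<N}-{j}. gx k (\<alpha> k) (\<beta> k) (t j - t k)) = 0"
      by (intro sum.neutral) blast
    moreover have "fst (wt (\<beta> j)) = 0" by (simp add: wt_def \<omega>)
    ultimately show ?thesis by linarith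
  next
    case True
    then have "fst (wt (\<beta> j)) = fst (\<beta> j)" by (simp add: wt_def)
    then show ?thesis using eq(1) by linarith
  qed
  show "(\<Sum>k\<in>{..<N}-{j}. gy k (\<alpha> k) (\<beta> k) (t j - t k)) = - snd (wt (\<beta> j))"
  proof (cases "snd \<omega> = 1")
    case False
    then have \<omega>: "snd \<omega> = 0" and const: "\<forall>j<N. \<forall>k<N. snd (t j) = snd (t k)"
      using \<omega>_snd by blast+
    have "gy k (\<alpha> k) (\<beta> k) (t j - t k) = 0" if "k < N" for k
    proof -
      have "snd (t j) = snd (t k)" using const j that by blast
      then show ?thesis by (simp add: gy_def atom_y_def wt_def \<omega> bump_0)
    qed
    then have "(\<Sum>k\<in>{..<N}-{j}. gy k (\<alpha> k) (\<beta> k) (t j - t k)) = 0"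
      by (intro sum.neutral) blast
    moreover have "snd (wt (\<beta> j)) = 0" by (simp add: wt_def \<omega>)
    ultimately show ?thesis by linarith
  next
    case True
    then have "snd (wt (\<beta> j)) = snd (\<beta> j)" by (simp add: wt_def)
    then show ?thesis using eq(2) by linarith
  qed
qed

text \<open>Taylor's formula along the segment from t j to t j + v: the equations for the
  coefficients identify value and slope of the other atoms at t j, and half of the Hessian bound
  0.63 remains.\<close>

lemma far_remainder_le:
  assumes j: "j < N" and v: "sqrt \<kappa> * norm v \<le> 0.4"
  shows "\<bar>(\<Sum>k\<in>{..<N}-{j}. g k (\<alpha> k) (\<beta> k) (t j + v - t k)) - (\<epsilon> j - \<alpha> j) + (fst (wt (\<beta> j)) * fst v + snd (wt (\<beta> j)) * snd v)\<bar>
    \<le> 0.315 * (norm v)\<^sup>2"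
proof -
  let ?K = "{..<N} - {j}"
  define f where "f s = (\<Sum>k\<in>?K. g k (\<alpha> k) (\<beta> k) (t j - t k + s *\<^sub>R v))" for s
  define f1 where "f1 s = (\<Sum>k\<in>?K. gx k (\<alpha> k) (\<beta> k) (t j - t k + s *\<^sub>R v) * fst v + gy k (\<alpha> k) (\<beta> k) (t j - t k + s *\<^sub>R v) * snd v)" for s
  define f2 where "f2 s = (\<Sum>k\<in>?K. guu k (\<alpha> k) (\<beta> k) v (t j - t k + s *\<^sub>R v))" for s
  \<comment> \<open>\<open>Maclaurin\<close> expects the successive derivatives as one indexed
    family.\<close>
  define F where "F n = [f, f1, f2] ! n" for n
  have "(f has_real_derivative f1 s) (at s)" for s
    unfolding f_def f1_def g_def gx_def gy_def using r
    by (intro DERIV_sum atom_line_derivative) auto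
  moreover have "(f1 has_real_derivative f2 s) (at s)" for s
    unfolding f1_def f2_def guu_def gx_def gy_def using r
    by (intro DERIV_sum atom_line_derivative2) auto
  ultimately have "\<forall>m s. m < 2 \<and> 0 \<le> s \<and> s \<le> 1 \<longrightarrow> (F m has_real_derivative F (Suc m) s) (at s)"
    by (auto simp: F_def nth_Cons split: nat.splits)
  from Maclaurin[of 1 2 F f, OF _ _ _ this]
  obtain s where s: "0 < s" "s < 1" "f 1 = f 0 + f1 0 + f2 s / 2"
    by (auto simp: F_def lessThan_nat_numeral)
  have "f 0 = \<epsilon> j - \<alpha> j" using \<alpha>_eq[OF j] by (simp add: f_def)
  moreover have "f1 0 = - (fst (wt (\<beta> j)) * fst v + snd (wt (\<beta> j)) * snd v)"
    by (simp add: f1_def sum.distrib gradient_eq[OF j] flip: sum_distrib_right)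
  ultimately have eq: "(\<Sum>k\<in>?K. g k (\<alpha> k) (\<beta> k) (t j + v - t k)) - (\<epsilon> j - \<alpha> j) + (fst (wt (\<beta> j)) * fst v + snd (wt (\<beta> j)) * snd v) = f2 s / 2"
    using s(3) by (simp add: f_def algebra_simps)
  define x where "x = t j + s *\<^sub>R v"
  have "sqrt \<kappa> * dist (t j) x \<le> 0.4"
  proof -
    have "sqrt \<kappa> * (s * norm v) \<le> sqrt \<kappa> * (1 * norm v)"
      using s \<kappa>_pos by (intro mult_left_mono mult_right_mono) auto
    then show ?thesis using v s by (simp add: x_def dist_norm)
  qed
  then have far: "3.587 \<le> sqrt \<kappa> * dist x (t k)" if "k \<in> ?K" for k
  proof -
    have "sqrt \<kappa> * dist (t j) (t k) \<le> sqrt \<kappa> * (dist (t j) x + dist x (t k))"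
      using \<kappa>_pos by (intro mult_left_mono dist_triangle) auto
    then show ?thesis
      using sep[of j k] that j \<open>sqrt \<kappa> * dist (t j) x \<le> 0.4\<close> by (auto simp: distrib_left)
  qed
  have "\<bar>f2 s\<bar> \<le> (\<Sum>k\<in>?K. \<bar>guu k (\<alpha> k) (\<beta> k) v (x - t k)\<bar>)"
    unfolding f2_def x_def by (rule order_trans[OF sum_abs]) (simp add: algebra_simps)
  also have "\<dots> \<le> (\<Sum>k\<in>?K. (1.006 * (1 + (dist x (t k))\<^sup>2) + 0.025 * (2.12 * dist x (t k) ^ 3 + 24.5 * dist x (t k) + 6.7)) * E x (t k) * (norm v)\<^sup>2)"
    using \<alpha>_le \<beta>_small by (intro sum_mono order_trans[OF guu_le] mult_right_mono add_mono) auto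
  also have "\<dots> = (1.006 * ((\<Sum>k\<in>?K. E x (t k)) + (\<Sum>k\<in>?K. (dist x (t k))\<^sup>2 * E x (t k)))
      + 0.025 * (2.12 * (\<Sum>k\<in>?K. dist x (t k) ^ 3 * E x (t k)) + 24.5 * (\<Sum>k\<in>?K. dist x (t k) * E x (t k)) + 6.7 * (\<Sum>k\<in>?K. E x (t k)))) * (norm v)\<^sup>2"
    unfolding sum_distrib_left sum_distrib_right sum.distrib[symmetric]
    by (rule sum.cong) (simp_all only: distrib_right distrib_left mult.assoc mult_1)
  also have "\<dots> \<le> (1.006 * (0.0262 + 0.43) + 0.025 * (2.12 * 1.75 + 24.5 * 0.106 + 6.7 * 0.0262)) * (norm v)\<^sup>2"
    using far by (intro mult_right_mono add_mono mult_left_mono moment_sums_near) auto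
  also have "\<dots> \<le> 0.63 * (norm v)\<^sup>2"
    by (intro mult_right_mono) auto
  finally show ?thesis unfolding eq by simp
qed

text \<open>The linear terms of the own waves and of the far atoms cancel, leaving q = \<epsilon> -
  \<alpha> (1 - b) + w + R with quadratic errors w and R. The decay of the product bump b outweighs
  both errors, and V <= 0.2 keeps \<epsilon> q away from -1.\<close>

lemma q_near:
  assumes j: "j < N" and x: "x \<noteq> t j" "sqrt \<kappa> * dist x (t j) \<le> 0.4"
  shows "\<bar>q x\<bar> < 1"
proof -
  define v where "v = x - t j"
  define V where "V = (norm v)\<^sup>2"
  have v: "sqrt \<kappa> * norm v \<le> 0.4" using x by (simp add: v_def dist_norm)
  have "0 < V" using x by (simp add: V_def v_def)
  have \<kappa>V: "\<kappa> * V \<le> 0.16"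
    using power_mono[OF v, of 2] \<kappa>_pos by (simp add: V_def scaled_square power_divide)
  have "0.801 * V \<le> \<kappa> * V" using \<kappa> \<open>0 < V\<close> by (intro mult_right_mono) auto
  have "V \<le> 0.2" using \<kappa>V \<open>0.801 * V \<le> \<kappa> * V\<close> by simp
  have v': "norm v \<le> 0.45"
    by (rule power2_le_imp_le) (use \<open>V \<le> 0.2\<close> in \<open>auto simp: V_def power_divide\<close>)
  interpret cell2 "A j" "r - A j" "C j" "r - C j" r by (rule cell2[OF j])
  let ?b = "bump (A j) (r - A j) (fst v) * bump (C j) (r - C j) (snd v)"
  let ?w = "fst (wt (\<beta> j)) * (wave (A j) (r - A j) (fst v) * bump (C j) (r - C j) (snd v) - fst v)
     + snd (wt (\<beta> j)) * (bump (A j) (r - A j) (fst v) * wave (C j) (r - C j) (snd v) - snd v)"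
  let ?R = "(\<Sum>k\<in>{..<N}-{j}. g k (\<alpha> k) (\<beta> k) (t j + v - t k)) - (\<epsilon> j - \<alpha> j) + (fst (wt (\<beta> j)) * fst v + snd (wt (\<beta> j)) * snd v)"
  have "q x = \<epsilon> j - \<alpha> j * (1 - ?b) + ?w + ?R"
    by (simp add: q_split[OF j] g_def atom_def v_def algebra_simps)
  moreover have "\<bar>?w\<bar> \<le> 0.05 * V"
  proof -
    have "\<bar>?w\<bar> \<le> 2 * norm (wt (\<beta> j)) * V" unfolding V_def using v' by (rule own_wave_le)
    also have "\<dots> \<le> 2 * 0.025 * V"
      using norm_wt_le[of "\<beta> j"] \<beta>_small[OF j] \<open>0 < V\<close> by (intro mult_right_mono mult_left_mono) auto
    finally show ?thesis by simp
  qed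
  moreover have "\<bar>?R\<bar> \<le> 0.315 * V" unfolding V_def using j v by (rule far_remainder_le)
  \<comment> \<open>0.48 = 1/2 - 0.16/8: the quadratic term in the expansion of exp(- \<kappa> V /
    2) is absorbed using \<kappa> V <= 0.16.\<close>
  moreover have b: "0 \<le> ?b" "?b \<le> 1 - 0.48 * (\<kappa> * V)"
  proof -
    have pos: "0 \<le> bump (A j) (r - A j) (fst v)" "0 \<le> bump (C j) (r - C j) (snd v)"
      using X.bump_ge Y.bump_ge order_trans[OF exp_ge_zero] by blast+
    then show "0 \<le> ?b" by simp
    have "?b \<le> env r (fst v) * env r (snd v)"
      using X.bump_le[of "fst v"] Y.bump_le[of "snd v"] pos by (intro mult_mono) auto
    also have "\<dots> = exp (- (\<kappa> * V / 2))"
      unfolding env_mult by (simp add: V_def \<kappa>_def field_simps)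
    also have "\<dots> \<le> 1 - \<kappa> * V / 2 + (\<kappa> * V / 2)\<^sup>2 / 2"
      using \<kappa>_pos \<open>0 < V\<close> by (intro exp_minus_le_quadratic) auto
    also have "\<dots> \<le> 1 - 0.48 * (\<kappa> * V)"
    proof -
      have "(\<kappa> * V) * (\<kappa> * V) \<le> 0.16 * (\<kappa> * V)"
        using \<kappa>V \<kappa>_pos \<open>0 < V\<close> by (intro mult_right_mono) auto
      then show ?thesis by (simp add: power2_eq_square)
    qed
    finally show "?b \<le> 1 - 0.48 * (\<kappa> * V)" .
  qed
  ultimately obtain w R where qx: "q x = \<epsilon> j - \<alpha> j * (1 - ?b) + w + R" "\<bar>w\<bar> \<le> 0.05 * V" "\<bar>R\<bar> \<le> 0.315 * V"
    by blast
  have a: "\<bar>\<alpha> j - \<epsilon> j\<bar> \<le> 0.006" by (rule \<alpha>_near[OF j])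
  have "\<epsilon> j * \<alpha> j \<ge> 0.994" "\<epsilon> j * \<alpha> j \<le> 1.006"
    using a \<epsilon>[of j] by (auto simp: abs_if split: if_splits)
  have "0.48 * (0.801 * V) \<le> 0.48 * (\<kappa> * V)"
    using \<open>0.801 * V \<le> \<kappa> * V\<close> by (intro mult_left_mono) auto
  then have "0.48 * (0.801 * V) \<le> 1 - ?b" using b(2) by linarith
  have "0 \<le> \<kappa> * V" using \<kappa>_pos \<open>0 < V\<close> by simp
  then have "0 \<le> 0.48 * (\<kappa> * V)" by simp
  then have "?b \<le> 1" using b(2) by linarith
  then have "0.994 * (0.48 * (0.801 * V)) \<le> (\<epsilon> j * \<alpha> j) * (1 - ?b)"
    using \<open>\<epsilon> j * \<alpha> j \<ge> 0.994\<close> \<open>0 < V\<close> \<open>0.48 * (0.801 * V) \<le> 1 - ?b\<close> by (intro mult_mono) auto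
  moreover have "(\<epsilon> j * \<alpha> j) * (1 - ?b) \<le> 1.006 * 1"
    using b(1) \<open>\<epsilon> j * \<alpha> j \<le> 1.006\<close> \<open>?b \<le> 1\<close> by (intro mult_mono) auto
  moreover have "\<epsilon> j * q x = 1 - (\<epsilon> j * \<alpha> j) * (1 - ?b) + \<epsilon> j * w + \<epsilon> j * R"
    using \<epsilon>[of j] unfolding qx(1) by (simp add: abs_if algebra_simps split: if_splits)
  moreover have "\<bar>\<epsilon> j * w\<bar> \<le> 0.05 * V" "\<bar>\<epsilon> j * R\<bar> \<le> 0.315 * V"
    using qx \<epsilon>[of j] by (simp_all add: abs_mult)
  ultimately have "\<bar>\<epsilon> j * q x\<bar> < 1"
    using \<open>0 < V\<close> \<open>V \<le> 0.2\<close> by (simp add: abs_less_iff; linarith)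
  then show ?thesis using \<epsilon>[of j] by (simp add: abs_mult)
qed

text \<open>0.0593 exceeds 2.12 * 0.025 * 1.118.\<close>

lemma g_term_le:
  assumes "k < N"
  shows "\<bar>g k (\<alpha> k) (\<beta> k) (x - t k)\<bar> \<le> (1.006 + 0.0593 * (sqrt \<kappa> * dist x (t k))) * E x (t k)"
proof -
  have "\<bar>g k (\<alpha> k) (\<beta> k) (x - t k)\<bar> \<le> (\<bar>\<alpha> k\<bar> + 2.12 * norm (\<beta> k) * dist x (t k)) * E x (t k)"
    by (rule g_le[OF assms])
  also have "\<dots> \<le> (1.006 + 2.12 * 0.025 * (1.118 * (sqrt \<kappa> * dist x (t k)))) * E x (t k)"
    using \<alpha>_le[OF assms] \<beta>_small[OF assms] dist_le_scaled[of x "t k"]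
    by (intro mult_right_mono add_mono mult_mono) auto
  also have "\<dots> \<le> (1.006 + 0.0593 * (sqrt \<kappa> * dist x (t k))) * E x (t k)"
    using \<kappa>_pos by (intro mult_right_mono) auto
  finally show ?thesis .
qed

lemma g_term_le_gauss:
  assumes "k < N"
  shows "\<bar>g k (\<alpha> k) (\<beta> k) (x - t k)\<bar> \<le> 1.09 * exp (- 0.49 * \<kappa> * (dist x (t k))\<^sup>2)"
proof -
  define z where "z = sqrt \<kappa> * dist x (t k)"
  have z2: "z\<^sup>2 = \<kappa> * (dist x (t k))\<^sup>2" by (simp add: z_def scaled_square)
  have "1.006 + 0.0593 * z \<le> 1.09 * (1 + 0.01 * z\<^sup>2)"
  proof -
    have "0 \<le> (z - 2.73)\<^sup>2" by simp
    then have "5.46 * z \<le> z\<^sup>2 + 7.4529" by (simp add: power2_diff power_divide)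
    moreover have "0 \<le> z" using \<kappa>_pos by (simp add: z_def)
    ultimately show ?thesis by simp
  qed
  also have "\<dots> \<le> 1.09 * exp (0.01 * z\<^sup>2)"
    using exp_ge_add_one_self[of "0.01 * z\<^sup>2"] by (intro mult_left_mono) auto
  finally have "(1.006 + 0.0593 * z) * exp (- z\<^sup>2 / 2) \<le> 1.09 * exp (0.01 * z\<^sup>2) * exp (- z\<^sup>2 / 2)"
    by (intro mult_right_mono) auto
  also have "\<dots> = 1.09 * exp (- 0.49 * z\<^sup>2)"
    by (simp add: algebra_simps flip: exp_add)
  finally show ?thesis
    using g_term_le[OF assms, of x] by (simp add: z_def[symmetric] z2 mult.assoc)
qed

text \<open>4.36 = 4 * 1.09 belongs to the squares touching x, and 0.1802 collects all others. In
  the companion with sixteen equal squares, 17.44 = 16 * 1.09.\<close>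

lemma atoms_sum_le4:
  assumes "S \<subseteq> {..<N}" "0 \<le> R" "\<And>k. k \<in> S \<Longrightarrow> R \<le> sqrt \<kappa> * dist x (t k)" "exp (- 0.49 * R\<^sup>2) \<le> u"
  shows "(\<Sum>k\<in>S. \<bar>g k (\<alpha> k) (\<beta> k) (x - t k)\<bar>) \<le> 4.36 * u + 0.1802"
proof -
  have "(\<Sum>k\<in>S. \<bar>g k (\<alpha> k) (\<beta> k) (x - t k)\<bar>) \<le> 1.09 * (\<Sum>k\<in>S. exp (- 0.49 * \<kappa> * (dist x (t k))\<^sup>2))"
    unfolding sum_distrib_left using assms(1) by (intro sum_mono g_term_le_gauss) auto
  also have "\<dots> \<le> 1.09 * (4 * exp (- 0.49 * R\<^sup>2) + 8 * exp (- 0.49 * (3.987\<^sup>2 / 2)) + 4 * exp (- 0.49 * 3.987\<^sup>2) + 32 * exp (- 2 * 0.49 * 3.987\<^sup>2))"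
    using assms by (intro mult_left_mono gauss_sum_le4) auto
  also have "\<dots> \<le> 1.09 * (4 * u + 8 * 0.0204 + 4 * 0.00042 + 32 * 0.0000003)"
  proof (intro mult_left_mono add_mono assms)
    show "exp (- 0.49 * (3.987\<^sup>2 / 2)) \<le> (0.0204 :: real)"
    by (rule exp_le_pow16[where u = "0.24341" and p = "1.27558"]) (simp_all add: power_divide)
    show "exp (- 0.49 * 3.987\<^sup>2) \<le> (0.00042 :: real)"
    by (rule exp_le_pow16[where u = "0.48682" and p = "1.62688"]) (simp_all add: power_divide)
    show "exp (- 2 * 0.49 * 3.987\<^sup>2) \<le> (0.0000003 :: real)"
    by (rule exp_le_pow16[where u = "0.97364" and p = "2.6389"]) (simp_all add: power_divide)
  qed auto
  finally show ?thesis by simp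
qed

lemma atoms_sum_le16:
  assumes "S \<subseteq> {..<N}" "0 \<le> R" "\<And>k. k \<in> S \<Longrightarrow> R \<le> sqrt \<kappa> * dist x (t k)" "exp (- 0.49 * R\<^sup>2) \<le> u"
  shows "(\<Sum>k\<in>S. \<bar>g k (\<alpha> k) (\<beta> k) (x - t k)\<bar>) \<le> 17.44 * u + 0.0001"
proof -
  have "(\<Sum>k\<in>S. \<bar>g k (\<alpha> k) (\<beta> k) (x - t k)\<bar>) \<le> 1.09 * (\<Sum>k\<in>S. exp (- 0.49 * \<kappa> * (dist x (t k))\<^sup>2))"
    unfolding sum_distrib_left using assms(1) by (intro sum_mono g_term_le_gauss) auto
  also have "\<dots> \<le> 1.09 * (16 * exp (- 0.49 * R\<^sup>2) + 32 * exp (- 2 * 0.49 * 3.987\<^sup>2))"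
    using assms by (intro mult_left_mono gauss_sum_le16) auto
  also have "\<dots> \<le> 1.09 * (16 * u + 32 * 0.0000003)"
  proof (intro mult_left_mono add_mono assms)
    show "exp (- 2 * 0.49 * 3.987\<^sup>2) \<le> (0.0000003 :: real)"
    by (rule exp_le_pow16[where u = "0.97364" and p = "2.6389"]) (simp_all add: power_divide)
  qed auto
  finally show ?thesis by simp
qed

(* z0 and z1 bound the scaled distance to the nearest spike j: its own term is estimated at z0, and the
   other spikes are at distance at least 3.987 - z1. *)
lemma q_annulus:
  assumes j: "j < N" and z: "z0 \<le> sqrt \<kappa> * dist x (t j)" "sqrt \<kappa> * dist x (t j) \<le> z1" "0 \<le> z0" "z1 \<le> 3"
    and u: "exp (- (z0\<^sup>2 / 2)) \<le> u" and w: "exp (- 0.49 * (3.987 - z1)\<^sup>2) \<le> w"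
    and less: "(1.006 + 0.0593 * z1) * u + (17.44 * w + 0.0001) < 1 \<or> (1.006 + 0.0593 * z1) * u + (4.36 * w + 0.1802) < 1"
  shows "\<bar>q x\<bar> < 1"
proof -
  let ?K = "{..<N} - {j}"
  have far: "3.987 - z1 \<le> sqrt \<kappa> * dist x (t k)" if "k \<in> ?K" for k
  proof -
    have "sqrt \<kappa> * dist (t j) (t k) \<le> sqrt \<kappa> * (dist x (t j) + dist x (t k))"
      using \<kappa>_pos by (intro mult_left_mono dist_triangle3) auto
    then show ?thesis using sep[of j k] that j z by (auto simp: distrib_left)
  qed
  have "\<bar>g j (\<alpha> j) (\<beta> j) (x - t j)\<bar> \<le> (1.006 + 0.0593 * z1) * u"
  proof -
    have "exp (- (1/2) * \<kappa> * (dist x (t j))\<^sup>2) \<le> exp (- (1/2) * z0\<^sup>2)"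
      using z by (intro exp_scaled_le) auto
    moreover have "exp (- (1/2) * z0\<^sup>2) = exp (- (z0\<^sup>2 / 2))" by simp
    moreover have "exp (- (1/2) * \<kappa> * (dist x (t j))\<^sup>2) = E x (t j)" by simp
    ultimately have "E x (t j) \<le> u" using u by linarith
    moreover have "0 \<le> sqrt \<kappa> * dist x (t j)" using \<kappa>_pos by simp
    ultimately show ?thesis
      using z by (intro order_trans[OF g_term_le[OF j]] mult_mono) (auto intro: order_trans)
  qed
  moreover have "(\<Sum>k\<in>?K. \<bar>g k (\<alpha> k) (\<beta> k) (x - t k)\<bar>) \<le> 17.44 * w + 0.0001"
    using far w z by (intro atoms_sum_le16[where R = "3.987 - z1"]) auto
  moreover have "(\<Sum>k\<in>?K. \<bar>g k (\<alpha> k) (\<beta> k) (x - t k)\<bar>) \<le> 4.36 * w + 0.1802"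
    using far w z by (intro atoms_sum_le4[where R = "3.987 - z1"]) auto
  moreover have "\<bar>q x\<bar> \<le> \<bar>g j (\<alpha> j) (\<beta> j) (x - t j)\<bar> + (\<Sum>k\<in>?K. \<bar>g k (\<alpha> k) (\<beta> k) (x - t k)\<bar>)"
    unfolding q_split[OF j] by (intro order_trans[OF abs_triangle_ineq] add_left_mono sum_abs)
  ultimately show ?thesis using less by linarith
qed

text \<open>Between 0.4 and 1.9 the rings are narrow enough to estimate the own term at the inner
  radius and the others at the outer one. Up to distance 1 the sixteen-square alternative of
  \<open>q_annulus\<close> closes, beyond it only the four-square one. The innermost ring is the
  tightest, with a total of about 0.992.\<close>

lemma q_less_one:
  assumes "\<And>j. j < N \<Longrightarrow> x \<noteq> t j"
  shows "\<bar>q x\<bar> < 1"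
proof -
  let ?z = "\<lambda>j. sqrt \<kappa> * dist x (t j)"
  have i_0_4: "\<bar>q x\<bar> < 1" if "j < N" "0.4 \<le> ?z j" "?z j \<le> 0.45" for j
  proof (rule q_annulus[OF that])
    show "exp (- (0.4\<^sup>2 / 2)) \<le> (0.9234 :: real)"
    by (rule exp_le_pow16[where u = "0.005" and p = "1.00501"]) (simp_all add: power_divide)
    show "exp (- 0.49 * (3.987 - 0.45)\<^sup>2) \<le> (0.00219 :: real)"
    by (rule exp_le_pow16[where u = "0.38313" and p = "1.46679"]) (simp_all add: power_divide)
  qed (simp_all add: power_divide)
  have i_0_45: "\<bar>q x\<bar> < 1" if "j < N" "0.45 \<le> ?z j" "?z j \<le> 0.52" for j
  proof (rule q_annulus[OF that])
    show "exp (- (0.45\<^sup>2 / 2)) \<le> (0.9040 :: real)"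
    by (rule exp_le_pow16[where u = "0.00632" and p = "1.00634"]) (simp_all add: power_divide)
    show "exp (- 0.49 * (3.987 - 0.52)\<^sup>2) \<le> (0.00278 :: real)"
    by (rule exp_le_pow16[where u = "0.36811" and p = "1.44494"]) (simp_all add: power_divide)
  qed (simp_all add: power_divide)
  have i_0_52: "\<bar>q x\<bar> < 1" if "j < N" "0.52 \<le> ?z j" "?z j \<le> 0.65" for j
  proof (rule q_annulus[OF that])
    show "exp (- (0.52\<^sup>2 / 2)) \<le> (0.8739 :: real)"
    by (rule exp_le_pow16[where u = "0.00845" and p = "1.00848"]) (simp_all add: power_divide)
    show "exp (- 0.49 * (3.987 - 0.65)\<^sup>2) \<le> (0.00428 :: real)"
    by (rule exp_le_pow16[where u = "0.34102" and p = "1.40634"]) (simp_all add: power_divide)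
  qed (simp_all add: power_divide)
  have i_0_65: "\<bar>q x\<bar> < 1" if "j < N" "0.65 \<le> ?z j" "?z j \<le> 0.8" for j
  proof (rule q_annulus[OF that])
    show "exp (- (0.65\<^sup>2 / 2)) \<le> (0.8099 :: real)"
    by (rule exp_le_pow16[where u = "0.0132" and p = "1.01328"]) (simp_all add: power_divide)
    show "exp (- 0.49 * (3.987 - 0.8)\<^sup>2) \<le> (0.00691 :: real)"
    by (rule exp_le_pow16[where u = "0.31105" and p = "1.36483"]) (simp_all add: power_divide)
  qed (simp_all add: power_divide)
  have i_0_8: "\<bar>q x\<bar> < 1" if "j < N" "0.8 \<le> ?z j" "?z j \<le> 0.9" for j
  proof (rule q_annulus[OF that])
    show "exp (- (0.8\<^sup>2 / 2)) \<le> (0.7264 :: real)"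
    by (rule exp_le_pow16[where u = "0.02" and p = "1.0202"]) (simp_all add: power_divide)
    show "exp (- 0.49 * (3.987 - 0.9)\<^sup>2) \<le> (0.00939 :: real)"
    by (rule exp_le_pow16[where u = "0.29184" and p = "1.33887"]) (simp_all add: power_divide)
  qed (simp_all add: power_divide)
  have i_0_9: "\<bar>q x\<bar> < 1" if "j < N" "0.9 \<le> ?z j" "?z j \<le> 1" for j
  proof (rule q_annulus[OF that])
    show "exp (- (0.9\<^sup>2 / 2)) \<le> (0.6672 :: real)"
    by (rule exp_le_pow16[where u = "0.02531" and p = "1.02563"]) (simp_all add: power_divide)
    show "exp (- 0.49 * (3.987 - 1)\<^sup>2) \<le> (0.01265 :: real)"
    by (rule exp_le_pow16[where u = "0.27324" and p = "1.3142"]) (simp_all add: power_divide)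
  qed (simp_all add: power_divide)
  have i_1: "\<bar>q x\<bar> < 1" if "j < N" "1 \<le> ?z j" "?z j \<le> 1.25" for j
  proof (rule q_annulus[OF that])
    show "exp (- (1\<^sup>2 / 2)) \<le> (0.6068 :: real)"
    by (rule exp_le_pow16[where u = "0.03125" and p = "1.03174"]) (simp_all add: power_divide)
    show "exp (- 0.49 * (3.987 - 1.25)\<^sup>2) \<le> (0.02549 :: real)"
    by (rule exp_le_pow16[where u = "0.22941" and p = "1.25785"]) (simp_all add: power_divide)
  qed (simp_all add: power_divide)
  have i_1_25: "\<bar>q x\<bar> < 1" if "j < N" "1.25 \<le> ?z j" "?z j \<le> 1.6" for j
  proof (rule q_annulus[OF that])
    show "exp (- (1.25\<^sup>2 / 2)) \<le> (0.4580 :: real)"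
    by (rule exp_le_pow16[where u = "0.04882" and p = "1.05003"]) (simp_all add: power_divide)
    show "exp (- 0.49 * (3.987 - 1.6)\<^sup>2) \<le> (0.06137 :: real)"
    by (rule exp_le_pow16[where u = "0.17449" and p = "1.19063"]) (simp_all add: power_divide)
  qed (simp_all add: power_divide)
  have i_1_6: "\<bar>q x\<bar> < 1" if "j < N" "1.6 \<le> ?z j" "?z j \<le> 1.8" for j
  proof (rule q_annulus[OF that])
    show "exp (- (1.6\<^sup>2 / 2)) \<le> (0.2782 :: real)"
    by (rule exp_le_pow16[where u = "0.08" and p = "1.08328"]) (simp_all add: power_divide)
    show "exp (- 0.49 * (3.987 - 1.8)\<^sup>2) \<le> (0.09608 :: real)"
    by (rule exp_le_pow16[where u = "0.14647" and p = "1.15773"]) (simp_all add: power_divide)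
  qed (simp_all add: power_divide)
  have i_1_8: "\<bar>q x\<bar> < 1" if "j < N" "1.8 \<le> ?z j" "?z j \<le> 1.9" for j
  proof (rule q_annulus[OF that])
    show "exp (- (1.8\<^sup>2 / 2)) \<le> (0.1980 :: real)"
    by (rule exp_le_pow16[where u = "0.10125" and p = "1.10655"]) (simp_all add: power_divide)
    show "exp (- 0.49 * (3.987 - 1.9)\<^sup>2) \<le> (0.11846 :: real)"
    by (rule exp_le_pow16[where u = "0.13338" and p = "1.14268"]) (simp_all add: power_divide)
  qed (simp_all add: power_divide)
  consider (near) j where "j < N" "?z j \<le> 0.4" | (mid) j where "j < N" "0.4 \<le> ?z j" "?z j \<le> 1.9" | (far) "\<And>j. j < N \<Longrightarrow> 1.9 \<le> ?z j"
    by (meson linear)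
  then show ?thesis
  proof cases
    case near
    then show ?thesis using q_near assms by blast
  next
    case (mid j)
    then show ?thesis
      using i_0_4[of j] i_0_45[of j] i_0_52[of j] i_0_65[of j] i_0_8[of j] i_0_9[of j] i_1[of j] i_1_25[of j] i_1_6[of j] i_1_8[of j]
      by (smt (verit))
  next
    case far
    \<comment> \<open>No spike is singled out here: all are at least 1.9 away, and one sum bound
      covers every atom.\<close>
    have "exp (- 0.49 * 1.9\<^sup>2) \<le> (0.1706 :: real)"
    by (rule exp_le_pow16[where u = "0.11055" and p = "1.11689"]) (simp_all add: power_divide)
    then have "(\<Sum>k\<in>{..<N}. \<bar>g k (\<alpha> k) (\<beta> k) (x - t k)\<bar>) \<le> 4.36 * 0.1706 + 0.1802"
      using far by (intro atoms_sum_le4[where R = "1.9"]) auto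
    then show ?thesis
      unfolding q_def by (intro le_less_trans[OF sum_abs]) (auto elim: le_less_trans)
  qed
qed

end

subsection \<open>The dual certificate\<close>

lemma gauss_1_Pair: "gauss 1 ((a, b) - x) = exp (- (fst x - a)\<^sup>2 / 2) * exp (- (snd x - b)\<^sup>2 / 2)"
proof -
  have "norm ((a, b) - x) * norm ((a, b) - x) = (fst x - a)\<^sup>2 + (snd x - b)\<^sup>2"
    by (cases x) (simp add: norm_Pair power2_commute flip: power2_eq_square)
  then show ?thesis
    by (simp add: gauss_def add_divide_distrib flip: exp_add)
qed

definition line_span :: "real \<Rightarrow> real \<Rightarrow> nat \<Rightarrow> (real \<Rightarrow> real) \<Rightarrow> bool" where
  "line_span s r S f \<longleftrightarrow> (\<exists>c. \<forall>y. f y = (\<Sum>p<S. c p * exp (- (y - (s + r * real p))\<^sup>2 / 2)))"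

text \<open>The two coefficients are added rather than assigned, so p = p' is allowed; the grid with
  a single line uses this.\<close>

lemma line_span_two:
  assumes "p < S" "p' < S"
    "\<And>y. f y = a * exp (- (y - (s + r * real p))\<^sup>2 / 2) + b * exp (- (y - (s + r * real p'))\<^sup>2 / 2)"
  shows "line_span s r S f"
  unfolding line_span_def
proof (intro exI allI)
  fix y
  let ?G = "\<lambda>i. exp (- (y - (s + r * real i))\<^sup>2 / 2)"
  have "(\<Sum>i<S. ((if i = p then a else 0) + (if i = p' then b else 0)) * ?G i)
      = (\<Sum>i<S. (if i = p then a * ?G i else 0)) + (\<Sum>i<S. (if i = p' then b * ?G i else 0))"
    unfolding sum.distrib[symmetric] by (rule sum.cong) (auto simp: algebra_simps)
  also have "\<dots> = f y" using assms by (simp add: sum.delta)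
  finally show "f y = (\<Sum>i<S. ((if i = p then a else 0) + (if i = p' then b else 0)) * ?G i)" ..
qed

text \<open>A is the distance of x from the left node of a cell containing it. Completing the square
  turns \<open>exp (- h\<^sup>2 / 2) * exp (a * h)\<close> into a multiple of the kernel centred at
  a, so bump and wave are combinations of the two end-point kernels.\<close>

lemma line_kit:
  fixes x s r :: real and S :: nat
  assumes r: "0 < r" and x: "s \<le> x" "x \<le> s + r * (real S - 1)"
  shows "\<exists>A. 0 \<le> A \<and> A \<le> r \<and> line_span s r S (\<lambda>y. bump A (r - A) (y - x))
    \<and> (S \<noteq> 1 \<longrightarrow> line_span s r S (\<lambda>y. wave A (r - A) (y - x))) \<and> (S = 1 \<longrightarrow> x = s)"
proof -
  have "0 \<le> r * (real S - 1)" using x by linarith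
  then have "1 \<le> S" using r by (simp add: zero_le_mult_iff)
  show ?thesis
  proof (cases "S = 1")
    case True
    then have "x = s" using x by simp
    \<comment> \<open>With A = 0 the second kernel gets weight 0, so a single node suffices.\<close>
    have "bump 0 (r - 0) (y - x) = 1 * exp (- (y - (s + r * real 0))\<^sup>2 / 2) + 0 * exp (- (y - (s + r * real 0))\<^sup>2 / 2)" for y
      using r \<open>x = s\<close> by (simp add: bump_def bump_factor_def)
    then have "line_span s r S (\<lambda>y. bump 0 (r - 0) (y - x))"
      by (rule line_span_two[rotated 2]) (use True in auto)
    then show ?thesis using True \<open>x = s\<close> r by (intro exI[of _ 0]) auto
  next
    case False
    then have S: "2 \<le> S" using \<open>1 \<le> S\<close> by simp
    \<comment> \<open>The minimum puts a point on the right border into the last cell; the floor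
      alone would select the last node, which has no right neighbour.\<close>
    define p where "p = min (nat \<lfloor>(x - s) / r\<rfloor>) (S - 2)"
    have p: "p < S" "p + 1 < S" using S by (auto simp: p_def)
    have "0 \<le> (x - s) / r" using x r by simp
    have "real p \<le> (x - s) / r"
    proof -
      have "real (nat \<lfloor>(x - s) / r\<rfloor>) \<le> (x - s) / r" using \<open>0 \<le> (x - s) / r\<close> by simp
      then show ?thesis by (simp add: p_def min_def)
    qed
    have "(x - s) / r \<le> real p + 1"
    proof (cases "nat \<lfloor>(x - s) / r\<rfloor> \<le> S - 2")
      case True
      then show ?thesis using \<open>0 \<le> (x - s) / r\<close> by (simp add: p_def min_def)
    next
      case False
      have "(x - s) / r \<le> real S - 1" using x r by (simp add: pos_divide_le_eq mult.commute)
      moreover have "real p = real S - 2" using False S by (simp add: p_def min_def of_nat_diff)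
      ultimately show ?thesis by simp
    qed
    define A where "A = x - (s + r * real p)"
    define B where "B = r - A"
    have A: "0 \<le> A" "A \<le> r"
      using \<open>real p \<le> (x - s) / r\<close> \<open>(x - s) / r \<le> real p + 1\<close> r
      by (simp_all add: A_def pos_le_divide_eq pos_divide_le_eq algebra_simps)
    have AB: "A + B = r" by (simp add: B_def)
    have shift: "exp (- h\<^sup>2 / 2) * exp (a * h) = exp (a\<^sup>2 / 2) * exp (- (h - a)\<^sup>2 / 2)" for a h :: real
      by (simp only: exp_add[symmetric]) (simp add: power2_diff field_simps)
    have eA: "exp (- (y - x)\<^sup>2 / 2) * exp (- A * (y - x)) = exp (A\<^sup>2 / 2) * exp (- (y - (s + r * real p))\<^sup>2 / 2)" for y
    proof -
      have e: "(y - x) - (- A) = y - (s + r * real p)" by (simp add: A_def)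
      then show ?thesis using shift[of "y - x" "- A", unfolded e] by (simp only: power2_minus)
    qed
    have eB: "exp (- (y - x)\<^sup>2 / 2) * exp (B * (y - x)) = exp (B\<^sup>2 / 2) * exp (- (y - (s + r * real (p + 1)))\<^sup>2 / 2)" for y
    proof -
      have e: "(y - x) - B = y - (s + r * real (p + 1))" by (simp add: A_def B_def algebra_simps)
      show ?thesis by (rule shift[of "y - x" B, unfolded e])
    qed
    have "bump A B (y - x) = (B / r * exp (A\<^sup>2 / 2)) * exp (- (y - (s + r * real p))\<^sup>2 / 2)
        + (A / r * exp (B\<^sup>2 / 2)) * exp (- (y - (s + r * real (p + 1)))\<^sup>2 / 2)" for y
    proof -
      have "bump A B (y - x) = B / r * (exp (- (y - x)\<^sup>2 / 2) * exp (- A * (y - x))) + A / r * (exp (- (y - x)\<^sup>2 / 2) * exp (B * (y - x)))"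
        by (simp add: bump_def bump_factor_def AB add_divide_distrib algebra_simps)
      then show ?thesis unfolding eA eB by (simp add: mult.assoc)
    qed
    then have "line_span s r S (\<lambda>y. bump A B (y - x))"
      by (intro line_span_two[OF p])
    moreover have "wave A B (y - x) = (- 1 / r * exp (A\<^sup>2 / 2)) * exp (- (y - (s + r * real p))\<^sup>2 / 2)
        + (1 / r * exp (B\<^sup>2 / 2)) * exp (- (y - (s + r * real (p + 1)))\<^sup>2 / 2)" for y
    proof -
      have "wave A B (y - x) = - 1 / r * (exp (- (y - x)\<^sup>2 / 2) * exp (- A * (y - x))) + 1 / r * (exp (- (y - x)\<^sup>2 / 2) * exp (B * (y - x)))"
        by (simp add: wave_def wave_factor_def AB diff_divide_distrib algebra_simps)
      then show ?thesis unfolding eA eB by (simp add: mult.assoc)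
    qed
    then have "line_span s r S (\<lambda>y. wave A B (y - x))"
      by (intro line_span_two[OF p])
    ultimately show ?thesis using A False by (auto simp: B_def)
  qed
qed

context
  fixes s :: "real \<times> real" and r :: real and S1 S2 :: nat
begin

definition grid_span :: "(real \<times> real \<Rightarrow> real) \<Rightarrow> bool" where
  "grid_span f \<longleftrightarrow> (\<exists>c. \<forall>x. f x = (\<Sum>p<S1. \<Sum>k<S2. c p k * gauss 1 ((fst s + r * real p, snd s + r * real k) - x)))"

lemma grid_span_prod:
  assumes "line_span (fst s) r S1 f" "line_span (snd s) r S2 h"
  shows "grid_span (\<lambda>x. f (fst x) * h (snd x))"
proof -
  obtain c where c: "\<forall>y. f y = (\<Sum>p<S1. c p * exp (- (y - (fst s + r * real p))\<^sup>2 / 2))"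
    using assms(1) unfolding line_span_def by (elim exE)
  obtain d where d: "\<forall>y. h y = (\<Sum>p<S2. d p * exp (- (y - (snd s + r * real p))\<^sup>2 / 2))"
    using assms(2) unfolding line_span_def by (elim exE)
  have "f (fst x) * h (snd x) = (\<Sum>p<S1. \<Sum>k<S2. (c p * d k) * gauss 1 ((fst s + r * real p, snd s + r * real k) - x))" for x
    unfolding c[rule_format] d[rule_format] sum_product gauss_1_Pair by (simp only: mult_ac)
  then show ?thesis unfolding grid_span_def by (intro exI[of _ "\<lambda>p k. c p * d k"]) blast
qed

lemma grid_span_add:
  assumes "grid_span f" "grid_span h"
  shows "grid_span (\<lambda>x. f x + h x)"
proof -
  obtain c where c: "\<forall>x. f x = (\<Sum>p<S1. \<Sum>k<S2. c p k * gauss 1 ((fst s + r * real p, snd s + r * real k) - x))"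
    using assms(1) unfolding grid_span_def by (elim exE)
  obtain d where d: "\<forall>x. h x = (\<Sum>p<S1. \<Sum>k<S2. d p k * gauss 1 ((fst s + r * real p, snd s + r * real k) - x))"
    using assms(2) unfolding grid_span_def by (elim exE)
  have "f x + h x = (\<Sum>p<S1. \<Sum>k<S2. (c p k + d p k) * gauss 1 ((fst s + r * real p, snd s + r * real k) - x))" for x
    unfolding c[rule_format] d[rule_format] by (simp only: distrib_right sum.distrib)
  then show ?thesis unfolding grid_span_def by (intro exI[of _ "\<lambda>p k. c p k + d p k"]) blast
qed

text \<open>The premise is restricted to nonzero a because a wave masked by \<omega> need not lie in
  the span.\<close>

lemma grid_span_scale:
  assumes "a \<noteq> 0 \<Longrightarrow> grid_span f"
  shows "grid_span (\<lambda>x. a * f x)"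
proof (cases "a = 0")
  case True
  then show ?thesis unfolding grid_span_def by (intro exI[of _ "\<lambda>_ _. 0"]) simp
next
  case False
  obtain c where c: "\<forall>x. f x = (\<Sum>p<S1. \<Sum>k<S2. c p k * gauss 1 ((fst s + r * real p, snd s + r * real k) - x))"
    using assms[OF False] unfolding grid_span_def by (elim exE)
  have "a * f x = (\<Sum>p<S1. \<Sum>k<S2. (a * c p k) * gauss 1 ((fst s + r * real p, snd s + r * real k) - x))" for x
    unfolding c[rule_format] by (simp only: sum_distrib_left mult.assoc)
  then show ?thesis unfolding grid_span_def by (intro exI[of _ "\<lambda>p k. a * c p k"]) blast
qed

lemma grid_span_sum:
  "finite I \<Longrightarrow> (\<And>i. i \<in> I \<Longrightarrow> grid_span (f i)) \<Longrightarrow> grid_span (\<lambda>x. \<Sum>i\<in>I. f i x)"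
proof (induction I rule: finite_induct)
  case empty
  then show ?case unfolding grid_span_def by (intro exI[of _ "\<lambda>_ _. 0"]) simp
next
  case (insert i I)
  then show ?case by (simp add: grid_span_add)
qed

lemma certificate_normalized:
  fixes N :: nat and t :: "nat \<Rightarrow> real \<times> real" and \<epsilon> :: "nat \<Rightarrow> real"
  assumes r: "0 < r" "r \<le> 0.89"
    and t: "\<And>j. j < N \<Longrightarrow> fst s \<le> fst (t j) \<and> fst (t j) \<le> fst s + r * (real S1 - 1)
                 \<and> snd s \<le> snd (t j) \<and> snd (t j) \<le> snd s + r * (real S2 - 1)"
    and sep: "\<And>j k. j < N \<Longrightarrow> k < N \<Longrightarrow> j \<noteq> k \<Longrightarrow> 3.987 < sqrt (1 - r\<^sup>2 / 4) * dist (t j) (t k)"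
    and \<epsilon>: "\<And>j. \<bar>\<epsilon> j\<bar> = 1"
  shows "\<exists>q. grid_span q \<and> (\<forall>j<N. q (t j) = \<epsilon> j) \<and> (\<forall>x. x \<notin> t ` {..<N} \<longrightarrow> \<bar>q x\<bar> < 1)"
proof -
  have "\<forall>j\<in>{..<N}. \<exists>a. 0 \<le> a \<and> a \<le> r \<and> line_span (fst s) r S1 (\<lambda>y. bump a (r - a) (y - fst (t j)))
    \<and> (S1 \<noteq> 1 \<longrightarrow> line_span (fst s) r S1 (\<lambda>y. wave a (r - a) (y - fst (t j)))) \<and> (S1 = 1 \<longrightarrow> fst (t j) = fst s)"
    using t by (intro ballI line_kit r) auto
  then obtain A where LA: "\<And>j. j < N \<Longrightarrow> 0 \<le> A j \<and> A j \<le> r \<and> line_span (fst s) r S1 (\<lambda>y. bump (A j) (r - A j) (y - fst (t j)))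
    \<and> (S1 \<noteq> 1 \<longrightarrow> line_span (fst s) r S1 (\<lambda>y. wave (A j) (r - A j) (y - fst (t j)))) \<and> (S1 = 1 \<longrightarrow> fst (t j) = fst s)"
    unfolding bchoice_iff by auto
  have "\<forall>j\<in>{..<N}. \<exists>a. 0 \<le> a \<and> a \<le> r \<and> line_span (snd s) r S2 (\<lambda>y. bump a (r - a) (y - snd (t j)))
    \<and> (S2 \<noteq> 1 \<longrightarrow> line_span (snd s) r S2 (\<lambda>y. wave a (r - a) (y - snd (t j)))) \<and> (S2 = 1 \<longrightarrow> snd (t j) = snd s)"
    using t by (intro ballI line_kit r) auto
  then obtain C where LC: "\<And>j. j < N \<Longrightarrow> 0 \<le> C j \<and> C j \<le> r \<and> line_span (snd s) r S2 (\<lambda>y. bump (C j) (r - C j) (y - snd (t j)))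
    \<and> (S2 \<noteq> 1 \<longrightarrow> line_span (snd s) r S2 (\<lambda>y. wave (C j) (r - C j) (y - snd (t j)))) \<and> (S2 = 1 \<longrightarrow> snd (t j) = snd s)"
    unfolding bchoice_iff by auto
  define \<omega> :: "real \<times> real" where "\<omega> = (if S1 = 1 then 0 else 1, if S2 = 1 then 0 else 1)"
  interpret spike_config N t A C r \<omega> \<epsilon> "1 - r\<^sup>2 / 4"
  proof unfold_locales
    show "0 < r" "r \<le> 0.89" by (rule r)+
    show "0 \<le> A j \<and> A j \<le> r" if "j < N" for j using LA[OF that] by blast
    show "0 \<le> C j \<and> C j \<le> r" if "j < N" for j using LC[OF that] by blast
    show "3.987 < sqrt (1 - r\<^sup>2 / 4) * dist (t j) (t k)" if "j < N" "k < N" "j \<noteq> k" for j k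
      using that by (rule sep)
    show "\<bar>\<epsilon> j\<bar> = 1" for j by (rule \<epsilon>)
    have "fst (t j) = fst s" if "S1 = 1" "j < N" for j using LA[OF that(2)] that(1) by blast
    then have "S1 = 1 \<Longrightarrow> \<forall>j<N. \<forall>k<N. fst (t j) = fst (t k)" by simp
    moreover have "S1 = 1 \<Longrightarrow> fst \<omega> = 0" "S1 \<noteq> 1 \<Longrightarrow> fst \<omega> = 1" by (simp_all add: \<omega>_def)
    ultimately show "fst \<omega> = 1 \<or> fst \<omega> = 0 \<and> (\<forall>j<N. \<forall>k<N. fst (t j) = fst (t k))" by blast
    have "snd (t j) = snd s" if "S2 = 1" "j < N" for j using LC[OF that(2)] that(1) by blast
    then have "S2 = 1 \<Longrightarrow> \<forall>j<N. \<forall>k<N. snd (t j) = snd (t k)" by simp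
    moreover have "S2 = 1 \<Longrightarrow> snd \<omega> = 0" "S2 \<noteq> 1 \<Longrightarrow> snd \<omega> = 1" by (simp_all add: \<omega>_def)
    ultimately show "snd \<omega> = 1 \<or> snd \<omega> = 0 \<and> (\<forall>j<N. \<forall>k<N. snd (t j) = snd (t k))" by blast
  qed
  show ?thesis
  proof (rule coefficients_exist)
    fix \<alpha> \<beta>
    assume ab: "\<And>j. j < N \<Longrightarrow> \<alpha> j = \<epsilon> j - (\<Sum>k\<in>{..<N}-{j}. g k (\<alpha> k) (\<beta> k) (t j - t k))"
    "\<And>j. j < N \<Longrightarrow> \<beta> j = - (\<Sum>k\<in>{..<N}-{j}. (gx k (\<alpha> k) (\<beta> k) (t j - t k), gy k (\<alpha> k) (\<beta> k) (t j - t k)))"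
    "\<And>j. j < N \<Longrightarrow> \<bar>\<alpha> j - \<epsilon> j\<bar> \<le> 0.006" "\<And>j. j < N \<Longrightarrow> norm (\<beta> j) \<le> 0.025"
    interpret interpolant N t A C r \<omega> \<epsilon> "1 - r\<^sup>2 / 4" \<alpha> \<beta>
      by unfold_locales (rule ab; assumption)+
    have "grid_span (\<lambda>x. g k (\<alpha> k) (\<beta> k) (x - t k))" if "k < N" for k
    proof -
      have "grid_span (\<lambda>x. \<alpha> k * (bump (A k) (r - A k) (fst x - fst (t k)) * bump (C k) (r - C k) (snd x - snd (t k)))
       + fst (wt (\<beta> k)) * (wave (A k) (r - A k) (fst x - fst (t k)) * bump (C k) (r - C k) (snd x - snd (t k)))
       + snd (wt (\<beta> k)) * (bump (A k) (r - A k) (fst x - fst (t k)) * wave (C k) (r - C k) (snd x - snd (t k))))"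
      proof -
        have bump: "line_span (fst s) r S1 (\<lambda>y. bump (A k) (r - A k) (y - fst (t k)))"
          "line_span (snd s) r S2 (\<lambda>y. bump (C k) (r - C k) (y - snd (t k)))"
          using LA[OF that] LC[OF that] by blast+
        have wave1: "line_span (fst s) r S1 (\<lambda>y. wave (A k) (r - A k) (y - fst (t k)))" if "fst (wt (\<beta> k)) \<noteq> 0"
        proof -
          have "S1 \<noteq> 1" using that unfolding wt_def fst_conv by (auto simp: \<omega>_def)
          then show ?thesis using LA[OF \<open>k < N\<close>] by blast
        qed
        have wave2: "line_span (snd s) r S2 (\<lambda>y. wave (C k) (r - C k) (y - snd (t k)))" if "snd (wt (\<beta> k)) \<noteq> 0"
        proof -
          have "S2 \<noteq> 1" using that unfolding wt_def snd_conv by (auto simp: \<omega>_def)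
          then show ?thesis using LC[OF \<open>k < N\<close>] by blast
        qed
        show ?thesis
          by (intro grid_span_add grid_span_scale)
            (rule grid_span_prod[OF bump] grid_span_prod[OF wave1 bump(2)] grid_span_prod[OF bump(1) wave2]; assumption)+
      qed
      then show ?thesis by (simp add: g_def atom_def)
    qed
    then have "grid_span q"
      unfolding q_def by (intro grid_span_sum) auto
    then show ?thesis using q_spike q_less_one by (intro exI[of _ q]) auto
  qed
qed

end

section \<open>Condition (R) and rescaling\<close>

lemma cond_R_range:
  assumes "cond_R r d"
  shows "0 < r" "r \<le> 0.89"
  using assms unfolding cond_R_def by auto

text \<open>In each row (1 - r^2/4) D^2 is smallest at the right end of the interval for r; the
  second row is the tightest, with about 15.92.\<close>

lemma cond_R_separation:
  assumes "cond_R r d" "d \<le> ereal u"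
  shows "3.987 < sqrt (1 - r\<^sup>2 / 4) * u"
proof -
  have *: "3.987 < sqrt (1 - r\<^sup>2 / 4) * u" if "0 \<le> r" "r \<le> a" "ereal D \<le> d" "0 \<le> D" "15.9 \<le> (1 - a\<^sup>2 / 4) * D\<^sup>2" for a D
  proof -
    have "D \<le> u" using that assms(2) by (metis ereal_less_eq(3) order_trans)
    have "r\<^sup>2 \<le> a\<^sup>2" using that by (intro power_mono) auto
    then have le: "1 - a\<^sup>2 / 4 \<le> 1 - r\<^sup>2 / 4" by simp
    have pos: "0 < 1 - a\<^sup>2 / 4"
    proof (rule ccontr)
      assume "\<not> 0 < 1 - a\<^sup>2 / 4"
      then have "(1 - a\<^sup>2 / 4) * D\<^sup>2 \<le> 0" by (intro mult_nonpos_nonneg) auto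
      then show False using that(5) by linarith
    qed
    have "3.987\<^sup>2 < (1 - a\<^sup>2 / 4) * D\<^sup>2" using that(5) by (simp add: power_divide)
    also have "\<dots> \<le> (1 - r\<^sup>2 / 4) * u\<^sup>2"
      using le pos \<open>D \<le> u\<close> that(4) by (intro mult_mono power_mono) auto
    also have "\<dots> = (sqrt (1 - r\<^sup>2 / 4) * u)\<^sup>2"
      using le pos by (simp add: power_mult_distrib)
    finally show ?thesis
      by (rule power_less_imp_less_base) (use le pos \<open>D \<le> u\<close> that(4) in auto)
  qed
  \<comment> \<open>Decimals of type \<open>ereal\<close> are quotients
    \<open>numeral n / 10\<^sup>2\<close>; this form matches every row of the condition.\<close>
  have case_R: "3.987 < sqrt (1 - r\<^sup>2 / 4) * u"
    if "l \<le> r \<and> r \<le> a \<and> numeral n / 10\<^sup>2 \<le> d" "0 \<le> l" "15.9 \<le> (1 - a\<^sup>2 / 4) * (numeral n / 10\<^sup>2)\<^sup>2" for l a n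
  proof (rule *[OF _ _ _ _ that(3)])
    show "ereal (numeral n / 10\<^sup>2) \<le> d" using that by (simp add: numeral_eq_ereal)
  qed (use that in auto)
  show "3.987 < sqrt (1 - r\<^sup>2 / 4) * u"
    using assms(1) unfolding cond_R_def
    by (elim disjE) (erule case_R; simp add: power_divide)+
qed

lemma dual_certificate:
  fixes \<sigma> \<zeta> :: real and N S1 S2 :: nat and t :: "nat \<Rightarrow> real \<times> real" and s1 :: "real \<times> real" and \<epsilon> :: "nat \<Rightarrow> real"
  assumes "\<sigma> > 0" and "\<zeta> > 0"
    and "inj_on t {..<N}"
    and "\<forall>j<N. fst s1 \<le> fst (t j) \<and> fst (t j) \<le> fst s1 + \<zeta> * (real S1 - 1)
                 \<and> snd s1 \<le> snd (t j) \<and> snd (t j) \<le> snd s1 + \<zeta> * (real S2 - 1)"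
    and R: "cond_R (\<zeta> / \<sigma>) (min_sep (t ` {..<N}) / ereal \<sigma>)"
    and \<epsilon>: "\<And>j. \<bar>\<epsilon> j\<bar> = 1"
  shows "\<exists>c q. (\<forall>x. q x = (\<Sum>p<S1. \<Sum>k<S2. c p k * gauss \<sigma> ((fst s1 + \<zeta> * real p, snd s1 + \<zeta> * real k) - x)))
    \<and> (\<forall>j<N. q (t j) = \<epsilon> j) \<and> (\<forall>x. x \<notin> t ` {..<N} \<longrightarrow> \<bar>q x\<bar> < 1)"
proof -
  define r where "r = \<zeta> / \<sigma>"
  define t' where "t' j = t j /\<^sub>R \<sigma>" for j
  have sep: "3.987 < sqrt (1 - r\<^sup>2 / 4) * dist (t' j) (t' k)" if "j < N" "k < N" "j \<noteq> k" for j k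
  proof -
    have "min_sep (t ` {..<N}) \<le> ereal (dist (t j) (t k))"
      unfolding min_sep_def
    proof (intro Inf_lower CollectI exI conjI)
      show "t j \<noteq> t k" using that assms(3) by (auto simp: inj_on_def)
    qed (use that in auto)
    then have "min_sep (t ` {..<N}) / ereal \<sigma> \<le> ereal (dist (t j) (t k)) / ereal \<sigma>"
      using assms(1) by (intro ereal_divide_right_mono) auto
    also have "\<dots> = ereal (dist (t' j) (t' k))"
      using assms(1) by (simp add: t'_def dist_norm divide_inverse mult.commute flip: scaleR_diff_right)
    finally show ?thesis
      using cond_R_separation[OF R] by (simp add: r_def)
  qed
  have r: "0 < r" "r \<le> 0.89" using cond_R_range[OF R] by (simp_all add: r_def)
  have "\<exists>q. grid_span (s1 /\<^sub>R \<sigma>) r S1 S2 q \<and> (\<forall>j<N. q (t' j) = \<epsilon> j) \<and> (\<forall>x. x \<notin> t' ` {..<N} \<longrightarrow> \<bar>q x\<bar> < 1)"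
  proof (rule certificate_normalized[OF r _ sep \<epsilon>])
    fix j assume "j < N"
    then have "fst s1 \<le> fst (t j) \<and> fst (t j) \<le> fst s1 + \<zeta> * (real S1 - 1)
                 \<and> snd s1 \<le> snd (t j) \<and> snd (t j) \<le> snd s1 + \<zeta> * (real S2 - 1)" using assms(4) by blast
    then show "fst (s1 /\<^sub>R \<sigma>) \<le> fst (t' j) \<and> fst (t' j) \<le> fst (s1 /\<^sub>R \<sigma>) + r * (real S1 - 1)
                 \<and> snd (s1 /\<^sub>R \<sigma>) \<le> snd (t' j) \<and> snd (t' j) \<le> snd (s1 /\<^sub>R \<sigma>) + r * (real S2 - 1)"
      using assms(1) by (simp add: t'_def r_def field_simps)
  qed
  then obtain q c where q: "\<And>x. q x = (\<Sum>p<S1. \<Sum>k<S2. c p k * gauss 1 ((fst (s1 /\<^sub>R \<sigma>) + r * real p, snd (s1 /\<^sub>R \<sigma>) + r * real k) - x))"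
    "\<And>j. j < N \<Longrightarrow> q (t' j) = \<epsilon> j" "\<And>x. x \<notin> t' ` {..<N} \<Longrightarrow> \<bar>q x\<bar> < 1"
    unfolding grid_span_def by blast
  have gs: "gauss 1 ((fst (s1 /\<^sub>R \<sigma>) + r * real p, snd (s1 /\<^sub>R \<sigma>) + r * real k) - x /\<^sub>R \<sigma>)
      = gauss \<sigma> ((fst s1 + \<zeta> * real p, snd s1 + \<zeta> * real k) - x)" for p k x
  proof -
    have "(fst (s1 /\<^sub>R \<sigma>) + r * real p, snd (s1 /\<^sub>R \<sigma>) + r * real k) - x /\<^sub>R \<sigma> = ((fst s1 + \<zeta> * real p, snd s1 + \<zeta> * real k) - x) /\<^sub>R \<sigma>"
      using assms(1) by (simp add: prod_eq_iff r_def field_simps)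
    moreover have "gauss 1 (v /\<^sub>R \<sigma>) = gauss \<sigma> v" for v
      using assms(1) by (simp add: gauss_def field_simps)
    ultimately show ?thesis by simp
  qed
  show ?thesis
  proof (intro exI[of _ c] exI[of _ "\<lambda>x. q (x /\<^sub>R \<sigma>)"] conjI allI impI)
    show "q (x /\<^sub>R \<sigma>) = (\<Sum>p<S1. \<Sum>k<S2. c p k * gauss \<sigma> ((fst s1 + \<zeta> * real p, snd s1 + \<zeta> * real k) - x))" for x
      by (simp only: q(1) gs)
    show "q (t j /\<^sub>R \<sigma>) = \<epsilon> j" if "j < N" for j using q(2)[OF that] by (simp add: t'_def)
    show "\<bar>q (x /\<^sub>R \<sigma>)\<bar> < 1" if "x \<notin> t ` {..<N}" for x
      using that assms(1) by (intro q(3)) (auto simp: t'_def)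
  qed
qed

subsection \<open>Signed measures\<close>

text \<open>\<open>measure_of\<close> returns the intended values only if the set function is a
  measure. As the image of a weighted point measure it inherits this, together with finiteness and
  the formula for integrals.\<close>

lemma atomic_eq_distr:
  "atomic N t w = distr (point_measure {..<N} (\<lambda>j. ennreal (w j))) borel t"
proof -
  have "emeasure (point_measure {..<N} (\<lambda>j. ennreal (w j))) (t -` A \<inter> {..<N}) = (\<Sum>j\<in>{j. j < N \<and> t j \<in> A}. ennreal (w j))" for A
    by (subst emeasure_point_measure_finite) (auto intro!: sum.cong)
  then show ?thesis
    unfolding atomic_def distr_def space_borel space_point_measure
    by (intro measure_of_eq) auto
qed

lemma finite_measure_atomic: "finite_measure (atomic N t w)" "sets (atomic N t w) = sets borel"
proof -
  interpret M: finite_measure "point_measure {..<N} (\<lambda>j. ennreal (w j))"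
    by (rule finite_measureI) (subst space_point_measure, subst emeasure_point_measure_finite, auto)
  show "finite_measure (atomic N t w)"
    unfolding atomic_eq_distr by (rule M.finite_measure_distr) (simp add: measurable_def space_point_measure sets_point_measure)
  show "sets (atomic N t w) = sets borel" by (simp add: atomic_eq_distr)
qed

lemma integral_atomic:
  fixes f :: "real \<times> real \<Rightarrow> real"
  assumes "f \<in> borel_measurable borel" "\<And>j. 0 \<le> w j"
  shows "(\<integral>x. f x \<partial>(atomic N t w)) = (\<Sum>j<N. w j * f (t j))"
  unfolding atomic_eq_distr using assms
  by (subst integral_distr) (auto simp: measurable_def space_point_measure sets_point_measure lebesgue_integral_point_measure_finite)

lemma fin_signed_spikes: "fin_signed (spikes N t a)"
  by (simp add: fin_signed_def spikes_def finite_measure_atomic)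

lemma sint_spikes:
  assumes "f \<in> borel_measurable borel"
  shows "sint (spikes N t a) f = (\<Sum>j<N. a j * f (t j))"
  unfolding sint_def spikes_def fst_conv snd_conv using assms
  by (simp add: integral_atomic sum_subtractf[symmetric] left_diff_distrib[symmetric]) (auto intro!: sum.cong)

lemma sint_indicator:
  assumes "fin_signed \<nu>" "A \<in> sets borel"
  shows "sint \<nu> (indicator A) = measure (fst \<nu>) A - measure (snd \<nu>) A"
proof -
  interpret M1: finite_measure "fst \<nu>" using assms by (simp add: fin_signed_def)
  interpret M2: finite_measure "snd \<nu>" using assms by (simp add: fin_signed_def)
  show ?thesis using assms by (simp add: sint_def fin_signed_def)
qed

locale signed_measure =
  fixes M1 M2 :: "(real \<times> real) measure"
  assumes fin_signed: "fin_signed (M1, M2)"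
begin

sublocale M1: finite_measure M1 using fin_signed by (simp add: fin_signed_def)
sublocale M2: finite_measure M2 using fin_signed by (simp add: fin_signed_def)

lemma sets_M [measurable_cong, simp]: "sets M1 = sets borel" "sets M2 = sets borel"
  using fin_signed by (simp_all add: fin_signed_def)

lemma integrable_bounded:
  fixes f :: "real \<times> real \<Rightarrow> real"
  assumes "f \<in> borel_measurable borel" "\<And>x. \<bar>f x\<bar> \<le> B"
  shows "integrable M1 f" "integrable M2 f"
  using assms by (auto intro!: M1.integrable_const_bound[where B = B] M2.integrable_const_bound[where B = B] simp: measurable_cong_sets[OF sets_M(1) refl] measurable_cong_sets[OF sets_M(2) refl])

lemma sint_add:
  assumes "f \<in> borel_measurable borel" "\<And>x. \<bar>f x\<bar> \<le> B" "g \<in> borel_measurable borel" "\<And>x. \<bar>g x\<bar> \<le> C"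
  shows "sint (M1, M2) (\<lambda>x. f x + g x) = sint (M1, M2) f + sint (M1, M2) g"
  using integrable_bounded[OF assms(1,2)] integrable_bounded[OF assms(3,4)] by (simp add: sint_def)

lemma sint_scale: "sint (M1, M2) (\<lambda>x. c * f x) = c * sint (M1, M2) f"
  by (simp add: sint_def right_diff_distrib)

lemma sint_le_TV:
  assumes "continuous_on UNIV f" "\<And>x. \<bar>f x\<bar> \<le> 1"
  shows "sint (M1, M2) f \<le> TV (M1, M2)"
  unfolding TV_def
proof (rule cSup_upper)
  show "bdd_above {sint (M1, M2) f |f. continuous_on UNIV f \<and> (\<forall>x. \<bar>f x\<bar> \<le> 1)}"
  proof (rule bdd_aboveI)
    fix v assume "v \<in> {sint (M1, M2) f |f. continuous_on UNIV f \<and> (\<forall>x. \<bar>f x\<bar> \<le> 1)}"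
    then obtain f where f: "v = sint (M1, M2) f" "continuous_on UNIV f" "\<And>x. \<bar>f x\<bar> \<le> 1" by blast
    have m: "f \<in> borel_measurable borel" using f(2) by (rule borel_measurable_continuous_onI)
    note int = integrable_bounded[OF m f(3)]
    have "\<bar>integral\<^sup>L M1 f\<bar> \<le> (\<integral>x. 1 \<partial>M1)" "\<bar>integral\<^sup>L M2 f\<bar> \<le> (\<integral>x. 1 \<partial>M2)"
      by (intro order_trans[OF integral_abs_bound] integral_mono int integrable_abs; simp add: f(3))+
    then show "v \<le> measure M1 (space M1) + measure M2 (space M2)"
      by (simp add: f(1) sint_def)
  qed
qed (use assms in auto)

text \<open>First variation: q + g and q - g are both admissible in the supremum defining
  \<open>TV\<close>, and q already attains it, so the integral of g can have neither sign.\<close>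

lemma sint_zero_of_maximal:
  assumes q: "continuous_on UNIV q" "\<And>x. \<bar>q x\<bar> \<le> 1" "TV (M1, M2) \<le> sint (M1, M2) q"
    and g: "continuous_on UNIV g" "\<And>x. \<bar>g x\<bar> \<le> 1 - \<bar>q x\<bar>"
  shows "sint (M1, M2) g = 0"
proof -
  have g1: "\<bar>g x\<bar> \<le> 1" for x using g(2)[of x] by simp
  have m: "q \<in> borel_measurable borel" "g \<in> borel_measurable borel"
    using q(1) g(1) by (auto intro: borel_measurable_continuous_onI)
  have "sint (M1, M2) q + c * sint (M1, M2) g \<le> sint (M1, M2) q" if "\<bar>c\<bar> = 1" for c
  proof -
    have "\<bar>c * g x\<bar> \<le> 1" for x using g1[of x] that by (simp add: abs_mult)
    then have "sint (M1, M2) q + c * sint (M1, M2) g = sint (M1, M2) (\<lambda>x. q x + c * g x)"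
      using m q(2) by (subst sint_scale[symmetric], subst sint_add[where B = 1 and C = 1]) auto
    also have "\<dots> \<le> TV (M1, M2)"
    proof (rule sint_le_TV)
      show "continuous_on UNIV (\<lambda>x. q x + c * g x)" by (intro continuous_intros q g)
      have cg: "\<bar>c * g x\<bar> \<le> 1 - \<bar>q x\<bar>" for x using g(2)[of x] that by (simp add: abs_mult)
      show "\<bar>q x + c * g x\<bar> \<le> 1" for x
        using abs_triangle_ineq[of "q x" "c * g x"] cg[of x] by linarith
    qed
    finally show ?thesis using q(3) by linarith
  qed
  from this[of 1] this[of "-1"] show ?thesis by simp
qed

text \<open>With u = 1 - |q|, every product of u with a continuous h, |h| <= 1, is annihilated, so
  M1 and M2 weighted by u agree; on A the weight is positive and can be divided out. Only the
  difference of M1 and M2 is shown to vanish on A, since the pair need not be mutually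
  singular.\<close>

lemma emeasure_eq_off_maximal:
  assumes q: "continuous_on UNIV q" "\<And>x. \<bar>q x\<bar> \<le> 1" "TV (M1, M2) \<le> sint (M1, M2) q"
    and A: "A \<in> sets borel" "\<And>x. x \<in> A \<Longrightarrow> \<bar>q x\<bar> < 1"
  shows "emeasure M1 A = emeasure M2 A"
proof -
  define u where "u x = 1 - \<bar>q x\<bar>" for x
  have u: "continuous_on UNIV u" "\<And>x. 0 \<le> u x" "\<And>x. u x \<le> 1"
    using q by (auto simp: u_def intro!: continuous_intros)
  have um [measurable]: "u \<in> borel_measurable borel"
    using u(1) by (rule borel_measurable_continuous_onI)
  have test: "(\<integral>x. u x * h x \<partial>M1) = (\<integral>x. u x * h x \<partial>M2)" if "continuous_on UNIV h" "\<And>x. \<bar>h x\<bar> \<le> 1" for h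
  proof -
    have "sint (M1, M2) (\<lambda>x. u x * h x) = 0"
    proof (rule sint_zero_of_maximal[OF q])
      show "continuous_on UNIV (\<lambda>x. u x * h x)" by (intro continuous_intros u that)
      show "\<bar>u x * h x\<bar> \<le> 1 - \<bar>q x\<bar>" for x
        using mult_left_mono[OF that(2)[of x] u(2)[of x]] u(2)[of x] by (simp add: abs_mult u_def)
    qed
    then show ?thesis by (simp add: sint_def)
  qed
  have closed: "(\<integral>x. u x * indicator C x \<partial>M1) = (\<integral>x. u x * indicator C x \<partial>M2)" if C: "closed C" for C
  proof (cases "C = {}")
    case False
    \<comment> \<open>These continuous functions decrease to the indicator of the closed set
      C.\<close>
    define h where "h n x = max 0 (1 - real n * infdist x C)" for n x
    have h: "continuous_on UNIV (h n)" "\<bar>h n x\<bar> \<le> 1" for n x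
    proof -
      have "0 \<le> real n * infdist x C" by (intro mult_nonneg_nonneg infdist_nonneg) simp
      then show "\<bar>h n x\<bar> \<le> 1" by (simp add: h_def)
      show "continuous_on UNIV (h n)" unfolding h_def by (intro continuous_intros)
    qed
    have hm [measurable]: "h n \<in> borel_measurable borel" for n
      using h(1) by (rule borel_measurable_continuous_onI)
    have lim: "(\<lambda>n. u x * h n x) \<longlonglongrightarrow> u x * indicator C x" for x
    proof (cases "x \<in> C")
      case True
      then show ?thesis by (simp add: h_def)
    next
      case F: False
      then have "0 < infdist x C"
        using C False by (metis in_closed_iff_infdist_zero infdist_nonneg less_eq_real_def)
      then obtain n0 where n0: "1 < real n0 * infdist x C" using reals_Archimedean3 by blast
      have "h n x = 0" if "n0 \<le> n" for n
      proof -
        have "real n0 * infdist x C \<le> real n * infdist x C"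
          using that \<open>0 < infdist x C\<close> by (intro mult_right_mono) auto
        then show ?thesis using n0 by (simp add: h_def)
      qed
      then have "eventually (\<lambda>n. u x * h n x = u x * indicator C x) sequentially"
        using F by (auto simp: eventually_sequentially)
      then show ?thesis by (rule tendsto_eventually)
    qed
    have b: "norm (u x * h n x) \<le> 1" for n x
      using mult_mono[OF u(3)[of x] h(2)[of n x]] u(2)[of x] by (simp add: abs_mult)
    have Cm [measurable]: "C \<in> sets borel" using C by auto
    have "(\<lambda>n. \<integral>x. u x * h n x \<partial>M1) \<longlonglongrightarrow> (\<integral>x. u x * indicator C x \<partial>M1)"
      by (rule integral_dominated_convergence[where w = "\<lambda>_. 1"]) (use lim b in auto)
    moreover have "(\<lambda>n. \<integral>x. u x * h n x \<partial>M2) \<longlonglongrightarrow> (\<integral>x. u x * indicator C x \<partial>M2)"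
      by (rule integral_dominated_convergence[where w = "\<lambda>_. 1"]) (use lim b in auto)
    ultimately show ?thesis
      using LIMSEQ_unique by (simp add: test[OF h]) blast
  qed simp
  have em: "emeasure (density M1 u) C = ennreal (\<integral>x. u x * indicator C x \<partial>M1)"
    "emeasure (density M2 u) C = ennreal (\<integral>x. u x * indicator C x \<partial>M2)" if [measurable]: "C \<in> sets borel" for C
  proof -
    have bd: "\<bar>u x * indicator C x\<bar> \<le> 1" for x using u(2,3)[of x] by (auto simp: indicator_def)
    have i: "integrable M1 (\<lambda>x. u x * indicator C x)" "integrable M2 (\<lambda>x. u x * indicator C x)"
      by (rule integrable_bounded[OF _ bd]; measurable)+
    show "emeasure (density M1 u) C = ennreal (\<integral>x. u x * indicator C x \<partial>M1)"
      "emeasure (density M2 u) C = ennreal (\<integral>x. u x * indicator C x \<partial>M2)"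
      using i u(2) that
      by (simp_all add: emeasure_density nn_integral_eq_integral[symmetric] ennreal_mult ennreal_indicator)
  qed
  have "density M1 u = density M2 u"
  proof (rule measure_eqI_generator_eq[where E = "Collect closed" and \<Omega> = UNIV and A = "\<lambda>_. UNIV"])
    show "Int_stable (Collect closed)" by (auto simp: Int_stable_def)
    show "sets (density M1 u) = sigma_sets UNIV (Collect closed)" "sets (density M2 u) = sigma_sets UNIV (Collect closed)"
      by (simp_all add: borel_eq_closed)
    show "emeasure (density M1 u) X = emeasure (density M2 u) X" if "X \<in> Collect closed" for X
      using that by (simp add: em closed)
    show "emeasure (density M1 u) UNIV \<noteq> \<infinity>" by (simp add: em)
  qed auto
  \<comment> \<open>Integrating 1/u over A against the weighted measure recovers the measure of
    A.\<close>
  moreover have "emeasure M A = (\<integral>\<^sup>+x. ennreal (indicator A x / u x) \<partial>density M u)" if [measurable_cong]: "sets M = sets borel" for M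
  proof -
    have [measurable]: "A \<in> sets borel" by (rule A)
    have "(\<integral>\<^sup>+x. ennreal (indicator A x / u x) \<partial>density M u) = (\<integral>\<^sup>+x. ennreal (u x) * ennreal (indicator A x / u x) \<partial>M)"
      by (rule nn_integral_density) auto
    also have "\<dots> = (\<integral>\<^sup>+x. indicator A x \<partial>M)"
    proof (rule nn_integral_cong)
      fix x
      show "ennreal (u x) * ennreal (indicator A x / u x) = indicator A x"
        using A(2)[of x] u(2)[of x] by (cases "x \<in> A") (auto simp: u_def ennreal_mult[symmetric])
    qed
    also have "\<dots> = emeasure M A" using A(1) that by simp
    finally show ?thesis ..
  qed
  ultimately show ?thesis by simp
qed

text \<open>The restrictions of M1 and M2 to the complement of T, written as densities of an
  indicator, coincide and cancel, which leaves the atoms on T.\<close>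

lemma sint_eq_sum:
  fixes f :: "real \<times> real \<Rightarrow> real"
  assumes T: "finite T" "\<And>A. A \<in> sets borel \<Longrightarrow> A \<inter> T = {} \<Longrightarrow> emeasure M1 A = emeasure M2 A"
    and f [measurable]: "f \<in> borel_measurable borel" and "\<And>x. \<bar>f x\<bar> \<le> B"
  shows "sint (M1, M2) f = (\<Sum>x\<in>T. (measure M1 {x} - measure M2 {x}) * f x)"
proof -
  have Tm [measurable]: "T \<in> sets borel" using T(1) by (simp add: finite_imp_closed borel_closed)
  have split: "(\<integral>x. f x \<partial>M) = (\<Sum>x\<in>T. measure M {x} * f x) + (\<integral>x. f x \<partial>density M (indicator (- T)))"
    if "finite_measure M" and [measurable_cong]: "sets M = sets borel" for M
  proof -
    interpret finite_measure M by fact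
    have "integrable M f"
      using assms by (intro integrable_const_bound[where B = B]) (auto simp: measurable_cong_sets[OF that(2) refl])
    have eq: "f x = (\<Sum>y\<in>T. f y * indicator {y} x) + indicator (- T) x * f x" for x
    proof (cases "x \<in> T")
      case True
      then have "(\<Sum>y\<in>T. f y * indicator {y} x) = (\<Sum>y\<in>T. if y = x then f x else 0)"
        by (intro sum.cong) (auto simp: indicator_def)
      then show ?thesis using True T(1) by simp
    qed (auto simp: indicator_def intro!: sum.neutral)
    have ind: "integrable M (\<lambda>x. f y * indicator {y} x)" for y
      using that(2) by (intro integrable_mult_right integrable_real_indicator) (auto simp: emeasure_eq_measure)
    have "(\<integral>x. f x \<partial>M) = (\<integral>x. (\<Sum>y\<in>T. f y * indicator {y} x) + indicator (- T) x * f x \<partial>M)"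
      by (rule Bochner_Integration.integral_cong[OF refl]) (rule eq)
    also have "\<dots> = (\<integral>x. (\<Sum>y\<in>T. f y * indicator {y} x) \<partial>M) + (\<integral>x. indicator (- T) x * f x \<partial>M)"
    proof (rule Bochner_Integration.integral_add)
      show "integrable M (\<lambda>x. indicator (- T) x * f x)"
        using integrable_mult_indicator[OF _ \<open>integrable M f\<close>, of "- T"] that(2) by simp
    qed (intro Bochner_Integration.integrable_sum ind)
    also have "(\<integral>x. (\<Sum>y\<in>T. f y * indicator {y} x) \<partial>M) = (\<Sum>y\<in>T. measure M {y} * f y)"
      using that(2) by (subst Bochner_Integration.integral_sum[OF ind]) (auto simp: mult.commute intro!: sum.cong)
    also have "(\<integral>x. indicator (- T) x * f x \<partial>M) = (\<integral>x. f x \<partial>density M (indicator (- T)))"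
      by (subst integral_real_density[symmetric]) (auto simp: ennreal_indicator)
    finally show ?thesis .
  qed
  have "density M1 (indicator (- T)) = density M2 (indicator (- T))"
  proof (rule measure_eqI)
    fix A assume "A \<in> sets (density M1 (indicator (- T)))"
    then have A [measurable]: "A \<in> sets borel" by simp
    have "emeasure M1 (- T \<inter> A) = emeasure M2 (- T \<inter> A)" by (rule T(2)) auto
    then show "emeasure (density M1 (indicator (- T))) A = emeasure (density M2 (indicator (- T))) A"
      using A by (simp add: emeasure_density nn_integral_indicator indicator_inter_arith[symmetric])
  qed simp
  then show ?thesis
    unfolding sint_def fst_conv snd_conv
    using split[OF M1.finite_measure_axioms] split[OF M2.finite_measure_axioms]
    by (simp add: left_diff_distrib sum_subtractf)
qed

end

section \<open>From certificates to uniqueness\<close>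

lemma continuous_on_gauss: "continuous_on UNIV (\<lambda>x. gauss \<sigma> (s - x))"
  unfolding gauss_def divide_inverse by (intro continuous_intros)

lemma gauss_bounds: "0 \<le> gauss \<sigma> x" "gauss \<sigma> x \<le> 1"
  by (auto simp: gauss_def divide_nonneg_nonneg)

text \<open>A certificate is a combination of sampled kernels, so its integral against a feasible
  measure is determined by the samples.\<close>

lemma (in signed_measure) sint_grid_sum:
  assumes conv: "\<And>s. s \<in> grid s1 \<zeta> S1 S2 \<Longrightarrow> conv \<sigma> (M1, M2) s = (\<Sum>j<N. a j * gauss \<sigma> (s - t j))"
  shows "sint (M1, M2) (\<lambda>x. \<Sum>p<S1. \<Sum>k<S2. c p k * gauss \<sigma> ((fst s1 + \<zeta> * real p, snd s1 + \<zeta> * real k) - x))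
    = (\<Sum>j<N. a j * (\<Sum>p<S1. \<Sum>k<S2. c p k * gauss \<sigma> ((fst s1 + \<zeta> * real p, snd s1 + \<zeta> * real k) - t j)))"
proof -
  let ?s = "\<lambda>p k. (fst s1 + \<zeta> * real p, snd s1 + \<zeta> * real k)"
  have int: "integrable M1 (\<lambda>x. gauss \<sigma> (s - x))" "integrable M2 (\<lambda>x. gauss \<sigma> (s - x))" for s
    by (rule integrable_bounded[where B = 1, OF borel_measurable_continuous_onI[OF continuous_on_gauss]];
      simp add: gauss_bounds)+
  have "sint (M1, M2) (\<lambda>x. \<Sum>p<S1. \<Sum>k<S2. c p k * gauss \<sigma> (?s p k - x)) = (\<Sum>p<S1. \<Sum>k<S2. c p k * conv \<sigma> (M1, M2) (?s p k))"
    by (simp add: sint_def conv_def int sum_subtractf right_diff_distrib)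
  also have "\<dots> = (\<Sum>p<S1. \<Sum>k<S2. c p k * (\<Sum>j<N. a j * gauss \<sigma> (?s p k - t j)))"
    by (intro sum.cong refl, subst conv) (auto simp: grid_def)
  also have "\<dots> = (\<Sum>p<S1. \<Sum>k<S2. \<Sum>j<N. a j * (c p k * gauss \<sigma> (?s p k - t j)))"
    by (simp add: sum_distrib_left mult_ac)
  also have "\<dots> = (\<Sum>p<S1. \<Sum>j<N. \<Sum>k<S2. a j * (c p k * gauss \<sigma> (?s p k - t j)))"
    by (intro sum.cong refl sum.swap)
  also have "\<dots> = (\<Sum>j<N. \<Sum>p<S1. \<Sum>k<S2. a j * (c p k * gauss \<sigma> (?s p k - t j)))"
    by (rule sum.swap)
  finally show ?thesis by (simp add: sum_distrib_left)
qed

lemma TV_spikes_le: "TV (spikes N t a) \<le> (\<Sum>j<N. \<bar>a j\<bar>)"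
  unfolding TV_def
proof (rule cSup_least)
  show "{sint (spikes N t a) f |f. continuous_on UNIV f \<and> (\<forall>x. \<bar>f x\<bar> \<le> 1)} \<noteq> {}"
    by (auto intro!: exI[of _ "\<lambda>_. 0"])
  fix v assume "v \<in> {sint (spikes N t a) f |f. continuous_on UNIV f \<and> (\<forall>x. \<bar>f x\<bar> \<le> 1)}"
  then obtain f where f: "v = sint (spikes N t a) f" "continuous_on UNIV f" "\<And>x. \<bar>f x\<bar> \<le> 1" by blast
  have "v = (\<Sum>j<N. a j * f (t j))"
    unfolding f(1) using f(2) by (intro sint_spikes borel_measurable_continuous_onI)
  also have "\<dots> \<le> (\<Sum>j<N. \<bar>a j\<bar>)"
  proof (rule sum_mono)
    fix j
    have "a j * f (t j) \<le> \<bar>a j\<bar> * \<bar>f (t j)\<bar>" by (metis abs_ge_self abs_mult)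
    also have "\<dots> \<le> \<bar>a j\<bar> * 1" by (intro mult_left_mono f) auto
    finally show "a j * f (t j) \<le> \<bar>a j\<bar>" by simp
  qed
  finally show "v \<le> (\<Sum>j<N. \<bar>a j\<bar>)" .
qed

theorem theorem1:
  fixes \<sigma> \<zeta> :: real and N S1 S2 :: nat and t :: "nat \<Rightarrow> real \<times> real"
    and a :: "nat \<Rightarrow> real" and s1 :: "real \<times> real"
  assumes "\<sigma> > 0" and "\<zeta> > 0"
    and "inj_on t {..<N}"
    and "\<forall>j<N. fst s1 \<le> fst (t j) \<and> fst (t j) \<le> fst s1 + \<zeta> * (real S1 - 1)
                 \<and> snd s1 \<le> snd (t j) \<and> snd (t j) \<le> snd s1 + \<zeta> * (real S2 - 1)"
    and "cond_R (\<zeta> / \<sigma>) (min_sep (t ` {..<N}) / ereal \<sigma>)"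
  shows "fin_signed (spikes N t a) \<and>
    (\<forall>\<nu>. fin_signed \<nu> \<and>
         (\<forall>s \<in> grid s1 \<zeta> S1 S2. conv \<sigma> \<nu> s = (\<Sum>j<N. a j * gauss \<sigma> (s - t j)))
       \<longrightarrow> TV (spikes N t a) \<le> TV \<nu> \<and>
           (TV \<nu> \<le> TV (spikes N t a) \<longrightarrow> same_smeasure \<nu> (spikes N t a)))"
proof (intro conjI allI impI)
  show "fin_signed (spikes N t a)" by (rule fin_signed_spikes)
  fix \<nu> :: smeasure
  assume \<nu>: "fin_signed \<nu> \<and> (\<forall>s \<in> grid s1 \<zeta> S1 S2. conv \<sigma> \<nu> s = (\<Sum>j<N. a j * gauss \<sigma> (s - t j)))"
  obtain M1 M2 where \<nu>_eq: "\<nu> = (M1, M2)" by fastforce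
  interpret signed_measure M1 M2
    using \<nu> by unfold_locales (simp add: \<nu>_eq)
  \<comment> \<open>Unlike \<open>sgn\<close> this is never 0: a certificate requires signs of
    modulus one, also at spikes of weight 0.\<close>
  define sgn' :: "real \<Rightarrow> real" where "sgn' x = (if 0 \<le> x then 1 else - 1)" for x
  have sgn': "\<bar>sgn' x\<bar> = 1" "x * sgn' x = \<bar>x\<bar>" for x by (auto simp: sgn'_def)
  have certificate: "\<exists>q. continuous_on UNIV q \<and> sint \<nu> q = (\<Sum>j<N. a j * q (t j)) \<and> (\<forall>x. \<bar>q x\<bar> \<le> 1)
      \<and> (\<forall>j<N. q (t j) = sgn' (b j)) \<and> (\<forall>x. x \<notin> t ` {..<N} \<longrightarrow> \<bar>q x\<bar> < 1)" for b :: "nat \<Rightarrow> real"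
  proof -
    obtain c q where q: "\<forall>x. q x = (\<Sum>p<S1. \<Sum>k<S2. c p k * gauss \<sigma> ((fst s1 + \<zeta> * real p, snd s1 + \<zeta> * real k) - x))"
      "\<forall>j<N. q (t j) = sgn' (b j)" "\<forall>x. x \<notin> t ` {..<N} \<longrightarrow> \<bar>q x\<bar> < 1"
      using dual_certificate[OF assms, of "\<lambda>j. sgn' (b j)", OF sgn'(1)] by (elim exE conjE) (rule that)
    have q_eq: "q = (\<lambda>x. \<Sum>p<S1. \<Sum>k<S2. c p k * gauss \<sigma> ((fst s1 + \<zeta> * real p, snd s1 + \<zeta> * real k) - x))"
      using q(1) by blast
    have "continuous_on UNIV q"
      unfolding q_eq by (intro continuous_intros continuous_on_gauss)
    moreover have "sint \<nu> q = (\<Sum>j<N. a j * q (t j))"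
      unfolding \<nu>_eq q_eq using \<nu> by (intro sint_grid_sum) (simp add: \<nu>_eq)
    moreover have "\<bar>q x\<bar> \<le> 1" for x
    proof (cases "x \<in> t ` {..<N}")
      case True
      then show ?thesis using q(2) sgn'(1) by auto
    qed (use q(3) less_imp_le in blast)
    ultimately show ?thesis using q(2,3) by blast
  qed
  obtain q where q: "continuous_on UNIV q" "sint \<nu> q = (\<Sum>j<N. a j * q (t j))" "\<And>x. \<bar>q x\<bar> \<le> 1"
    "\<And>j. j < N \<Longrightarrow> q (t j) = sgn' (a j)" "\<And>x. x \<notin> t ` {..<N} \<Longrightarrow> \<bar>q x\<bar> < 1"
    using certificate[of a] by blast
  have "sint \<nu> q = (\<Sum>j<N. \<bar>a j\<bar>)"
    unfolding q(2) by (intro sum.cong) (simp_all add: q(4) sgn'(2))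
  with TV_spikes_le have le: "TV (spikes N t a) \<le> sint \<nu> q" by metis
  also have "\<dots> \<le> TV \<nu>" unfolding \<nu>_eq by (intro sint_le_TV q)
  finally show "TV (spikes N t a) \<le> TV \<nu>" .
  assume "TV \<nu> \<le> TV (spikes N t a)"
  with le have max: "TV (M1, M2) \<le> sint (M1, M2) q" by (simp add: \<nu>_eq)
  have off: "emeasure M1 A = emeasure M2 A" if "A \<in> sets borel" "A \<inter> t ` {..<N} = {}" for A
    by (rule emeasure_eq_off_maximal[OF q(1,3) max that(1)]) (use that(2) q(5) in blast)
  define b where "b j = measure M1 {t j} - measure M2 {t j}" for j
  have sint_eq: "sint \<nu> f = (\<Sum>j<N. b j * f (t j))" if "f \<in> borel_measurable borel" "\<And>x. \<bar>f x\<bar> \<le> 1" for f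
  proof -
    have "sint (M1, M2) f = (\<Sum>x\<in>t ` {..<N}. (measure M1 {x} - measure M2 {x}) * f x)"
      by (rule sint_eq_sum[OF _ _ that]) (use off in auto)
    then show ?thesis by (simp add: \<nu>_eq b_def sum.reindex[OF assms(3)])
  qed
  \<comment> \<open>The integral of q' is computed twice: with weights b because \<nu> lives on the
    spikes, and with weights a because \<nu> is feasible. The difference is the sum of the |b j - a
    j|.\<close>
  obtain q' where q': "continuous_on UNIV q'" "sint \<nu> q' = (\<Sum>j<N. a j * q' (t j))" "\<And>x. \<bar>q' x\<bar> \<le> 1"
    "\<And>j. j < N \<Longrightarrow> q' (t j) = sgn' (b j - a j)"
    using certificate[of "\<lambda>j. b j - a j"] by blast
  have "(\<Sum>j<N. \<bar>b j - a j\<bar>) = (\<Sum>j<N. (b j - a j) * q' (t j))"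
    by (intro sum.cong) (simp_all add: q'(4) sgn'(2))
  also have "\<dots> = 0"
    using sint_eq[OF borel_measurable_continuous_onI[OF q'(1)] q'(3)] q'(2) by (simp add: left_diff_distrib sum_subtractf)
  finally have ab: "b j = a j" if "j < N" for j
    using that by (simp add: sum_nonneg_eq_0_iff)
  show "same_smeasure \<nu> (spikes N t a)"
    unfolding same_smeasure_def
  proof
    fix A :: "(real \<times> real) set" assume A: "A \<in> sets borel"
    have "measure (fst \<nu>) A - measure (snd \<nu>) A = sint \<nu> (indicator A)"
      using \<nu> A by (simp add: sint_indicator)
    also have "\<dots> = (\<Sum>j<N. b j * indicator A (t j))"
      using A by (intro sint_eq) (auto simp: indicator_def)
    also have "\<dots> = (\<Sum>j<N. a j * indicator A (t j))" by (simp add: ab)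
    also have "\<dots> = measure (fst (spikes N t a)) A - measure (snd (spikes N t a)) A"
      using A by (subst sint_indicator[symmetric, OF fin_signed_spikes]) (auto simp: sint_spikes)
    finally show "measure (fst \<nu>) A - measure (snd \<nu>) A = measure (fst (spikes N t a)) A - measure (snd (spikes N t a)) A" .
  qed
qed

end
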